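(* Let $\Phi_1\in\mathcal C(A_0,A_1)$, $\Phi_2\in\mathcal C(A'_0,A_1)$ and $\epsilon\ge0$, and let $\delta_{\rm pre}(\Phi_1\|\Phi_2)=\min_{\Lambda\in\mathcal C(A'_0,A_0)}\|\Phi_1\circ\Lambda-\Phi_2\|_\diamond$. The following are equivalent. (i) $\delta_{\rm pre}(\Phi_1\|\Phi_2)\le\epsilon$. (ii) For every finite-dimensional ancilla $R_0$ and every $\rho\in\mathfrak S(R_0A_1)$, $$\|(\mathrm{id}_{R_0}\otimes\Phi_2^{\mathsf T})(\rho)\|^\diamond_{A'_0|R_0}\le\|(\mathrm{id}_{R_0}\otimes\Phi_1^{\mathsf T})(\rho)\|^\diamond_{A_0|R_0}+\frac{\epsilon}{2}\|\rho\|^\diamond_{A_1|R_0}.$$ (iii) For every ancilla $R_0$, every ensemble $\mathcal E=\{\lambda_i,\rho_i\}_{i=1}^k$ on $R_0A_1$ and every measurement $M=(M_1,\dots,M_k)$ on $A_1A_1$, $$\sup_{\alpha\in\mathcal C(R_0,A'_0)}P_{\rm succ}\big(((\Phi_2\circ\alpha)\otimes\mathrm{id}_{A_1})(\mathcal E),M\big)\le\sup_{\alpha\in\mathcal C(R_0,A_0)}P_{\rm succ}\big(((\Phi_1\circ\alpha)\otimes\mathrm{id}_{A_1})(\mathcal E),M\big)+\frac{\epsilon}{2}P_{\rm succ}(\mathcal E).$$ Moreover, (i) is also equivalent to (ii), resp. (iii), required only for $R_0=A'_0$.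
   Context: Finite-dimensional systems; $\mathcal C(X,Y)$ channels; $\|\cdot\|_\diamond$ diamond norm. For $\phi:\mathcal B(X)\to\mathcal B(Y)$ hermitian linear, $\phi^*$ is its Hilbert–Schmidt adjoint and $\phi^{\mathsf T}(Z)=(\phi^*(Z^{\mathsf T}))^{\mathsf T}$ (transpose in fixed standard bases), so $\Phi^{\mathsf T}$ maps $\mathcal B(A_1)$ to the input space of $\Phi$. For $X\in\mathcal B_h(R_0B)$ and $\phi\in\mathcal L(R_0,B)$ set $\langle X,\phi\rangle={\rm Tr}[XC_{\phi^*}]$, where $C_{\psi}=(\psi\otimes\mathrm{id})(|I\rangle\rangle\langle\langle I|)$ is the Choi matrix, $|I\rangle\rangle=\sum_i|i\rangle|i\rangle$. For $\rho\in\mathcal B_+(R_0B)$, $\|\rho\|^\diamond_{B|R_0}=\max_{\alpha\in\mathcal C(R_0,B)}\langle\rho,\alpha\rangle=\min\{\lambda>0:\rho\le\lambda\sigma\otimes I_B,\ \sigma\in\mathfrak S(R_0)\}$. An ensemble $\mathcal E=\{\lambda_i,\rho_i\}_{i=1}^k$ on $X$: states $\rho_i$ with probabilities $\lambda_i$; for a map $\Psi$, $\Psi(\mathcal E)=\{\lambda_i,\Psi(\rho_i)\}$; a $k$-outcome measurement $M$: $M_i\ge0$, $\sum M_i=I$; $P_{\rm succ}(\mathcal E,M)=\sum_i\lambda_i{\rm Tr}[\rho_iM_i]$, $P_{\rm succ}(\mathcal E)=\max_MP_{\rm succ}(\mathcal E,M)$. In (iii), $\Phi\circ\alpha$ acts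 on the $R_0$ part and the output is measured together with the $A_1$ part of the ensemble. *)

theory Defs
  imports "Jordan_Normal_Form.Schur_Decomposition"
begin

(* Finite-dimensional quantum systems are identified with their dimensions
   (positive naturals). Operators on a d-dimensional system are complex d x d
   matrices. Linear maps B(X) -> B(Y) are HOL functions on complex matrices,
   only their behaviour on carrier_mat dX dX matters.
   Composite systems X Y have dimension dX * dY, with the standard
   (lexicographic) tensor basis |i>|j> = e_(i*dY + j). *)

type_synonym cmap = "complex mat \<Rightarrow> complex mat"

definition mtrace :: "complex mat \<Rightarrow> complex" where
  "mtrace A = (\<Sum>i<dim_row A. A $$ (i,i))"

definition transp :: "complex mat \<Rightarrow> complex mat" where
  "transp A = transpose_mat A"

definition munit :: "nat \<Rightarrow> nat \<Rightarrow> nat \<Rightarrow> complex mat" where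
  "munit d i j = mat d d (\<lambda>(a,b). if a = i \<and> b = j then 1 else 0)"

definition psd :: "nat \<Rightarrow> complex mat \<Rightarrow> bool" where
  "psd d A \<longleftrightarrow> A \<in> carrier_mat d d \<and>
     (\<forall>v \<in> carrier_vec d. ((A *\<^sub>v v) \<bullet> conjugate v) \<in> \<real> \<and> 0 \<le> Re ((A *\<^sub>v v) \<bullet> conjugate v))"

definition state :: "nat \<Rightarrow> complex mat \<Rightarrow> bool" where
  "state d \<rho> \<longleftrightarrow> psd d \<rho> \<and> mtrace \<rho> = 1"

definition trace_norm :: "complex mat \<Rightarrow> real" where
  "trace_norm A = Re (mtrace (THE B. psd (dim_col A) B \<and> B * B = mat_adjoint A * A))"

definition lin_map :: "nat \<Rightarrow> nat \<Rightarrow> cmap \<Rightarrow> bool" where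
  "lin_map dX dY \<phi> \<longleftrightarrow>
     (\<forall>A \<in> carrier_mat dX dX. \<phi> A \<in> carrier_mat dY dY) \<and>
     (\<forall>A \<in> carrier_mat dX dX. \<forall>B \<in> carrier_mat dX dX. \<phi> (A + B) = \<phi> A + \<phi> B) \<and>
     (\<forall>A \<in> carrier_mat dX dX. \<forall>c. \<phi> (c \<cdot>\<^sub>m A) = c \<cdot>\<^sub>m \<phi> A)"

definition id_tensor :: "nat \<Rightarrow> nat \<Rightarrow> nat \<Rightarrow> cmap \<Rightarrow> cmap" where
  "id_tensor dR dX dY \<phi> M = mat (dR * dY) (dR * dY) (\<lambda>(p,q).
      \<phi> (mat dX dX (\<lambda>(i,j). M $$ ((p div dY) * dX + i, (q div dY) * dX + j)))
        $$ (p mod dY, q mod dY))"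

definition tensor_id :: "nat \<Rightarrow> nat \<Rightarrow> nat \<Rightarrow> cmap \<Rightarrow> cmap" where
  "tensor_id dX dY dR \<phi> M = mat (dY * dR) (dY * dR) (\<lambda>(p,q).
      \<phi> (mat dX dX (\<lambda>(i,j). M $$ (i * dR + p mod dR, j * dR + q mod dR)))
        $$ (p div dR, q div dR))"

definition CP_map :: "nat \<Rightarrow> nat \<Rightarrow> cmap \<Rightarrow> bool" where
  "CP_map dX dY \<phi> \<longleftrightarrow>
     (\<forall>n>0. \<forall>P. psd (n * dX) P \<longrightarrow> psd (n * dY) (id_tensor n dX dY \<phi> P))"

definition TP_map :: "nat \<Rightarrow> nat \<Rightarrow> cmap \<Rightarrow> bool" where
  "TP_map dX dY \<phi> \<longleftrightarrow> (\<forall>A \<in> carrier_mat dX dX. mtrace (\<phi> A) = mtrace A)"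

definition channel :: "nat \<Rightarrow> nat \<Rightarrow> cmap \<Rightarrow> bool" where
  "channel dX dY \<phi> \<longleftrightarrow> lin_map dX dY \<phi> \<and> CP_map dX dY \<phi> \<and> TP_map dX dY \<phi>"

(* Hilbert-Schmidt adjoint \<phi>^dag : B(Y) -> B(X) of \<phi> : B(X) -> B(Y):
   <A, \<phi>^dag(Z)> = <\<phi>(A), Z>, so \<phi>^dag(Z)_(i,j) = <\<phi>(|i><j|), Z> *)
definition hs_adj :: "nat \<Rightarrow> nat \<Rightarrow> cmap \<Rightarrow> cmap" where
  "hs_adj dX dY \<phi> Z = mat dX dX (\<lambda>(i,j). mtrace (mat_adjoint (\<phi> (munit dX i j)) * Z))"

definition map_transp :: "nat \<Rightarrow> nat \<Rightarrow> cmap \<Rightarrow> cmap" where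
  "map_transp dX dY \<phi> Z = transp (hs_adj dX dY \<phi> (transp Z))"

(* |I>> = \<Sum>_i |i>|i> as a column matrix, and |I>><<I| *)
definition max_ent :: "nat \<Rightarrow> complex mat" where
  "max_ent d = mat (d * d) (d * d) (\<lambda>(p,q).
      if p div d = p mod d \<and> q div d = q mod d then 1 else 0)"

definition choi :: "nat \<Rightarrow> nat \<Rightarrow> cmap \<Rightarrow> complex mat" where
  "choi dX dY \<psi> = tensor_id dX dY dX \<psi> (max_ent dX)"

definition pairing :: "nat \<Rightarrow> nat \<Rightarrow> complex mat \<Rightarrow> cmap \<Rightarrow> complex" where
  "pairing dR dB X \<phi> = mtrace (X * choi dB dR (hs_adj dR dB \<phi>))"

definition cond_dnorm :: "nat \<Rightarrow> nat \<Rightarrow> complex mat \<Rightarrow> real" where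
  "cond_dnorm dR dB \<rho> = Sup {Re (pairing dR dB \<rho> \<alpha>) | \<alpha>. channel dR dB \<alpha>}"

definition dnorm :: "nat \<Rightarrow> nat \<Rightarrow> cmap \<Rightarrow> real" where
  "dnorm dX dY \<phi> = Sup {trace_norm (tensor_id dX dY dX \<phi> X) | X.
      X \<in> carrier_mat (dX * dX) (dX * dX) \<and> trace_norm X \<le> 1}"

definition delta_pre :: "nat \<Rightarrow> nat \<Rightarrow> nat \<Rightarrow> cmap \<Rightarrow> cmap \<Rightarrow> real" where
  "delta_pre dA0 dA0' dA1 \<Phi>1 \<Phi>2 =
     Inf {dnorm dA0' dA1 (\<lambda>X. \<Phi>1 (\<Lambda> X) - \<Phi>2 X) | \<Lambda>. channel dA0' dA0 \<Lambda>}"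

definition ensemble :: "nat \<Rightarrow> nat \<Rightarrow> (nat \<Rightarrow> real) \<Rightarrow> (nat \<Rightarrow> complex mat) \<Rightarrow> bool" where
  "ensemble d k lam rho \<longleftrightarrow>
     (\<forall>i<k. 0 \<le> lam i \<and> state d (rho i)) \<and> (\<Sum>i<k. lam i) = 1"

definition measurement :: "nat \<Rightarrow> nat \<Rightarrow> (nat \<Rightarrow> complex mat) \<Rightarrow> bool" where
  "measurement d k M \<longleftrightarrow> (\<forall>i<k. psd d (M i)) \<and> (\<forall>a<d. \<forall>b<d. (\<Sum>i<k. M i $$ (a,b)) = 1\<^sub>m d $$ (a,b))"

definition psucc :: "nat \<Rightarrow> (nat \<Rightarrow> real) \<Rightarrow> (nat \<Rightarrow> complex mat) \<Rightarrow> (nat \<Rightarrow> complex mat) \<Rightarrow> real" where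
  "psucc k lam rho M = (\<Sum>i<k. lam i * Re (mtrace (rho i * M i)))"

definition psucc_opt :: "nat \<Rightarrow> nat \<Rightarrow> (nat \<Rightarrow> real) \<Rightarrow> (nat \<Rightarrow> complex mat) \<Rightarrow> real" where
  "psucc_opt d k lam rho = Sup {psucc k lam rho M | M. measurement d k M}"

definition cond_ii :: "nat \<Rightarrow> nat \<Rightarrow> nat \<Rightarrow> cmap \<Rightarrow> cmap \<Rightarrow> real \<Rightarrow> nat \<Rightarrow> bool" where
  "cond_ii dA0 dA0' dA1 \<Phi>1 \<Phi>2 \<epsilon> dR \<longleftrightarrow>
     (\<forall>\<rho>. state (dR * dA1) \<rho> \<longrightarrow>
        cond_dnorm dR dA0' (id_tensor dR dA1 dA0' (map_transp dA0' dA1 \<Phi>2) \<rho>)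
        \<le> cond_dnorm dR dA0 (id_tensor dR dA1 dA0 (map_transp dA0 dA1 \<Phi>1) \<rho>)
           + \<epsilon> / 2 * cond_dnorm dR dA1 \<rho>)"

definition cond_iii :: "nat \<Rightarrow> nat \<Rightarrow> nat \<Rightarrow> cmap \<Rightarrow> cmap \<Rightarrow> real \<Rightarrow> nat \<Rightarrow> bool" where
  "cond_iii dA0 dA0' dA1 \<Phi>1 \<Phi>2 \<epsilon> dR \<longleftrightarrow>
     (\<forall>k lam rho M. ensemble (dR * dA1) k lam rho \<longrightarrow> measurement (dA1 * dA1) k M \<longrightarrow>
        Sup {psucc k lam (\<lambda>i. tensor_id dR dA1 dA1 (\<lambda>X. \<Phi>2 (\<alpha> X)) (rho i)) M
               | \<alpha>. channel dR dA0' \<alpha>}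
        \<le> Sup {psucc k lam (\<lambda>i. tensor_id dR dA1 dA1 (\<lambda>X. \<Phi>1 (\<alpha> X)) (rho i)) M
               | \<alpha>. channel dR dA0 \<alpha>}
          + \<epsilon> / 2 * psucc_opt (dR * dA1) k lam rho)"

end

theory Submission
  imports Defs "HOL-Analysis.Elementary_Metric_Spaces" "HOL-Analysis.L2_Norm"
begin

text \<open>
  Identify a map with its Choi kernel \<open>J\<close>, so that composition becomes the link product, and put
  \<open>\<langle>\<rho>, J\<rangle> = \<Sum> \<rho>\<^sub>p\<^sub>q J\<^sub>p\<^sub>q\<close>. Both sides of (ii) are then suprema of \<open>\<langle>\<rho>, \<Phi> \<circ> \<alpha>\<rangle>\<close> over channels \<open>\<alpha>\<close>, and so are
  those of (iii), with \<open>\<rho>\<close> the contraction of the ensemble with the measurement; pulling the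
  measurement back through a channel bounds the conditional norm of this contraction by the success
  probability of the ensemble.

  If (i) holds with the channel \<open>\<Lambda>\<close>, let \<open>\<alpha>\<close> act on \<open>\<rho>\<close> first, which does not increase the conditional
  norm \<open>\<lambda>\<close>. Duality gives \<open>\<rho> \<le> \<sigma> \<otimes> I\<close> with \<open>\<sigma>\<close> of trace \<open>\<lambda>\<close>, and a purification of \<open>\<sigma>\<close> turns
  \<open>\<langle>\<rho>, \<Phi>\<^sub>2 - \<Phi>\<^sub>1 \<circ> \<Lambda>\<rangle>\<close> into \<open>\<lambda>\<close> times the pairing of some \<open>0 \<le> \<tau> \<le> I\<close> with a traceless operator of trace
  norm at most \<open>\<epsilon>\<close>, which is at most \<open>\<lambda> \<epsilon> / 2\<close>.

  Conversely, if the bound holds for all states on \<open>A'\<^sub>0 A\<^sub>1\<close>, a minimax argument yields channels \<open>\<Lambda>\<close>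
  and \<open>\<gamma>\<close> such that \<open>\<Phi>\<^sub>1 \<circ> \<Lambda> + (\<epsilon> / 2) \<gamma> - \<Phi>\<^sub>2\<close> is almost positive, and this forces a diamond
  distance of about \<open>\<epsilon>\<close>. Condition (iii) covers every state, because its Weyl rotations, measured in
  the basis of maximally entangled vectors, contract to a multiple of the state.
\<close>

section \<open>Kernels on a finite index set\<close>

type_synonym 'i kernel = "'i \<Rightarrow> 'i \<Rightarrow> complex"

definition inner_on :: "'i set \<Rightarrow> ('i \<Rightarrow> complex) \<Rightarrow> ('i \<Rightarrow> complex) \<Rightarrow> complex" where
  "inner_on I u v = (\<Sum>p\<in>I. cnj (u p) * v p)"

definition kernel_app :: "'i set \<Rightarrow> 'i kernel \<Rightarrow> ('i \<Rightarrow> complex) \<Rightarrow> 'i \<Rightarrow> complex" where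
  "kernel_app I A v p = (\<Sum>q\<in>I. A p q * v q)"

definition pos_kernel :: "'i set \<Rightarrow> 'i kernel \<Rightarrow> bool" where
  "pos_kernel I A \<longleftrightarrow> (\<forall>v. 0 \<le> inner_on I v (kernel_app I A v))"

definition herm_kernel :: "'i set \<Rightarrow> 'i kernel \<Rightarrow> bool" where
  "herm_kernel I A \<longleftrightarrow> (\<forall>p\<in>I. \<forall>q\<in>I. A q p = cnj (A p q))"

definition kernel_le :: "'i set \<Rightarrow> 'i kernel \<Rightarrow> 'i kernel \<Rightarrow> bool" where
  "kernel_le I A B \<longleftrightarrow> pos_kernel I (\<lambda>p q. B p q - A p q)"

abbreviation kernel_one :: "'i kernel" where
  "kernel_one \<equiv> \<lambda>p q. of_bool (p = q)"

definition kernel_rank1 :: "('i \<Rightarrow> complex) \<Rightarrow> 'i kernel" where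
  "kernel_rank1 u p q = u p * cnj (u q)"

definition kernel_trace :: "'i set \<Rightarrow> 'i kernel \<Rightarrow> complex" where
  "kernel_trace I A = (\<Sum>p\<in>I. A p p)"

lemma sum_of_bool_mult [simp]:
  fixes f :: "'i \<Rightarrow> 'a :: semiring_1"
  assumes "finite I" "p \<in> I"
  shows "(\<Sum>q\<in>I. of_bool (p = q) * f q) = f p" "(\<Sum>q\<in>I. of_bool (q = p) * f q) = f p"
    "(\<Sum>q\<in>I. f q * of_bool (p = q)) = f p" "(\<Sum>q\<in>I. f q * of_bool (q = p)) = f p"
proof -
  have "I \<inter> {q. p = q} = {p}" "I \<inter> {q. q = p} = {p}" using assms(2) by auto
  then show "(\<Sum>q\<in>I. of_bool (p = q) * f q) = f p" "(\<Sum>q\<in>I. of_bool (q = p) * f q) = f p"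
    "(\<Sum>q\<in>I. f q * of_bool (p = q)) = f p" "(\<Sum>q\<in>I. f q * of_bool (q = p)) = f p"
    using assms(1) by simp_all
qed

lemma cnj_of_bool [simp]: "cnj (of_bool b) = of_bool b"
  by (cases b) auto

lemma inner_on_linear:
  "inner_on I (\<lambda>x. u x + u' x) v = inner_on I u v + inner_on I u' v"
  "inner_on I (\<lambda>x. u x - u' x) v = inner_on I u v - inner_on I u' v"
  "inner_on I (\<lambda>x. c * u x) v = cnj c * inner_on I u v"
  "inner_on I u (\<lambda>x. v x + v' x) = inner_on I u v + inner_on I u v'"
  "inner_on I u (\<lambda>x. v x - v' x) = inner_on I u v - inner_on I u v'"
  "inner_on I u (\<lambda>x. c * v x) = c * inner_on I u v"
  by (simp_all add: inner_on_def algebra_simps sum.distrib sum_subtractf sum_distrib_left)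

lemma inner_on_sum_right:
  "inner_on I u (\<lambda>x. \<Sum>j\<in>J. c j * v j x) = (\<Sum>j\<in>J. c j * inner_on I u (v j))"
  unfolding inner_on_def sum_distrib_left by (subst sum.swap) (simp add: mult_ac)

lemma inner_on_cong:
  assumes "\<And>p. p \<in> I \<Longrightarrow> u p = u' p" "\<And>p. p \<in> I \<Longrightarrow> v p = v' p"
  shows "inner_on I u v = inner_on I u' v'"
  using assms by (simp add: inner_on_def)

lemma inner_on_cnj: "cnj (inner_on I u v) = inner_on I v u"
  by (simp add: inner_on_def mult.commute)

lemma inner_on_self: "inner_on I u u = of_real (\<Sum>p\<in>I. (cmod (u p))\<^sup>2)"
  unfolding inner_on_def by (simp add: complex_norm_square mult.commute del: of_real_power)

lemma inner_on_self_nonneg: "0 \<le> inner_on I u u"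
  unfolding inner_on_self by (simp add: sum_nonneg less_eq_complex_def)

lemma inner_on_self_eq_0:
  assumes "finite I" "inner_on I u u = 0" "p \<in> I"
  shows "u p = 0"
proof -
  have "(\<Sum>p\<in>I. (cmod (u p))\<^sup>2) = 0"
    using assms(2) unfolding inner_on_self of_real_eq_0_iff .
  then show ?thesis using assms by (simp add: sum_nonneg_eq_0_iff)
qed

lemma norm_inner_on_le:
  "cmod (inner_on I u v) \<le> L2_set (\<lambda>p. cmod (u p)) I * L2_set (\<lambda>p. cmod (v p)) I"
proof -
  have "cmod (inner_on I u v) \<le> (\<Sum>p\<in>I. \<bar>cmod (u p)\<bar> * \<bar>cmod (v p)\<bar>)"
    unfolding inner_on_def by (rule order_trans[OF norm_sum]) (simp add: norm_mult)
  also have "\<dots> \<le> L2_set (\<lambda>p. cmod (u p)) I * L2_set (\<lambda>p. cmod (v p)) I"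
    by (rule L2_set_mult_ineq)
  finally show ?thesis .
qed

lemma tendsto_inner_on:
  assumes "\<And>p. p \<in> I \<Longrightarrow> ((\<lambda>n. u n p) \<longlongrightarrow> u' p) F" "\<And>p. p \<in> I \<Longrightarrow> ((\<lambda>n. v n p) \<longlongrightarrow> v' p) F"
  shows "((\<lambda>n. inner_on I (u n) (v n)) \<longlongrightarrow> inner_on I u' v') F"
  unfolding inner_on_def by (intro tendsto_intros assms)

lemma kernel_app_linear:
  "kernel_app I A (\<lambda>x. u x + v x) = (\<lambda>p. kernel_app I A u p + kernel_app I A v p)"
  "kernel_app I A (\<lambda>x. u x - v x) = (\<lambda>p. kernel_app I A u p - kernel_app I A v p)"
  "kernel_app I A (\<lambda>x. c * v x) = (\<lambda>p. c * kernel_app I A v p)"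
  "kernel_app I (\<lambda>p q. A p q + B p q) v = (\<lambda>p. kernel_app I A v p + kernel_app I B v p)"
  "kernel_app I (\<lambda>p q. A p q - B p q) v = (\<lambda>p. kernel_app I A v p - kernel_app I B v p)"
  "kernel_app I (\<lambda>p q. c * A p q) v = (\<lambda>p. c * kernel_app I A v p)"
  by (simp_all add: fun_eq_iff kernel_app_def algebra_simps sum.distrib sum_subtractf
    sum_distrib_left)

lemma kernel_app_one: "finite I \<Longrightarrow> p \<in> I \<Longrightarrow> kernel_app I kernel_one v p = v p"
  by (simp add: kernel_app_def)

lemma kernel_app_rank1: "kernel_app I (kernel_rank1 u) v p = u p * inner_on I u v"
  by (simp add: kernel_app_def kernel_rank1_def inner_on_def sum_distrib_left mult.assoc)

lemma kernel_app_sum_rank1: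
  "kernel_app I (\<lambda>p q. \<Sum>j\<in>J. kernel_rank1 (v j) p q) x p = (\<Sum>j\<in>J. v j p * inner_on I (v j) x)"
  unfolding kernel_app_rank1[symmetric]
  by (simp add: kernel_app_def sum_distrib_right) (rule sum.swap)

lemma inner_on_kernel_app: "inner_on I u (kernel_app I A v) = (\<Sum>p\<in>I. \<Sum>q\<in>I. cnj (u p) * A p q * v q)"
  by (simp add: inner_on_def kernel_app_def sum_distrib_left mult.assoc)

lemma inner_on_kernel_app_delta:
  assumes "finite I" "p \<in> I" "q \<in> I"
  shows "inner_on I (\<lambda>x. of_bool (x = p)) (kernel_app I A (\<lambda>x. of_bool (x = q))) = A p q"
  using assms by (simp add: inner_on_def kernel_app_def)

lemma kernel_app_self_adjoint:
  assumes "herm_kernel I A"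
  shows "inner_on I u (kernel_app I A v) = inner_on I (kernel_app I A u) v"
proof -
  have "inner_on I u (kernel_app I A v) = (\<Sum>q\<in>I. \<Sum>p\<in>I. cnj (u p) * A p q * v q)"
    unfolding inner_on_kernel_app by (rule sum.swap)
  also have "\<dots> = (\<Sum>q\<in>I. \<Sum>p\<in>I. cnj (A q p * u p) * v q)"
  proof (intro sum.cong refl)
    fix q p assume "q \<in> I" "p \<in> I"
    then have entry_adjoint: "A p q = cnj (A q p)" using assms unfolding herm_kernel_def by blast
    show "cnj (u p) * A p q * v q = cnj (A q p * u p) * v q" unfolding entry_adjoint by simp
  qed
  also have "\<dots> = inner_on I (kernel_app I A u) v"
    by (simp add: inner_on_def kernel_app_def sum_distrib_right)
  finally show ?thesis .
qed

lemma Im_herm_form: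
  assumes "herm_kernel I A"
  shows "Im (inner_on I v (kernel_app I A v)) = 0"
  using kernel_app_self_adjoint[OF assms, of v v] inner_on_cnj[of I v "kernel_app I A v"]
  by (simp add: complex_eq_iff)

lemma herm_kernel_add: "herm_kernel I A \<Longrightarrow> herm_kernel I B \<Longrightarrow> herm_kernel I (\<lambda>p q. A p q + B p q)"
  unfolding herm_kernel_def by (metis complex_cnj_add)

lemma herm_kernel_diff: "herm_kernel I A \<Longrightarrow> herm_kernel I B \<Longrightarrow> herm_kernel I (\<lambda>p q. A p q - B p q)"
  unfolding herm_kernel_def by (metis complex_cnj_diff)

lemma herm_kernel_scale: "herm_kernel I A \<Longrightarrow> herm_kernel I (\<lambda>p q. of_real c * A p q)"
  unfolding herm_kernel_def by (metis complex_cnj_mult complex_cnj_complex_of_real)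

lemma herm_kernel_one: "herm_kernel I kernel_one"
  by (auto simp: herm_kernel_def)

lemma herm_kernel_rank1: "herm_kernel I (kernel_rank1 u)"
  by (simp add: herm_kernel_def kernel_rank1_def mult.commute)

lemma herm_kernel_sum:
  assumes "\<And>k. k \<in> K \<Longrightarrow> herm_kernel I (A k)"
  shows "herm_kernel I (\<lambda>p q. \<Sum>k\<in>K. A k p q)"
  using assms unfolding herm_kernel_def cnj_sum by (blast intro: sum.cong)

lemma pos_kernelI_Re:
  assumes "herm_kernel I A" "\<And>v. 0 \<le> Re (inner_on I v (kernel_app I A v))"
  shows "pos_kernel I A"
  using assms Im_herm_form[OF assms(1)] by (simp add: pos_kernel_def less_eq_complex_def)

lemma pos_kernel_diag: "finite I \<Longrightarrow> pos_kernel I A \<Longrightarrow> p \<in> I \<Longrightarrow> 0 \<le> A p p"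
  unfolding pos_kernel_def by (metis inner_on_kernel_app_delta)

lemma pos_kernel_two_points:
  assumes "finite I" "pos_kernel I A" "p \<in> I" "q \<in> I"
  shows "0 \<le> A p p + c * A p q + cnj c * A q p + cnj c * c * A q q"
proof -
  let ?v = "\<lambda>x. of_bool (x = p) + c * of_bool (x = q)"
  have "0 \<le> inner_on I ?v (kernel_app I A ?v)" using assms(2) by (simp add: pos_kernel_def)
  then show ?thesis
    by (simp add: inner_on_linear kernel_app_linear inner_on_kernel_app_delta assms algebra_simps)
qed

lemma pos_kernel_herm:
  assumes "finite I" "pos_kernel I A"
  shows "herm_kernel I A"
  unfolding herm_kernel_def
proof (intro ballI)
  fix p q assume in_I: "p \<in> I" "q \<in> I"
  then have "0 \<le> A p p" "0 \<le> A q q" using pos_kernel_diag[OF assms] by auto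
  then show "A q p = cnj (A p q)"
    using pos_kernel_two_points[OF assms in_I, of 1] pos_kernel_two_points[OF assms in_I, of \<i>]
    by (auto simp: less_eq_complex_def complex_eq_iff)
qed

lemma pos_kernel_cong:
  assumes "pos_kernel I A" "\<And>p q. p \<in> I \<Longrightarrow> q \<in> I \<Longrightarrow> B p q = A p q"
  shows "pos_kernel I B"
  using assms unfolding pos_kernel_def inner_on_kernel_app by simp

lemma pos_kernel_zero: "pos_kernel I (\<lambda>p q. 0)"
  by (simp add: pos_kernel_def inner_on_kernel_app)

lemma pos_kernel_one: "finite I \<Longrightarrow> pos_kernel I kernel_one"
  by (simp add: pos_kernel_def inner_on_self_nonneg kernel_app_one cong: inner_on_cong)

lemma pos_kernel_rank1: "pos_kernel I (kernel_rank1 u)"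
proof -
  have "inner_on I v (kernel_app I (kernel_rank1 u) v) = cnj (inner_on I u v) * inner_on I u v"
    for v
    unfolding kernel_app_rank1 inner_on_cnj by (simp add: inner_on_def sum_distrib_right mult.assoc)
  then show ?thesis
    by (simp add: pos_kernel_def less_eq_complex_def mult.commute complex_mult_cnj)
qed

lemma pos_kernel_add: "pos_kernel I A \<Longrightarrow> pos_kernel I B \<Longrightarrow> pos_kernel I (\<lambda>p q. A p q + B p q)"
  by (simp add: pos_kernel_def kernel_app_linear inner_on_linear)

lemma pos_kernel_scale: "pos_kernel I A \<Longrightarrow> 0 \<le> c \<Longrightarrow> pos_kernel I (\<lambda>p q. of_real c * A p q)"
  by (simp add: pos_kernel_def kernel_app_linear inner_on_linear less_eq_complex_def)

lemma pos_kernel_sum: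
  assumes "\<And>k. k \<in> K \<Longrightarrow> pos_kernel I (A k)"
  shows "pos_kernel I (\<lambda>p q. \<Sum>k\<in>K. A k p q)"
  using assms by (induction K rule: infinite_finite_induct)
    (auto intro: pos_kernel_add pos_kernel_zero)

lemma nonneg_linear_coeff:
  fixes a b :: real
  assumes "\<And>t. 0 < t \<Longrightarrow> t \<le> 1 \<Longrightarrow> 0 \<le> t * a + t\<^sup>2 * b"
  shows "0 \<le> a"
proof (rule tendsto_lowerbound)
  show "((\<lambda>t. a + t * b) \<longlongrightarrow> a) (at_right 0)"
    by (rule tendsto_eq_intros refl | simp)+
  have "0 \<le> a + t * b" if "t \<in> {0<..<1}" for t
  proof -
    have "0 \<le> t * (a + t * b)" using that assms[of t] by (simp add: power2_eq_square algebra_simps)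
    then show ?thesis using that by (simp add: zero_le_mult_iff)
  qed
  then show "\<forall>\<^sub>F t in at_right 0. 0 \<le> a + t * b"
    using eventually_at_right_real[of 0 1] by (auto elim: eventually_mono)
qed simp

lemma pos_kernel_null_vector:
  assumes fin: "finite I" and A_pos: "pos_kernel I A"
    and null: "inner_on I u (kernel_app I A u) = 0"
    and "p \<in> I"
  shows "kernel_app I A u p = 0"
proof -
  let ?z = "kernel_app I A u"
  have self_adjoint: "inner_on I u (kernel_app I A ?z) = inner_on I ?z ?z"
    by (rule kernel_app_self_adjoint[OF pos_kernel_herm[OF fin A_pos]])
  have "0 \<le> t * (- 2 * Re (inner_on I ?z ?z)) + t\<^sup>2 * Re (inner_on I ?z (kernel_app I A ?z))" for t
  proof -
    have "0 \<le> inner_on I (\<lambda>x. u x - of_real t * ?z x) (kernel_app I A (\<lambda>x. u x - of_real t * ?z x))"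
      using A_pos by (simp add: pos_kernel_def)
    then show ?thesis
      by (simp add: inner_on_linear kernel_app_linear null self_adjoint less_eq_complex_def
        power2_eq_square algebra_simps)
  qed
  then have "0 \<le> - 2 * Re (inner_on I ?z ?z)" by (rule nonneg_linear_coeff)
  then have "inner_on I ?z ?z = 0"
    using inner_on_self_nonneg[of I ?z] by (simp add: less_eq_complex_def complex_eq_iff)
  then show ?thesis using inner_on_self_eq_0[OF fin] \<open>p \<in> I\<close> by blast
qed

section \<open>The spectral theorem\<close>

lemma bounded_pointwise_convergent_subseq:
  fixes x :: "nat \<Rightarrow> 'i \<Rightarrow> complex"
  assumes "finite I" "\<And>n p. p \<in> I \<Longrightarrow> cmod (x n p) \<le> b"
  obtains r l where "strict_mono (r :: nat \<Rightarrow> nat)" "\<And>p. p \<in> I \<Longrightarrow> (\<lambda>n. x (r n) p) \<longlonglongrightarrow> l p"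
proof -
  let ?proj = "\<lambda>u z. if snd z then Re (u (fst z)) else Im (u (fst z))"
  have "\<exists>l r. strict_mono (r :: nat \<Rightarrow> nat) \<and>
      (\<forall>e>0. \<forall>\<^sub>F n in sequentially. \<forall>z\<in>I \<times> UNIV. dist (?proj (x (r n)) z) (?proj l z) < e)"
  proof (rule compact_lemma_general[where unproj = "\<lambda>f p.
      Complex (f (p, True)) (f (p, False))", rule_format])
    fix z assume "z \<in> I \<times> (UNIV :: bool set)"
    then have "cmod (x n (fst z)) \<le> b" for n using assms(2) by auto
    then have "\<bar>?proj (x n) z\<bar> \<le> b" for n
      using abs_Re_le_cmod[of "x n (fst z)"] abs_Im_le_cmod[of "x n (fst z)"]
      by (auto intro: order_trans)
    then show "bounded ((\<lambda>u. ?proj u z) ` range x)" unfolding bounded_iff by fastforce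
  qed (use assms(1) in auto)
  then obtain l r where r_mono: "strict_mono (r :: nat \<Rightarrow> nat)"
    and lim: "\<And>e. 0 < e \<Longrightarrow>
      \<forall>\<^sub>F n in sequentially. \<forall>z\<in>I \<times> UNIV. dist (?proj (x (r n)) z) (?proj l z) < e" by blast
  have "(\<lambda>n. ?proj (x (r n)) z) \<longlonglongrightarrow> ?proj l z" if "z \<in> I \<times> UNIV" for z
    using that by (intro tendstoI eventually_mono[OF lim]) blast+
  from this[of "(_, True)"] this[of "(_, False)"] have "(\<lambda>n. x (r n) p) \<longlonglongrightarrow> l p" if "p \<in> I" for p
    using that by (simp add: tendsto_complex_iff)
  with r_mono show ?thesis by (rule that)
qed

lemma pointwise_limit_minimiser:
  fixes f :: "('i \<Rightarrow> complex) \<Rightarrow> real"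
  assumes fin: "finite I" and nonempty: "U \<noteq> {}"
    and bounded: "\<And>u p. u \<in> U \<Longrightarrow> p \<in> I \<Longrightarrow> cmod (u p) \<le> b"
    and continuous: "\<And>x l. (\<And>p. p \<in> I \<Longrightarrow> (\<lambda>n::nat. x n p) \<longlonglongrightarrow> l p) \<Longrightarrow> (\<lambda>n. f (x n)) \<longlonglongrightarrow> f l"
  obtains x l where "\<And>n. x n \<in> U" "\<And>p. p \<in> I \<Longrightarrow> (\<lambda>n::nat. x n p) \<longlonglongrightarrow> l p" "\<And>u. u \<in> U \<Longrightarrow> f l \<le> f u"
proof -
  have subseq: "\<exists>r l. strict_mono (r :: nat \<Rightarrow> nat) \<and> (\<forall>p\<in>I. (\<lambda>n. x (r n) p) \<longlonglongrightarrow> l p)"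
    if "\<And>n. x n \<in> U" for x
    using bounded_pointwise_convergent_subseq[OF fin, of x b] bounded that by metis
  have "bdd_below (f ` U)"
  proof (rule ccontr)
    assume "\<not> bdd_below (f ` U)"
    then have "\<exists>u\<in>U. f u < - real n" for n by (force simp: bdd_below_def not_le)
    then obtain x where seq: "\<And>n. x n \<in> U" "\<And>n. f (x n) < - real n" by metis
    obtain r l where r_mono: "strict_mono (r :: nat \<Rightarrow> nat)"
      and lim: "\<And>p. p \<in> I \<Longrightarrow> (\<lambda>n. x (r n) p) \<longlonglongrightarrow> l p"
      using subseq[of x] seq(1) by blast
    have "(\<lambda>n. f (x (r n))) \<longlonglongrightarrow> f l" by (rule continuous[OF lim])
    then have "Bseq (\<lambda>n. f (x (r n)))" by (rule convergent_imp_Bseq[OF convergentI])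
    then obtain K where "\<And>n. \<bar>f (x (r n))\<bar> \<le> K" by (auto simp: Bseq_def)
    moreover obtain n :: nat where "K < n" using reals_Archimedean2 by blast
    moreover have "n \<le> r n" by (rule seq_suble[OF r_mono])
    ultimately show False using seq(2)[of "r n"] by (smt (verit) of_nat_mono)
  qed
  then have "Inf (f ` U) \<in> closure (f ` U)" using nonempty by (intro closure_contains_Inf) auto
  then obtain y where min_seq: "\<And>n. y n \<in> f ` U" "y \<longlonglongrightarrow> Inf (f ` U)"
    unfolding closure_sequential by blast
  have "\<forall>n. \<exists>u\<in>U. y n = f u" using min_seq(1) by blast
  then obtain x where seq: "\<And>n. x n \<in> U" "\<And>n. y n = f (x n)" by metis
  obtain r l where r_mono: "strict_mono (r :: nat \<Rightarrow> nat)"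
    and lim: "\<And>p. p \<in> I \<Longrightarrow> (\<lambda>n. x (r n) p) \<longlonglongrightarrow> l p"
    using subseq[of x] seq(1) by blast
  have "(\<lambda>n. f (x (r n))) \<longlonglongrightarrow> f l" by (rule continuous[OF lim])
  moreover have "(\<lambda>n. f (x (r n))) \<longlonglongrightarrow> Inf (f ` U)"
    using LIMSEQ_subseq_LIMSEQ[OF min_seq(2) r_mono] by (simp add: o_def seq(2))
  ultimately have "f l = Inf (f ` U)" by (rule LIMSEQ_unique)
  then have "f l \<le> f u" if "u \<in> U" for u
    using \<open>bdd_below (f ` U)\<close> that by (simp add: cINF_lower)
  with seq(1) lim show ?thesis using that[of "\<lambda>n. x (r n)" l] by blast
qed

lemma unit_form_maximiser:
  assumes fin: "finite I" and "I \<noteq> {}"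
  obtains u where "inner_on I u u = 1"
    "\<And>w. inner_on I w w = 1 \<Longrightarrow>
        Re (inner_on I w (kernel_app I A w)) \<le> Re (inner_on I u (kernel_app I A u))"
proof -
  let ?f = "\<lambda>u. - Re (inner_on I u (kernel_app I A u))"
  obtain x u where unit_seq: "\<And>n. x n \<in> {u. inner_on I u u = 1}"
    and lim: "\<And>p. p \<in> I \<Longrightarrow> (\<lambda>n::nat. x n p) \<longlonglongrightarrow> u p"
    and minimal: "\<And>w. w \<in> {u. inner_on I u u = 1} \<Longrightarrow> ?f u \<le> ?f w"
  proof (rule pointwise_limit_minimiser[OF fin, of "{u. inner_on I u u = 1}" 1 ?f])
    obtain p where "p \<in> I" using \<open>I \<noteq> {}\<close> by blast
    then have "(\<lambda>x. of_bool (x = p)) \<in> {u. inner_on I u u = 1}" using fin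
      by (simp add: inner_on_def)
    then show "{u. inner_on I u u = 1} \<noteq> {}" by blast
    show "cmod (u p) \<le> 1" if "u \<in> {u. inner_on I u u = 1}" "p \<in> I" for u p
    proof -
      have "(cmod (u p))\<^sup>2 \<le> (\<Sum>p\<in>I. (cmod (u p))\<^sup>2)"
        using fin that(2) by (intro member_le_sum) auto
      also have "\<dots> = 1" using that(1) unfolding inner_on_self
        by (simp flip: of_real_power of_real_sum)
      finally show ?thesis by (simp add: power_le_one_iff)
    qed
    show "(\<lambda>n. ?f (y n)) \<longlonglongrightarrow> ?f l" if "\<And>p. p \<in> I \<Longrightarrow> (\<lambda>n. y n p) \<longlonglongrightarrow> l p" for y l
      unfolding kernel_app_def by (intro tendsto_intros tendsto_inner_on that)
  qed blast
  have "(\<lambda>n. inner_on I (x n) (x n)) \<longlonglongrightarrow> inner_on I u u" by (intro tendsto_inner_on lim)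
  then have "inner_on I u u = 1" using unit_seq by (simp add: LIMSEQ_const_iff)
  then show ?thesis using minimal that by simp
qed

lemma inner_on_scalar_minus_app:
  assumes "finite I"
  shows "inner_on I w (kernel_app I (\<lambda>p q. of_real \<kappa> * kernel_one p q - A p q) w)
    = of_real \<kappa> * inner_on I w w - inner_on I w (kernel_app I A w)"
  using assms by (simp add: kernel_app_linear kernel_app_one inner_on_linear cong: inner_on_cong)

lemma kernel_le_scalarI:
  assumes fin: "finite I" and herm: "herm_kernel I A"
    and unit_bound: "\<And>w. inner_on I w w = 1 \<Longrightarrow> Re (inner_on I w (kernel_app I A w)) \<le> \<kappa>"
  shows "kernel_le I A (\<lambda>p q. of_real \<kappa> * kernel_one p q)"
  unfolding kernel_le_def
proof (rule pos_kernelI_Re)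
  show "herm_kernel I (\<lambda>p q. of_real \<kappa> * kernel_one p q - A p q)"
    by (intro herm_kernel_diff herm_kernel_scale herm_kernel_one herm)
  fix w
  define s where "s = Re (inner_on I w w)"
  have norm: "inner_on I w w = of_real s" "0 \<le> s"
    using inner_on_self_nonneg[of I w] by (simp_all add: s_def less_eq_complex_def complex_eq_iff)
  show "0 \<le> Re (inner_on I w (kernel_app I (\<lambda>p q. of_real \<kappa> * kernel_one p q - A p q) w))"
  proof (cases "s = 0")
    case True
    then have "w p = 0" if "p \<in> I" for p using inner_on_self_eq_0[OF fin _ that] norm(1) by simp
    then show ?thesis by (simp add: inner_on_def)
  next
    case False
    let ?c = "complex_of_real (1 / sqrt s)"
    have scale_sq: "cnj ?c * (?c * z) = z / of_real s" for z
      using norm(2) False by (simp add: field_simps flip: of_real_mult)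
    have "Re (inner_on I (\<lambda>p. ?c * w p) (kernel_app I A (\<lambda>p. ?c * w p))) \<le> \<kappa>"
      by (rule unit_bound)
        (use False in \<open>simp add: inner_on_linear scale_sq norm(1) del: of_real_divide
          complex_cnj_complex_of_real\<close>)
    then have "Re (inner_on I w (kernel_app I A w)) / s \<le> \<kappa>"
      unfolding kernel_app_linear inner_on_linear scale_sq by simp
    then show ?thesis using norm False
      by (simp add: inner_on_scalar_minus_app[OF fin] pos_divide_le_eq)
  qed
qed

lemma herm_kernel_top_eigenvector:
  assumes fin: "finite I" and "I \<noteq> {}" and herm: "herm_kernel I A"
  obtains u \<kappa> where "inner_on I u u = 1" "\<And>p. p \<in> I \<Longrightarrow> kernel_app I A u p = of_real \<kappa> * u p"
    "kernel_le I A (\<lambda>p q. of_real \<kappa> * kernel_one p q)"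
proof -
  obtain u where unit: "inner_on I u u = 1" and maximal:
    "\<And>w. inner_on I w w = 1 \<Longrightarrow>
        Re (inner_on I w (kernel_app I A w)) \<le> Re (inner_on I u (kernel_app I A u))"
    by (rule unit_form_maximiser[OF fin \<open>I \<noteq> {}\<close>]) blast
  define \<kappa> where "\<kappa> = Re (inner_on I u (kernel_app I A u))"
  have dominated: "kernel_le I A (\<lambda>p q. of_real \<kappa> * kernel_one p q)"
    unfolding \<kappa>_def by (rule kernel_le_scalarI[OF fin herm maximal])
  have "inner_on I u (kernel_app I (\<lambda>p q. of_real \<kappa> * kernel_one p q - A p q) u) = 0"
    using Im_herm_form[OF herm, of u]
    by (simp add: inner_on_scalar_minus_app[OF fin] unit \<kappa>_def complex_eq_iff)
  then have "kernel_app I A u p = of_real \<kappa> * u p" if "p \<in> I" for p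
    using pos_kernel_null_vector[OF fin dominated[unfolded kernel_le_def] _ that, of u]
    by (simp add: kernel_app_linear kernel_app_one fin that)
  with unit show ?thesis using dominated by (rule that)
qed

definition onb :: "'i set \<Rightarrow> (nat \<Rightarrow> 'i \<Rightarrow> complex) \<Rightarrow> bool" where
  "onb I v \<longleftrightarrow> (\<forall>j<card I. \<forall>k<card I. inner_on I (v j) (v k) = of_bool (j = k)) \<and>
     (\<forall>p\<in>I. \<forall>q\<in>I. (\<Sum>j<card I. v j p * cnj (v j q)) = of_bool (p = q))"

definition eigenfamily :: "'i set \<Rightarrow> 'i kernel \<Rightarrow> nat \<Rightarrow> (nat \<Rightarrow> 'i \<Rightarrow> complex) \<Rightarrow> (nat \<Rightarrow> real) \<Rightarrow> bool"
  where
  "eigenfamily I A k v d \<longleftrightarrow>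
     (\<forall>i<k. \<forall>j<k. inner_on I (v i) (v j) = of_bool (i = j)) \<and>
     (\<forall>j<k. \<forall>p\<in>I. kernel_app I A (v j) p = of_real (d j) * v j p)"

lemma herm_kernel_eigenvectors_orthogonal:
  assumes "herm_kernel I A"
    and "\<And>p. p \<in> I \<Longrightarrow> kernel_app I A u p = of_real a * u p"
    and "\<And>p. p \<in> I \<Longrightarrow> kernel_app I A v p = of_real b * v p"
    and "a \<noteq> b"
  shows "inner_on I u v = 0"
proof -
  have "of_real b * inner_on I u v = inner_on I u (kernel_app I A v)"
    using assms(3) by (simp add: inner_on_linear cong: inner_on_cong)
  also have "\<dots> = inner_on I (kernel_app I A u) v" by (rule kernel_app_self_adjoint[OF assms(1)])
  also have "\<dots> = of_real a * inner_on I u v"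
    using assms(2) by (simp add: inner_on_linear cong: inner_on_cong)
  finally show ?thesis using assms(4) by simp
qed

text \<open>Subtracting a large multiple of the projection onto the eigenvectors already found pushes their
  eigenvalues below the top eigenvalue on the orthogonal complement.\<close>

lemma herm_kernel_next_eigenvector:
  assumes fin: "finite I" and herm: "herm_kernel I A" and family: "eigenfamily I A k v d"
    and w_nonzero: "inner_on I w w \<noteq> 0" and orth: "\<And>j. j < k \<Longrightarrow> inner_on I (v j) w = 0"
  obtains u \<mu> where "inner_on I u u = 1" "\<And>j. j < k \<Longrightarrow> inner_on I (v j) u = 0"
    "\<And>p. p \<in> I \<Longrightarrow> kernel_app I A u p = of_real \<mu> * u p"
proof -
  define r where "r = Re (inner_on I w (kernel_app I A w)) / Re (inner_on I w w)"
  define M where "M = (\<Sum>j<k. \<bar>d j\<bar>) + \<bar>r\<bar> + 1"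
  define B where "B p q = A p q - of_real M * (\<Sum>j<k. kernel_rank1 (v j) p q)" for p q
  have B_app: "kernel_app I B x p
      = kernel_app I A x p - of_real M * (\<Sum>j<k. v j p * inner_on I (v j) x)" for x p
    unfolding B_def kernel_app_linear kernel_app_sum_rank1 ..
  have B_herm: "herm_kernel I B"
    unfolding B_def
    by (intro herm_kernel_diff herm_kernel_scale herm_kernel_sum herm_kernel_rank1 herm)
  have B_eig: "kernel_app I B (v j) p = of_real (d j - M) * v j p" if "j < k" "p \<in> I" for j p
    using family that by (simp add: B_app eigenfamily_def algebra_simps)
  have "I \<noteq> {}" using w_nonzero by (auto simp: inner_on_def)
  then obtain u \<kappa> where u_unit: "inner_on I u u = 1"
    and u_eig: "\<And>p. p \<in> I \<Longrightarrow> kernel_app I B u p = of_real \<kappa> * u p"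
    and u_top: "kernel_le I B (\<lambda>p q. of_real \<kappa> * kernel_one p q)"
    using herm_kernel_top_eigenvector[OF fin _ B_herm] by metis
  have "r \<le> \<kappa>"
  proof -
    have "0 \<le> inner_on I w (kernel_app I (\<lambda>p q. of_real \<kappa> * kernel_one p q - B p q) w)"
      using u_top unfolding kernel_le_def pos_kernel_def by blast
    also have "\<dots> = of_real \<kappa> * inner_on I w w - inner_on I w (kernel_app I A w)"
      using fin orth
      by (simp add: kernel_app_linear kernel_app_one B_app inner_on_linear cong: inner_on_cong)
    finally have "Re (inner_on I w (kernel_app I A w)) \<le> \<kappa> * Re (inner_on I w w)"
      by (simp add: less_eq_complex_def)
    moreover have "0 < Re (inner_on I w w)"
      using w_nonzero inner_on_self_nonneg[of I w]
      by (auto simp: less_eq_complex_def complex_eq_iff)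
    ultimately show ?thesis by (simp add: r_def pos_divide_le_eq)
  qed
  have u_orth: "inner_on I (v j) u = 0" if "j < k" for j
  proof (rule herm_kernel_eigenvectors_orthogonal[OF B_herm B_eig[OF that] u_eig])
    have "\<bar>d j\<bar> \<le> (\<Sum>j<k. \<bar>d j\<bar>)" using that by (intro member_le_sum) auto
    then show "d j - M \<noteq> \<kappa>" using \<open>r \<le> \<kappa>\<close> by (simp add: M_def)
  qed
  have "kernel_app I A u p = of_real \<kappa> * u p" if "p \<in> I" for p
    using u_eig[OF that] by (simp add: B_app u_orth)
  with u_unit u_orth show ?thesis by (rule that)
qed

definition residual :: "nat \<Rightarrow> (nat \<Rightarrow> 'i \<Rightarrow> complex) \<Rightarrow> 'i kernel" where
  "residual k v p q = of_bool (p = q) - (\<Sum>j<k. v j p * cnj (v j q))"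

lemma inner_on_residual:
  assumes "finite I" "q \<in> I"
  shows "inner_on I u (\<lambda>p. residual k v p q) = cnj (u q) - (\<Sum>j<k. cnj (v j q) * inner_on I u (v j))"
proof -
  have "(\<lambda>p. residual k v p q) = (\<lambda>p. of_bool (p = q) - (\<Sum>j<k. cnj (v j q) * v j p))"
    by (simp add: residual_def mult.commute)
  then have "inner_on I u (\<lambda>p. residual k v p q)
      = inner_on I u (\<lambda>p. of_bool (p = q)) - inner_on I u (\<lambda>p. \<Sum>j<k. cnj (v j q) * v j p)"
    by (simp add: inner_on_linear)
  also have "inner_on I u (\<lambda>p. of_bool (p = q)) = cnj (u q)"
    using assms by (simp add: inner_on_def)
  finally show ?thesis by (simp add: inner_on_sum_right)
qed

lemma residual_orthogonal:
  assumes "finite I" "eigenfamily I A k v d" "q \<in> I" "j < k"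
  shows "inner_on I (v j) (\<lambda>p. residual k v p q) = 0"
  using assms by (simp add: inner_on_residual eigenfamily_def)

lemma inner_on_residual_self:
  assumes "finite I" "eigenfamily I A k v d" "q \<in> I"
  shows "inner_on I (\<lambda>p. residual k v p q) (\<lambda>p. residual k v p q) = residual k v q q"
proof -
  let ?r = "\<lambda>p. residual k v p q"
  have "inner_on I ?r (v j) = 0" if "j < k" for j
    using residual_orthogonal[OF assms that] by (metis complex_cnj_zero inner_on_cnj)
  then have "inner_on I ?r ?r = cnj (residual k v q q)"
    using assms by (simp add: inner_on_residual)
  then show ?thesis by (simp add: residual_def mult.commute)
qed

lemma trace_residual:
  assumes "finite I" "eigenfamily I A k v d"
  shows "(\<Sum>q\<in>I. residual k v q q) = of_nat (card I) - of_nat k"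
proof -
  have "(\<Sum>q\<in>I. \<Sum>j<k. v j q * cnj (v j q)) = (\<Sum>j<k. inner_on I (v j) (v j))"
    by (subst sum.swap) (simp add: inner_on_def mult.commute)
  also have "\<dots> = of_nat k" using assms(2) by (simp add: eigenfamily_def)
  finally show ?thesis by (simp add: residual_def sum_subtractf)
qed

lemma eigenfamily_exists:
  assumes fin: "finite I" and herm: "herm_kernel I A"
  shows "k \<le> card I \<Longrightarrow> \<exists>v d. eigenfamily I A k v d"
proof (induction k)
  case 0
  show ?case by (simp add: eigenfamily_def)
next
  case (Suc k)
  then obtain v d where family: "eigenfamily I A k v d" by auto
  have "(\<Sum>q\<in>I. residual k v q q) \<noteq> 0"
    unfolding trace_residual[OF fin family] using Suc.prems by (simp flip: of_nat_diff)
  then obtain q where residual_nonzero: "q \<in> I" "residual k v q q \<noteq> 0" by (meson sum.neutral)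
  let ?w = "\<lambda>p. residual k v p q"
  have "inner_on I ?w ?w \<noteq> 0" unfolding inner_on_residual_self[OF fin family residual_nonzero(1)]
    by (rule residual_nonzero(2))
  from herm_kernel_next_eigenvector[OF fin herm family this
    residual_orthogonal[OF fin family residual_nonzero(1)]]
  obtain u \<mu> where u_unit: "inner_on I u u = 1" "\<And>j. j < k \<Longrightarrow> inner_on I (v j) u = 0"
    "\<And>p. p \<in> I \<Longrightarrow> kernel_app I A u p = of_real \<mu> * u p" by metis
  have "inner_on I u (v j) = 0" if "j < k" for j
    using u_unit(2)[OF that] by (metis complex_cnj_zero inner_on_cnj)
  then have "eigenfamily I A (Suc k) (v(k := u)) (d(k := \<mu>))"
    using family u_unit unfolding eigenfamily_def by (auto simp: less_Suc_eq)
  then show ?case by blast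
qed

theorem herm_kernel_spectral:
  assumes fin: "finite I" and herm: "herm_kernel I A"
  obtains v d where "onb I v"
    "\<And>j p. j < card I \<Longrightarrow> p \<in> I \<Longrightarrow> kernel_app I A (v j) p = of_real (d j :: real) * v j p"
proof -
  obtain v d where family: "eigenfamily I A (card I) v d"
    using eigenfamily_exists[OF fin herm order_refl] by blast
  have nonneg: "0 \<le> residual (card I) v q q" if "q \<in> I" for q
    using inner_on_residual_self[OF fin family that] inner_on_self_nonneg by metis
  have "(\<Sum>q\<in>I. residual (card I) v q q) = 0" using trace_residual[OF fin family] by simp
  then have diag: "residual (card I) v q q = 0" if "q \<in> I" for q
    using sum_nonneg_eq_0_iff[OF fin nonneg] that by auto
  have "residual (card I) v p q = 0" if "p \<in> I" "q \<in> I" for p q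
    using inner_on_self_eq_0[OF fin _ that(1)] inner_on_residual_self[OF fin family that(2)]
      diag[OF that(2)] by metis
  then have "onb I v"
    using family by (simp add: onb_def eigenfamily_def residual_def)
  with family show ?thesis by (intro that) (auto simp: eigenfamily_def)
qed

lemma onb_expand:
  assumes "finite I" "onb I v" "p \<in> I" "q \<in> I"
  shows "A p q = (\<Sum>j<card I. kernel_app I A (v j) p * cnj (v j q))"
proof -
  have "A p q = (\<Sum>r\<in>I. A p r * of_bool (r = q))" using assms by simp
  also have "\<dots> = (\<Sum>r\<in>I. A p r * (\<Sum>j<card I. v j r * cnj (v j q)))"
    using assms by (intro sum.cong) (auto simp: onb_def)
  also have "\<dots> = (\<Sum>j<card I. kernel_app I A (v j) p * cnj (v j q))"
    unfolding kernel_app_def sum_distrib_left sum_distrib_right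
    by (subst sum.swap) (simp add: mult.assoc)
  finally show ?thesis .
qed

definition spectral_kernel :: "'i set \<Rightarrow> (nat \<Rightarrow> 'i \<Rightarrow> complex) \<Rightarrow> (nat \<Rightarrow> real) \<Rightarrow> 'i kernel" where
  "spectral_kernel I v d p q = (\<Sum>j<card I. of_real (d j) * kernel_rank1 (v j) p q)"

lemma kernel_trace_spectral_kernel:
  assumes "onb I v"
  shows "kernel_trace I (spectral_kernel I v d) = of_real (\<Sum>j<card I. d j)"
proof -
  have "kernel_trace I (spectral_kernel I v d)
      = (\<Sum>j<card I. of_real (d j) * inner_on I (v j) (v j))"
    unfolding kernel_trace_def spectral_kernel_def
    by (subst sum.swap) (simp add: kernel_rank1_def inner_on_def sum_distrib_left mult_ac)
  then show ?thesis using assms by (simp add: onb_def)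
qed

lemma pos_kernel_spectral_kernel:
  "(\<And>j. j < card I \<Longrightarrow> 0 \<le> d j) \<Longrightarrow> pos_kernel I (spectral_kernel I v d)"
  unfolding spectral_kernel_def[abs_def]
  by (intro pos_kernel_sum pos_kernel_scale pos_kernel_rank1) auto

lemma kernel_app_spectral_kernel:
  assumes "onb I v" "k < card I"
  shows "kernel_app I (spectral_kernel I v d) (v k) p = of_real (d k) * v k p"
proof -
  have "kernel_app I (spectral_kernel I v d) (v k) p
      = (\<Sum>j<card I. of_real (d j) * kernel_app I (kernel_rank1 (v j)) (v k) p)"
    unfolding kernel_app_def spectral_kernel_def sum_distrib_left sum_distrib_right
    by (subst sum.swap) (simp add: mult_ac)
  also have "\<dots> = (\<Sum>j<card I. of_real (d j) * v j p * of_bool (j = k))"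
    using assms by (intro sum.cong) (auto simp: kernel_app_rank1 onb_def)
  finally show ?thesis using assms(2) by simp
qed

lemma spectral_kernel_eqI:
  assumes "finite I" "onb I v" "p \<in> I" "q \<in> I"
    and "\<And>j p. j < card I \<Longrightarrow> p \<in> I \<Longrightarrow> kernel_app I A (v j) p = of_real (d j) * v j p"
  shows "A p q = spectral_kernel I v d p q"
  unfolding onb_expand[OF assms(1-4), of A] spectral_kernel_def kernel_rank1_def using assms(3,5)
  by (simp add: mult.assoc)

theorem pos_kernel_spectral:
  assumes "finite I" "pos_kernel I A"
  obtains v d where "onb I v" "\<And>j. j < card I \<Longrightarrow> 0 \<le> d j"
    "\<And>j p. j < card I \<Longrightarrow> p \<in> I \<Longrightarrow> kernel_app I A (v j) p = of_real (d j :: real) * v j p"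
    "\<And>p q. p \<in> I \<Longrightarrow> q \<in> I \<Longrightarrow> A p q = spectral_kernel I v d p q"
proof -
  obtain v d where onb: "onb I v"
    and eigen: "\<And>j p. j < card I \<Longrightarrow> p \<in> I \<Longrightarrow> kernel_app I A (v j) p = of_real (d j :: real) * v j p"
    using herm_kernel_spectral[OF assms(1) pos_kernel_herm[OF assms]] by metis
  have nonneg: "0 \<le> d j" if "j < card I" for j
  proof -
    have "0 \<le> inner_on I (v j) (kernel_app I A (v j))" using assms(2) by (simp add: pos_kernel_def)
    also have "\<dots> = of_real (d j)"
      using onb that by (simp add: eigen inner_on_linear onb_def cong: inner_on_cong)
    finally show ?thesis by (simp add: less_eq_complex_def)
  qed
  show ?thesis by (rule that[OF onb nonneg eigen spectral_kernel_eqI[OF assms(1) onb _ _ eigen]])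
qed

lemma pos_kernel_gramE:
  assumes "finite I" "pos_kernel I A"
  obtains g where "\<And>p q. p \<in> I \<Longrightarrow> q \<in> I \<Longrightarrow> A p q = (\<Sum>k<card I. kernel_rank1 (g k) p q)"
proof -
  obtain v d where nonneg: "\<And>j. j < card I \<Longrightarrow> 0 \<le> d j"
    and A_pos: "\<And>p q. p \<in> I \<Longrightarrow> q \<in> I \<Longrightarrow> A p q = spectral_kernel I v d p q"
    by (rule pos_kernel_spectral[OF assms]) blast
  have "of_real (d j) * kernel_rank1 (v j) p q
      = kernel_rank1 (\<lambda>p. of_real (sqrt (d j)) * v j p) p q"
    if "j < card I" for j p q
  proof -
    have "complex_of_real (d j) = of_real (sqrt (d j)) * of_real (sqrt (d j))"
      using nonneg[OF that] by (simp flip: of_real_mult)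
    then show ?thesis by (simp add: kernel_rank1_def mult_ac)
  qed
  then show ?thesis using that[of "\<lambda>j p. of_real (sqrt (d j)) * v j p"] A_pos
    by (simp add: spectral_kernel_def)
qed

section \<open>Operations on positive kernels\<close>

lemma pos_kernel_gramI:
  assumes "\<And>p q. p \<in> I \<Longrightarrow> q \<in> I \<Longrightarrow> A p q = (\<Sum>k\<in>K. kernel_rank1 (g k) p q)"
  shows "pos_kernel I A"
  by (rule pos_kernel_cong[OF pos_kernel_sum[where K = K and A = "\<lambda>k. kernel_rank1 (g k)"]])
    (use assms pos_kernel_rank1 in auto)

lemma pos_kernel_pullback:
  assumes "finite J" "pos_kernel J A" "f ` I \<subseteq> J"
  shows "pos_kernel I (\<lambda>p q. A (f p) (f q))"
proof -
  obtain g where gram: "\<And>p q. p \<in> J \<Longrightarrow> q \<in> J \<Longrightarrow> A p q = (\<Sum>k<card J. kernel_rank1 (g k) p q)"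
    using pos_kernel_gramE[OF assms(1,2)] by blast
  then have "A (f p) (f q) = (\<Sum>k<card J. kernel_rank1 (\<lambda>p. g k (f p)) p q)" if "p \<in> I" "q \<in> I"
    for p q
    using assms(3) that by (auto simp: kernel_rank1_def image_subset_iff)
  then show ?thesis by (rule pos_kernel_gramI)
qed

lemma pos_kernel_mult_rank1:
  assumes "pos_kernel I A"
  shows "pos_kernel I (\<lambda>p q. A p q * kernel_rank1 u p q)"
proof -
  have "inner_on I v (kernel_app I (\<lambda>p q. A p q * kernel_rank1 u p q) v)
      = inner_on I (\<lambda>p. cnj (u p) * v p) (kernel_app I A (\<lambda>p. cnj (u p) * v p))" for v
    by (simp add: inner_on_kernel_app kernel_rank1_def mult_ac)
  then show ?thesis using assms by (simp add: pos_kernel_def)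
qed

theorem pos_kernel_mult:
  assumes "finite I" "pos_kernel I A" "pos_kernel I B"
  shows "pos_kernel I (\<lambda>p q. A p q * B p q)"
proof -
  obtain g where gram: "\<And>p q. p \<in> I \<Longrightarrow> q \<in> I \<Longrightarrow> B p q = (\<Sum>k<card I. kernel_rank1 (g k) p q)"
    using pos_kernel_gramE[OF assms(1,3)] by blast
  have "pos_kernel I (\<lambda>p q. \<Sum>k<card I. A p q * kernel_rank1 (g k) p q)"
    by (intro pos_kernel_sum pos_kernel_mult_rank1 assms)
  then show ?thesis by (rule pos_kernel_cong) (simp add: gram sum_distrib_left)
qed

lemma pos_kernel_marginal:
  assumes "pos_kernel (I \<times> K) A"
  shows "pos_kernel I (\<lambda>p q. \<Sum>x\<in>K. \<Sum>y\<in>K. A (p, x) (q, y))"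
proof -
  have "inner_on I v (kernel_app I (\<lambda>p q. \<Sum>x\<in>K. \<Sum>y\<in>K. A (p, x) (q, y)) v)
      = inner_on (I \<times> K) (\<lambda>z. v (fst z)) (kernel_app (I \<times> K) A (\<lambda>z. v (fst z)))" for v
  proof -
    have "(\<Sum>q\<in>I. \<Sum>x\<in>K. \<Sum>y\<in>K. cnj (v p) * A (p, x) (q, y) * v q)
        = (\<Sum>x\<in>K. \<Sum>q\<in>I. \<Sum>y\<in>K. cnj (v p) * A (p, x) (q, y) * v q)" for p
      by (rule sum.swap)
    then show ?thesis
      by (simp add: inner_on_kernel_app sum.cartesian_product' sum_distrib_left sum_distrib_right)
  qed
  then show ?thesis using assms by (simp add: pos_kernel_def)
qed

definition kernel_transpose :: "'i kernel \<Rightarrow> 'i kernel" where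
  "kernel_transpose A p q = A q p"

lemma pos_kernel_transpose:
  assumes "pos_kernel I A"
  shows "pos_kernel I (kernel_transpose A)"
proof -
  have "inner_on I v (kernel_app I (kernel_transpose A) v)
      = inner_on I (\<lambda>p. cnj (v p)) (kernel_app I A (\<lambda>p. cnj (v p)))" for v
    unfolding inner_on_kernel_app kernel_transpose_def by (subst sum.swap) (simp add: mult_ac)
  then show ?thesis using assms by (simp add: pos_kernel_def)
qed

lemma norm_pos_kernel_le_trace:
  assumes "finite I" "pos_kernel I A" "p \<in> I" "q \<in> I"
  shows "cmod (A p q) \<le> Re (kernel_trace I A)"
proof -
  have diag: "Re (A x x) \<le> Re (kernel_trace I A)" if "x \<in> I" for x
    unfolding kernel_trace_def Re_sum using assms(1) that pos_kernel_diag[OF assms(1,2)]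
    by (intro member_le_sum) (auto simp: less_eq_complex_def)
  show ?thesis
  proof (cases "A p q = 0")
    case True
    then show ?thesis
      using diag[OF assms(3)] pos_kernel_diag[OF assms(1-3)] by (simp add: less_eq_complex_def)
  next
    case False
    define c where "c = - cnj (A p q) / of_real (cmod (A p q))"
    have "A p q * cnj (A p q) = of_real (cmod (A p q)) * of_real (cmod (A p q))"
      using complex_norm_square[of "A p q"] by (simp add: power2_eq_square)
    then have unit_phase: "c * A p q = - of_real (cmod (A p q))" "cnj c * c = 1"
      using False by (simp_all add: c_def divide_simps mult.commute)
    have "A q p = cnj (A p q)"
      using pos_kernel_herm[OF assms(1,2)] assms(3,4) unfolding herm_kernel_def by blast
    then have "cnj c * A q p = - of_real (cmod (A p q))"
      using arg_cong[OF unit_phase(1), of cnj] by simp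
    then have "2 * cmod (A p q) \<le> Re (A p p) + Re (A q q)"
      using pos_kernel_two_points[OF assms, of c] unfolding unit_phase
      by (simp add: less_eq_complex_def)
    with diag[OF assms(3)] diag[OF assms(4)] show ?thesis by simp
  qed
qed

definition kernel_pair :: "'i set \<Rightarrow> 'i kernel \<Rightarrow> 'i kernel \<Rightarrow> complex" where
  "kernel_pair I A C = (\<Sum>p\<in>I. \<Sum>q\<in>I. A p q * C p q)"

lemma kernel_pair_cong:
  assumes "\<And>p q. p \<in> I \<Longrightarrow> q \<in> I \<Longrightarrow> A p q = A' p q" "\<And>p q. p \<in> I \<Longrightarrow> q \<in> I \<Longrightarrow> C p q = C' p q"
  shows "kernel_pair I A C = kernel_pair I A' C'"
  unfolding kernel_pair_def using assms by simp

lemma kernel_pair_commute: "kernel_pair I A C = kernel_pair I C A"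
  by (simp add: kernel_pair_def mult.commute)

lemma kernel_pair_linear:
  "kernel_pair I A (\<lambda>p q. C p q + D p q) = kernel_pair I A C + kernel_pair I A D"
  "kernel_pair I A (\<lambda>p q. C p q - D p q) = kernel_pair I A C - kernel_pair I A D"
  "kernel_pair I A (\<lambda>p q. c * C p q) = c * kernel_pair I A C"
  by (simp_all add: kernel_pair_def algebra_simps sum.distrib sum_subtractf sum_distrib_left)

lemma kernel_pair_sum: "kernel_pair I A (\<lambda>p q. \<Sum>k\<in>K. C k p q) = (\<Sum>k\<in>K. kernel_pair I A (C k))"
proof -
  have "(\<Sum>p\<in>I. \<Sum>q\<in>I. \<Sum>k\<in>K. A p q * C k p q) = (\<Sum>p\<in>I. \<Sum>k\<in>K. \<Sum>q\<in>I. A p q * C k p q)"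
    by (intro sum.cong refl sum.swap)
  also have "\<dots> = (\<Sum>k\<in>K. \<Sum>p\<in>I. \<Sum>q\<in>I. A p q * C k p q)" by (rule sum.swap)
  finally show ?thesis by (simp add: kernel_pair_def sum_distrib_left)
qed

lemma kernel_pair_prod:
  "kernel_pair (R \<times> S) A C
      = (\<Sum>i\<in>R. \<Sum>j\<in>R. kernel_pair S (\<lambda>a b. A (i, a) (j, b)) (\<lambda>a b. C (i, a) (j, b)))"
  unfolding kernel_pair_def sum.cartesian_product' by (intro sum.cong refl sum.swap)

lemma kernel_pair_adjoint_blocks:
  assumes "herm_kernel (R \<times> S) A" "herm_kernel (R \<times> S) C" "i \<in> R" "j \<in> R"
  shows "kernel_pair S (\<lambda>a b. A (j, a) (i, b)) (\<lambda>a b. C (j, a) (i, b))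
    = cnj (kernel_pair S (\<lambda>a b. A (i, a) (j, b)) (\<lambda>a b. C (i, a) (j, b)))"
proof -
  have "A (j, b) (i, a) * C (j, b) (i, a) = cnj (A (i, a) (j, b) * C (i, a) (j, b))"
    if "a \<in> S" "b \<in> S" for a b
  proof -
    have "A (j, b) (i, a) = cnj (A (i, a) (j, b))" "C (j, b) (i, a) = cnj (C (i, a) (j, b))"
      using assms that unfolding herm_kernel_def by blast+
    then show ?thesis by simp
  qed
  then show ?thesis unfolding kernel_pair_def cnj_sum by (subst sum.swap) simp
qed

lemma kernel_pair_one: "finite I \<Longrightarrow> kernel_pair I A kernel_one = kernel_trace I A"
  by (simp add: kernel_pair_def kernel_trace_def)

lemma kernel_pair_nonneg:
  assumes "finite I" "pos_kernel I A" "pos_kernel I C"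
  shows "0 \<le> kernel_pair I A C"
proof -
  have "kernel_pair I A C = inner_on I (\<lambda>_. 1) (kernel_app I (\<lambda>p q. A p q * C p q) (\<lambda>_. 1))"
    by (simp add: kernel_pair_def inner_on_kernel_app)
  then show ?thesis using pos_kernel_mult[OF assms] by (simp add: pos_kernel_def)
qed

lemma kernel_pair_mono:
  assumes "finite I" "pos_kernel I A" "kernel_le I C D"
  shows "Re (kernel_pair I A C) \<le> Re (kernel_pair I A D)"
  using kernel_pair_nonneg[OF assms(1,2) assms(3)[unfolded kernel_le_def]]
  by (simp add: kernel_pair_linear less_eq_complex_def)

lemma kernel_pair_le_trace:
  assumes "finite I" "pos_kernel I C"
  shows "Re (kernel_pair I A C) \<le> (\<Sum>p\<in>I. \<Sum>q\<in>I. cmod (A p q)) * Re (kernel_trace I C)"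
proof -
  have "Re (kernel_pair I A C) \<le> cmod (kernel_pair I A C)" by (rule complex_Re_le_cmod)
  also have "\<dots> \<le> (\<Sum>p\<in>I. \<Sum>q\<in>I. cmod (A p q * C p q))"
    unfolding kernel_pair_def by (intro order_trans[OF norm_sum] sum_mono order_refl)
  also have "\<dots> \<le> (\<Sum>p\<in>I. \<Sum>q\<in>I. cmod (A p q) * Re (kernel_trace I C))"
    using norm_pos_kernel_le_trace[OF assms] by (intro sum_mono)
      (simp add: norm_mult mult_left_mono)
  finally show ?thesis by (simp add: sum_distrib_right)
qed

section \<open>Separation from the positive cone\<close>

lemma minimal_norm_limit:
  assumes fin: "finite X" and "C \<noteq> {}"
  obtains x w where "\<And>n. x n \<in> C" "\<And>i. i \<in> X \<Longrightarrow> (\<lambda>n::nat. x n i) \<longlonglongrightarrow> w i"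
    "\<And>u. u \<in> C \<Longrightarrow> Re (inner_on X w w) \<le> Re (inner_on X u u)"
proof -
  define N where "N u = Re (inner_on X u u)" for u
  obtain x0 where "x0 \<in> C" using \<open>C \<noteq> {}\<close> by blast
  obtain x w where seq: "\<And>n. x n \<in> {u \<in> C. N u \<le> N x0}"
    and lim: "\<And>i. i \<in> X \<Longrightarrow> (\<lambda>n::nat. x n i) \<longlonglongrightarrow> w i"
    and minimal: "\<And>u. u \<in> {u \<in> C. N u \<le> N x0} \<Longrightarrow> N w \<le> N u"
  proof (rule pointwise_limit_minimiser[OF fin, of "{u \<in> C. N u \<le> N x0}" "sqrt (N x0)" N])
    show "cmod (u i) \<le> sqrt (N x0)" if "u \<in> {u \<in> C. N u \<le> N x0}" "i \<in> X" for u i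
    proof (rule real_le_rsqrt)
      have "(cmod (u i))\<^sup>2 \<le> (\<Sum>i\<in>X. (cmod (u i))\<^sup>2)" using fin that(2) by (intro member_le_sum) auto
      then show "(cmod (u i))\<^sup>2 \<le> N x0" using that(1) by (simp add: N_def inner_on_self)
    qed
    show "(\<lambda>n. N (y n)) \<longlonglongrightarrow> N l" if "\<And>i. i \<in> X \<Longrightarrow> (\<lambda>n. y n i) \<longlonglongrightarrow> l i" for y l
      unfolding N_def by (intro tendsto_intros tendsto_inner_on that)
  qed (use \<open>x0 \<in> C\<close> in auto)
  have "N w \<le> N u" if "u \<in> C" for u
    using minimal[of u] minimal[of x0] that \<open>x0 \<in> C\<close> by (cases "N u \<le> N x0") auto
  then show ?thesis using that[of x w] seq lim by (simp add: N_def)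
qed

lemma convex_nearest_point:
  fixes C :: "('i \<Rightarrow> complex) set"
  assumes "finite X" "C \<noteq> {}"
    and convex: "\<And>x y t. x \<in> C \<Longrightarrow> y \<in> C \<Longrightarrow> 0 \<le> t \<Longrightarrow> t \<le> 1 \<Longrightarrow>
      (\<lambda>i. of_real (1 - t) * x i + of_real t * y i) \<in> C"
  obtains x w where "\<And>n. x n \<in> C" "\<And>i. i \<in> X \<Longrightarrow> (\<lambda>n::nat. x n i) \<longlonglongrightarrow> w i"
    "\<And>y. y \<in> C \<Longrightarrow> Re (inner_on X w w) \<le> Re (inner_on X w y)"
proof -
  define N where "N u = Re (inner_on X u u)" for u
  obtain x w where seq: "\<And>n. x n \<in> C" and lim: "\<And>i. i \<in> X \<Longrightarrow> (\<lambda>n::nat. x n i) \<longlonglongrightarrow> w i"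
    and minimal: "\<And>u. u \<in> C \<Longrightarrow> N w \<le> N u"
    unfolding N_def by (rule minimal_norm_limit[OF assms(1,2)]) blast
  have "N w \<le> Re (inner_on X w y)" if "y \<in> C" for y
  proof -
    let ?z = "\<lambda>i. y i - w i"
    have "0 \<le> t * (2 * Re (inner_on X w ?z)) + t\<^sup>2 * N ?z" if "0 < t" "t \<le> 1" for t
    proof -
      have "N w \<le> N (\<lambda>i. of_real (1 - t) * w i + of_real t * y i)"
      proof (rule LIMSEQ_le_const)
        show "(\<lambda>n. N (\<lambda>i. of_real (1 - t) * x n i + of_real t * y i)) \<longlonglongrightarrow>
            N (\<lambda>i. of_real (1 - t) * w i + of_real t * y i)"
          unfolding N_def by (intro tendsto_intros tendsto_inner_on lim)
        show "\<exists>m. \<forall>n\<ge>m. N w \<le> N (\<lambda>i. of_real (1 - t) * x n i + of_real t * y i)"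
          using minimal convex[OF seq \<open>y \<in> C\<close>] that by simp
      qed
      also have "(\<lambda>i. of_real (1 - t) * w i + of_real t * y i) = (\<lambda>i. w i + of_real t * ?z i)"
        by (simp add: algebra_simps)
      also have "N \<dots> = N w + t * (Re (inner_on X w ?z) + Re (inner_on X ?z w)) + t\<^sup>2 * N ?z"
        unfolding N_def inner_on_linear(1,3,4,6) by (simp add: power2_eq_square algebra_simps)
      also have "Re (inner_on X ?z w) = Re (inner_on X w ?z)"
        using arg_cong[OF inner_on_cnj[of X w ?z], of Re] by simp
      finally show ?thesis by simp
    qed
    then have "0 \<le> 2 * Re (inner_on X w ?z)" by (rule nonneg_linear_coeff)
    then show ?thesis by (simp add: inner_on_linear N_def)
  qed
  with seq lim show ?thesis using that[of x w] by (simp add: N_def)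
qed

definition kernel_convex :: "'i kernel set \<Rightarrow> bool" where
  "kernel_convex C \<longleftrightarrow> (\<forall>A\<in>C. \<forall>B\<in>C. \<forall>t::real. 0 \<le> t \<longrightarrow> t \<le> 1 \<longrightarrow>
     (\<lambda>p q. of_real (1 - t) * A p q + of_real t * B p q) \<in> C)"

lemma kernel_convexD:
  "kernel_convex C \<Longrightarrow> A \<in> C \<Longrightarrow> B \<in> C \<Longrightarrow> 0 \<le> t \<Longrightarrow> t \<le> 1 \<Longrightarrow>
    (\<lambda>p q. of_real (1 - t) * A p q + of_real t * B p q) \<in> C"
  by (simp add: kernel_convex_def)

lemma inner_on_case_prod:
  "inner_on (I \<times> I) (case_prod A) (case_prod B) = kernel_pair I (\<lambda>p q. cnj (A p q)) B"
  by (simp add: inner_on_def kernel_pair_def sum.cartesian_product')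

lemma pos_kernelI_pair:
  assumes "herm_kernel I A" "\<And>P. pos_kernel I P \<Longrightarrow> 0 \<le> Re (kernel_pair I A P)"
  shows "pos_kernel I A"
proof (rule pos_kernelI_Re[OF assms(1)])
  fix v
  have "kernel_pair I A (kernel_rank1 (\<lambda>p. cnj (v p))) = inner_on I v (kernel_app I A v)"
    by (simp add: kernel_pair_def kernel_rank1_def inner_on_kernel_app mult_ac)
  then show "0 \<le> Re (inner_on I v (kernel_app I A v))"
    using assms(2)[OF pos_kernel_rank1] by metis
qed

definition state_kernel :: "'i set \<Rightarrow> 'i kernel \<Rightarrow> bool" where
  "state_kernel I \<rho> \<longleftrightarrow> pos_kernel I \<rho> \<and> kernel_trace I \<rho> = 1"

lemma pos_kernel_normalise:
  assumes fin: "finite I" and A_pos: "pos_kernel I A" and nonzero: "kernel_pair I A C \<noteq> 0"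
  obtains \<tau> :: real where "0 < \<tau>" "kernel_trace I (\<lambda>p q. of_real (1 / \<tau>) * A p q) = 1"
proof -
  have "0 \<le> kernel_trace I A"
    unfolding kernel_trace_def using pos_kernel_diag[OF fin A_pos] by (rule sum_nonneg)
  then obtain \<tau> where trace_eq: "kernel_trace I A = of_real \<tau>" "0 \<le> \<tau>"
    by (metis less_eq_complex_def complex_is_Real_iff of_real_Re zero_complex.sel)
  have "\<tau> \<noteq> 0"
  proof
    assume "\<tau> = 0"
    then have "A p q = 0" if "p \<in> I" "q \<in> I" for p q
      using norm_pos_kernel_le_trace[OF fin A_pos that] by (simp add: trace_eq(1))
    then show False using nonzero by (simp add: kernel_pair_def)
  qed
  moreover have "kernel_trace I (\<lambda>p q. of_real (1 / \<tau>) * A p q)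
      = of_real (1 / \<tau>) * kernel_trace I A"
    by (simp add: kernel_trace_def sum_distrib_left)
  ultimately show ?thesis using trace_eq by (intro that) auto
qed

lemma pos_kernelI_pair_bounded_below:
  assumes herm: "herm_kernel I Y" and bounded: "\<And>Q. pos_kernel I Q \<Longrightarrow> b \<le> Re (kernel_pair I Y Q)"
  shows "pos_kernel I Y"
proof (rule pos_kernelI_pair[OF herm])
  fix Q assume Q_pos: "pos_kernel I Q"
  show "0 \<le> Re (kernel_pair I Y Q)"
  proof (rule ccontr)
    define a where "a = Re (kernel_pair I Y Q)"
    assume "\<not> 0 \<le> Re (kernel_pair I Y Q)"
    then have "a < 0" by (simp add: a_def)
    then have "b \<le> Re (kernel_pair I Y (\<lambda>p q. of_real ((\<bar>b\<bar> + 1) / - a) * Q p q))"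
      by (intro bounded pos_kernel_scale Q_pos) (simp add: divide_nonneg_neg)
    also have "\<dots> = - (\<bar>b\<bar> + 1)"
      unfolding kernel_pair_linear using \<open>a < 0\<close> by (simp add: a_def)
    finally show False by simp
  qed
qed

lemma convex_kernel_differences:
  assumes "kernel_convex C" and D_eq: "D = {\<lambda>(p, q). A p q - P p q | A P. A \<in> C \<and> pos_kernel I P}"
    and "x \<in> D" "y \<in> D" and t_bounds: "0 \<le> t" "t \<le> 1"
  shows "(\<lambda>i. of_real (1 - t) * x i + of_real t * y i) \<in> D"
proof -
  obtain A P B Q where A_in: "A \<in> C" "pos_kernel I P" and x_eq: "x = (\<lambda>(p, q). A p q - P p q)"
    and B_in: "B \<in> C" "pos_kernel I Q" and y_eq: "y = (\<lambda>(p, q). B p q - Q p q)"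
    using \<open>x \<in> D\<close> \<open>y \<in> D\<close> unfolding D_eq by blast
  have "pos_kernel I (\<lambda>p q. of_real (1 - t) * P p q + of_real t * Q p q)"
    using t_bounds by (intro pos_kernel_add pos_kernel_scale A_in B_in) auto
  moreover have "(\<lambda>i. of_real (1 - t) * x i + of_real t * y i) = (\<lambda>(p, q).
      (of_real (1 - t) * A p q + of_real t * B p q)
          - (of_real (1 - t) * P p q + of_real t * Q p q))"
    by (simp add: x_eq y_eq fun_eq_iff algebra_simps)
  moreover have "(\<lambda>p q. of_real (1 - t) * A p q + of_real t * B p q) \<in> C"
    by (rule kernel_convexD[OF assms(1) A_in(1) B_in(1) t_bounds])
  ultimately show ?thesis unfolding D_eq mem_Collect_eq by (intro exI conjI)
qed

lemma herm_kernel_limit: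
  assumes "\<And>n. herm_kernel I (A n)" "\<And>p q. p \<in> I \<Longrightarrow> q \<in> I \<Longrightarrow> (\<lambda>n::nat. A n p q) \<longlonglongrightarrow> W p q"
  shows "herm_kernel I W"
  unfolding herm_kernel_def
proof (intro ballI)
  fix p q assume "p \<in> I" "q \<in> I"
  then have "A n q p = cnj (A n p q)" for n using assms(1) unfolding herm_kernel_def by blast
  then have "(\<lambda>n. A n q p) \<longlonglongrightarrow> cnj (W p q)" using tendsto_cnj[OF assms(2)] \<open>p \<in> I\<close> \<open>q \<in> I\<close> by simp
  then show "W q p = cnj (W p q)" using LIMSEQ_unique assms(2) \<open>p \<in> I\<close> \<open>q \<in> I\<close> by blast
qed

lemma nearest_kernel_difference:
  assumes fin: "finite I" and "C \<noteq> {}" and convex: "kernel_convex C"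
    and herm: "\<And>A. A \<in> C \<Longrightarrow> herm_kernel I A"
    and gap: "\<And>A P. A \<in> C \<Longrightarrow> pos_kernel I P \<Longrightarrow>
      \<mu> \<le> Re (inner_on (I \<times> I) (\<lambda>(p, q). A p q - P p q) (\<lambda>(p, q). A p q - P p q))"
  obtains W where "herm_kernel I (\<lambda>p q. W (p, q))"
    "\<And>A P. A \<in> C \<Longrightarrow> pos_kernel I P \<Longrightarrow> \<mu> \<le> Re (inner_on (I \<times> I) W (\<lambda>(p, q). A p q - P p q))"
proof -
  define D where "D = {\<lambda>(p, q). A p q - P p q | A P. A \<in> C \<and> pos_kernel I P}"
  obtain x w where seq: "\<And>n. x n \<in> D" and lim: "\<And>z. z \<in> I \<times> I \<Longrightarrow> (\<lambda>n::nat. x n z) \<longlonglongrightarrow> w z"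
    and nearest: "\<And>z. z \<in> D \<Longrightarrow> Re (inner_on (I \<times> I) w w) \<le> Re (inner_on (I \<times> I) w z)"
  proof (rule convex_nearest_point[of "I \<times> I" D])
    show "D \<noteq> {}" unfolding D_def using \<open>C \<noteq> {}\<close> pos_kernel_zero by blast
    show "(\<lambda>i. of_real (1 - t) * x i + of_real t * y i) \<in> D" if "x \<in> D" "y \<in> D" "0 \<le> t" "t \<le> 1"
      for x y t
      by (rule convex_kernel_differences[OF convex D_def that])
  qed (use fin in auto)
  have seq_herm: "herm_kernel I (\<lambda>p q. x n (p, q))"
    and seq_gap: "\<mu> \<le> Re (inner_on (I \<times> I) (x n) (x n))" for n
  proof -
    obtain A P where x_eq: "x n = (\<lambda>(p, q). A p q - P p q)" and "A \<in> C" "pos_kernel I P"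
      using seq[of n] unfolding D_def by blast
    show "herm_kernel I (\<lambda>p q. x n (p, q))"
      using herm_kernel_diff[OF herm[OF \<open>A \<in> C\<close>] pos_kernel_herm[OF fin \<open>pos_kernel I P\<close>]]
      by (simp add: x_eq)
    show "\<mu> \<le> Re (inner_on (I \<times> I) (x n) (x n))"
      unfolding x_eq by (rule gap) fact+
  qed
  have w_herm: "herm_kernel I (\<lambda>p q. w (p, q))"
    by (rule herm_kernel_limit[OF seq_herm lim]) simp
  show ?thesis
  proof (rule that[OF w_herm])
    fix A P assume "A \<in> C" "pos_kernel I P"
    have "\<mu> \<le> Re (inner_on (I \<times> I) w w)"
    proof (rule LIMSEQ_le_const)
      show "(\<lambda>n. Re (inner_on (I \<times> I) (x n) (x n))) \<longlonglongrightarrow> Re (inner_on (I \<times> I) w w)"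
        by (intro tendsto_intros tendsto_inner_on lim)
    qed (use seq_gap in simp)
    also have "\<dots> \<le> Re (inner_on (I \<times> I) w (\<lambda>(p, q). A p q - P p q))"
      using \<open>A \<in> C\<close> \<open>pos_kernel I P\<close> by (intro nearest) (auto simp: D_def)
    finally show "\<mu> \<le> Re (inner_on (I \<times> I) w (\<lambda>(p, q). A p q - P p q))" .
  qed
qed

lemma pos_kernel_gap_functional:
  assumes "finite I" "C \<noteq> {}" "kernel_convex C" "\<And>A. A \<in> C \<Longrightarrow> herm_kernel I A"
    and "\<And>A P. A \<in> C \<Longrightarrow> pos_kernel I P \<Longrightarrow>
      \<mu> \<le> Re (inner_on (I \<times> I) (\<lambda>(p, q). A p q - P p q) (\<lambda>(p, q). A p q - P p q))"
  obtains Y where "herm_kernel I Y"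
    "\<And>A P. A \<in> C \<Longrightarrow> pos_kernel I P \<Longrightarrow> Re (kernel_pair I Y A) + \<mu> \<le> Re (kernel_pair I Y P)"
proof -
  obtain W where W_herm: "herm_kernel I (\<lambda>p q. W (p, q))"
    and separated: "\<And>A P. A \<in> C \<Longrightarrow> pos_kernel I P \<Longrightarrow>
        \<mu> \<le> Re (inner_on (I \<times> I) W (\<lambda>(p, q). A p q - P p q))"
    by (rule nearest_kernel_difference[OF assms]) blast+
  define Y where "Y p q = - cnj (W (p, q))" for p q
  have "herm_kernel I Y"
    unfolding herm_kernel_def
  proof (intro ballI)
    fix p q assume "p \<in> I" "q \<in> I"
    then have "W (q, p) = cnj (W (p, q))" using W_herm unfolding herm_kernel_def by blast
    then show "Y q p = cnj (Y p q)" by (simp add: Y_def)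
  qed
  moreover have "Re (kernel_pair I Y A) + \<mu> \<le> Re (kernel_pair I Y P)" if "A \<in> C" "pos_kernel I P"
    for A P
  proof -
    have "Re (inner_on (I \<times> I) W (\<lambda>(p, q). A p q - P p q))
        = Re (kernel_pair I Y P) - Re (kernel_pair I Y A)"
      using inner_on_case_prod[of I "\<lambda>p q. W (p, q)" "\<lambda>p q. A p q - P p q"]
      by (simp add: kernel_pair_linear) (simp add: kernel_pair_def Y_def sum_negf)
    with separated[OF that] show ?thesis by simp
  qed
  ultimately show ?thesis by (rule that)
qed

lemma pos_kernel_separation:
  assumes fin: "finite I" and "C \<noteq> {}" and convex: "kernel_convex C"
    and herm: "\<And>A. A \<in> C \<Longrightarrow> herm_kernel I A" and "0 < \<mu>"
    and gap: "\<And>A P. A \<in> C \<Longrightarrow> pos_kernel I P \<Longrightarrow>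
      \<mu> \<le> Re (inner_on (I \<times> I) (\<lambda>(p, q). A p q - P p q) (\<lambda>(p, q). A p q - P p q))"
  obtains Y m where "state_kernel I Y" "0 < m" "\<And>A. A \<in> C \<Longrightarrow> Re (kernel_pair I Y A) \<le> - m"
proof -
  obtain Y where Y_herm: "herm_kernel I Y"
    and separates: "\<And>A P. A \<in> C \<Longrightarrow> pos_kernel I P \<Longrightarrow>
        Re (kernel_pair I Y A) + \<mu> \<le> Re (kernel_pair I Y P)"
    by (rule pos_kernel_gap_functional[OF fin \<open>C \<noteq> {}\<close> convex herm gap]) blast+
  obtain A where "A \<in> C" using \<open>C \<noteq> {}\<close> by blast
  have Y_pos: "pos_kernel I Y"
    by (rule pos_kernelI_pair_bounded_below[OF Y_herm separates[OF \<open>A \<in> C\<close>]])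
  have Y_neg: "Re (kernel_pair I Y B) \<le> - \<mu>" if "B \<in> C" for B
    using separates[OF that pos_kernel_zero] by (simp add: kernel_pair_def)
  then have "kernel_pair I Y A \<noteq> 0" using \<open>A \<in> C\<close> \<open>0 < \<mu>\<close> by force
  then obtain \<tau> :: real where "0 < \<tau>"
    and trace_one: "kernel_trace I (\<lambda>p q. of_real (1 / \<tau>) * Y p q) = 1"
    by (rule pos_kernel_normalise[OF fin Y_pos])
  show ?thesis
  proof (rule that)
    have "pos_kernel I (\<lambda>p q. of_real (1 / \<tau>) * Y p q)" using \<open>0 < \<tau>\<close>
      by (intro pos_kernel_scale Y_pos) simp
    then show "state_kernel I (\<lambda>p q. of_real (1 / \<tau>) * Y p q)" using trace_one
      by (simp add: state_kernel_def)
    show "0 < \<mu> / \<tau>" using \<open>0 < \<mu>\<close> \<open>0 < \<tau>\<close> by simp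
    show "Re (kernel_pair I (\<lambda>p q. of_real (1 / \<tau>) * Y p q) B) \<le> - (\<mu> / \<tau>)" if "B \<in> C" for B
      using Y_neg[OF that] \<open>0 < \<tau>\<close> unfolding kernel_pair_commute[of I _ B] kernel_pair_linear
      by (simp add: field_simps)
  qed
qed

lemma pos_kernel_add_one:
  assumes fin: "finite I" and herm: "herm_kernel I A"
    and small: "Re (inner_on (I \<times> I) (case_prod A) (case_prod A)) \<le> \<eta>\<^sup>2" and "0 \<le> \<eta>"
  shows "pos_kernel I (\<lambda>p q. A p q + of_real \<eta> * kernel_one p q)"
proof (rule pos_kernelI_Re)
  show "herm_kernel I (\<lambda>p q. A p q + of_real \<eta> * kernel_one p q)"
    by (intro herm_kernel_add herm_kernel_scale herm_kernel_one herm)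
  fix v
  have "inner_on I v (kernel_app I A v) = inner_on (I \<times> I) (\<lambda>(p, q). v p * cnj (v q)) (case_prod A)"
    unfolding inner_on_kernel_app by (simp add: inner_on_def sum.cartesian_product' mult_ac)
  then have "- Re (inner_on I v (kernel_app I A v))
      \<le> L2_set (\<lambda>z. cmod (case z of (p, q) \<Rightarrow> v p * cnj (v q))) (I \<times> I)
          * L2_set (\<lambda>z. cmod (case_prod A z)) (I \<times> I)"
    using norm_inner_on_le[of "I \<times> I" "\<lambda>(p, q). v p * cnj (v q)" "case_prod A"]
      abs_Re_le_cmod[of "inner_on I v (kernel_app I A v)"] by simp
  also have "L2_set (\<lambda>z. cmod (case_prod A z)) (I \<times> I) \<le> \<eta>"
    using small \<open>0 \<le> \<eta>\<close> by (simp add: L2_set_def inner_on_self real_le_lsqrt sum_nonneg)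
  also have "L2_set (\<lambda>z. cmod (case z of (p, q) \<Rightarrow> v p * cnj (v q))) (I \<times> I)
      = (\<Sum>p\<in>I. (cmod (v p))\<^sup>2)"
  proof -
    have "(\<Sum>z\<in>I \<times> I. (cmod (case z of (p, q) \<Rightarrow> v p * cnj (v q)))\<^sup>2) = (\<Sum>p\<in>I. (cmod (v p))\<^sup>2)\<^sup>2"
      by (simp add: sum.cartesian_product' norm_mult power_mult_distrib
        power2_eq_square[of "sum _ _"] sum_product)
    then show ?thesis by (simp add: L2_set_def sum_nonneg)
  qed
  finally have "- Re (inner_on I v (kernel_app I A v)) \<le> (\<Sum>p\<in>I. (cmod (v p))\<^sup>2) * \<eta>"
    by (simp add: mult_left_mono sum_nonneg)
  moreover have "inner_on I v (kernel_app I (\<lambda>p q. A p q + of_real \<eta> * kernel_one p q) v)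
      = inner_on I v (kernel_app I A v) + of_real \<eta> * inner_on I v v"
    using fin by (simp add: kernel_app_linear kernel_app_one inner_on_linear cong: inner_on_cong)
  ultimately show "0 \<le> Re (inner_on I v (kernel_app I
      (\<lambda>p q. A p q + of_real \<eta> * kernel_one p q) v))"
    by (simp add: inner_on_self mult.commute)
qed

text \<open>No closedness of \<open>C\<close> is needed, since positivity is only claimed up to an arbitrarily small
  multiple of the identity.\<close>

theorem pos_kernel_minimax:
  assumes fin: "finite I" and nonempty: "C \<noteq> {}" and convex: "kernel_convex C"
    and herm: "\<And>A. A \<in> C \<Longrightarrow> herm_kernel I A" and "0 < \<eta>"
    and test: "\<And>Y m. state_kernel I Y \<Longrightarrow> 0 < m \<Longrightarrow> \<exists>A\<in>C. - m < Re (kernel_pair I Y A)"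
  obtains A where "A \<in> C" "pos_kernel I (\<lambda>p q. A p q + of_real \<eta> * kernel_one p q)"
proof -
  let ?N = "\<lambda>A. Re (inner_on (I \<times> I) (case_prod A) (case_prod A))"
  have "\<exists>A\<in>C. \<exists>P. pos_kernel I P \<and> ?N (\<lambda>p q. A p q - P p q) \<le> \<eta>\<^sup>2"
  proof (rule ccontr)
    assume far: "\<not> ?thesis"
    obtain Y m where "state_kernel I Y" "0 < m" "\<And>A. A \<in> C \<Longrightarrow> Re (kernel_pair I Y A) \<le> - m"
      by (rule pos_kernel_separation[OF fin nonempty convex herm, of "\<eta>\<^sup>2"])
        (use far \<open>0 < \<eta>\<close> in force)+
    then show False using test by (meson not_le)
  qed
  then obtain A P where A_in: "A \<in> C" and P_pos: "pos_kernel I P"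
    and small: "?N (\<lambda>p q. A p q - P p q) \<le> \<eta>\<^sup>2"
    by blast
  have "pos_kernel I (\<lambda>p q. (A p q - P p q) + of_real \<eta> * kernel_one p q)"
    by (rule pos_kernel_add_one[OF fin
      herm_kernel_diff[OF herm[OF A_in] pos_kernel_herm[OF fin P_pos]] small])
      (use \<open>0 < \<eta>\<close> in simp)
  from pos_kernel_add[OF this P_pos] have "pos_kernel I (\<lambda>p q. A p q + of_real \<eta> * kernel_one p q)"
    by (rule pos_kernel_cong) simp
  with A_in show ?thesis by (rule that)
qed

section \<open>Trace norm and positive completions\<close>

definition kernel_mult :: "'i set \<Rightarrow> 'i kernel \<Rightarrow> 'i kernel \<Rightarrow> 'i kernel" where
  "kernel_mult I A B p q = (\<Sum>r\<in>I. A p r * B r q)"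

definition kernel_adjoint :: "'i kernel \<Rightarrow> 'i kernel" where
  "kernel_adjoint A p q = cnj (A q p)"

lemma kernel_app_cong: "(\<And>q. q \<in> I \<Longrightarrow> u q = v q) \<Longrightarrow> kernel_app I A u p = kernel_app I A v p"
  by (simp add: kernel_app_def)

lemma kernel_app_mult: "kernel_app I (kernel_mult I A B) v p = kernel_app I A (kernel_app I B v) p"
  unfolding kernel_app_def kernel_mult_def sum_distrib_left sum_distrib_right
  by (subst sum.swap) (simp add: mult.assoc)

lemma inner_on_kernel_app_adjoint:
  "inner_on I u (kernel_app I (kernel_adjoint A) v) = inner_on I (kernel_app I A u) v"
  unfolding inner_on_kernel_app
  by (subst sum.swap)
    (simp add: inner_on_def kernel_app_def kernel_adjoint_def sum_distrib_left mult_ac)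

lemma pos_kernel_adjoint_mult: "pos_kernel I (kernel_mult I (kernel_adjoint A) A)"
  by (simp add: pos_kernel_def kernel_app_mult inner_on_kernel_app_adjoint inner_on_self_nonneg
    cong: inner_on_cong)

lemma pos_kernel_sqrt_eigenvector:
  assumes fin: "finite I" and B_pos: "pos_kernel I B" and "0 \<le> s" and "p \<in> I"
    and square_eigen: "\<And>p. p \<in> I \<Longrightarrow> kernel_app I (kernel_mult I B B) v p = of_real (s\<^sup>2) * v p"
  shows "kernel_app I B v p = of_real s * v p"
proof -
  define w where "w = (\<lambda>p. kernel_app I B v p - of_real s * v p)"
  have "kernel_app I B w p = - of_real s * w p" if "p \<in> I" for p
    using square_eigen[OF that]
    by (simp add: w_def kernel_app_linear kernel_app_mult power2_eq_square algebra_simps)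
  then have "inner_on I w (kernel_app I B w) = - of_real s * inner_on I w w"
    by (simp add: inner_on_linear(6)[symmetric] cong: inner_on_cong)
  then have "0 \<le> - of_real s * inner_on I w w" using B_pos unfolding pos_kernel_def by metis
  moreover have "inner_on I w w = 0" if "s = 0"
  proof -
    have "inner_on I w w = inner_on I v (kernel_app I B (kernel_app I B v))"
      using that kernel_app_self_adjoint[OF pos_kernel_herm[OF fin B_pos], of v]
      by (simp add: w_def)
    also have "\<dots> = inner_on I v (\<lambda>_. 0)"
      using square_eigen that by (intro inner_on_cong) (simp_all add: kernel_app_mult)
    finally show ?thesis by (simp add: inner_on_def)
  qed
  ultimately have "inner_on I w w = 0"
    using \<open>0 \<le> s\<close> inner_on_self_nonneg[of I w]
    by (cases "s = 0") (auto simp: less_eq_complex_def complex_eq_iff mult_le_0_iff)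
  then show ?thesis using inner_on_self_eq_0[OF fin _ \<open>p \<in> I\<close>] by (force simp: w_def)
qed

lemma pos_kernel_sqrt_eq_spectral_kernel:
  assumes "finite I" "onb I v" "pos_kernel I B" "\<And>j. j < card I \<Longrightarrow> 0 \<le> s j" "p \<in> I" "q \<in> I"
    and "\<And>j p. j < card I \<Longrightarrow> p \<in> I \<Longrightarrow>
        kernel_app I (kernel_mult I B B) (v j) p = of_real ((s j)\<^sup>2) * v j p"
  shows "B p q = spectral_kernel I v s p q"
  by (rule spectral_kernel_eqI) (use assms in \<open>auto intro: pos_kernel_sqrt_eigenvector\<close>)

lemma kernel_mult_spectral_kernel:
  assumes "finite I" "onb I v" "p \<in> I" "q \<in> I"
  shows "kernel_mult I (spectral_kernel I v d) (spectral_kernel I v d) p q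
      = spectral_kernel I v (\<lambda>j. (d j)\<^sup>2) p q"
proof (rule spectral_kernel_eqI[OF assms])
  fix j p assume in_range: "j < card I" "p \<in> I"
  have "kernel_app I (kernel_mult I (spectral_kernel I v d) (spectral_kernel I v d)) (v j) p
      = kernel_app I (spectral_kernel I v d) (\<lambda>p. of_real (d j) * v j p) p"
    unfolding kernel_app_mult
    by (intro kernel_app_cong kernel_app_spectral_kernel[OF assms(2) in_range(1)])
  then show "kernel_app I (kernel_mult I (spectral_kernel I v d) (spectral_kernel I v d)) (v j) p
      = of_real ((d j)\<^sup>2) * v j p"
    by (simp add: kernel_app_linear kernel_app_spectral_kernel[OF assms(2) in_range(1)]
      power2_eq_square)
qed

definition singular_system ::
    "'i set \<Rightarrow> 'i kernel \<Rightarrow> (nat \<Rightarrow> 'i \<Rightarrow> complex) \<Rightarrow> (nat \<Rightarrow> 'i \<Rightarrow> complex) \<Rightarrow> (nat \<Rightarrow> real) \<Rightarrow> bool" where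
  "singular_system I A u v s \<longleftrightarrow> onb I v \<and> (\<forall>j<card I. 0 \<le> s j) \<and>
     (\<forall>j<card I. \<forall>k<card I. inner_on I (u j) (u k) = of_bool (j = k \<and> s j \<noteq> 0)) \<and>
     (\<forall>j<card I. \<forall>p\<in>I. kernel_app I A (v j) p = of_real (s j) * u j p)"

theorem singular_value_decomposition:
  assumes fin: "finite I"
  obtains u v s where "singular_system I A u v s"
    "\<And>j p. j < card I \<Longrightarrow> p \<in> I \<Longrightarrow>
      kernel_app I (kernel_mult I (kernel_adjoint A) A) (v j) p = of_real ((s j)\<^sup>2) * v j p"
proof -
  let ?N = "kernel_mult I (kernel_adjoint A) A"
  obtain v d where onb: "onb I v" and d_nonneg: "\<And>j. j < card I \<Longrightarrow> 0 \<le> d j"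
    and eigen: "\<And>j p. j < card I \<Longrightarrow> p \<in> I \<Longrightarrow> kernel_app I ?N (v j) p = of_real (d j :: real) * v j p"
    by (rule pos_kernel_spectral[OF fin pos_kernel_adjoint_mult]) blast
  define s where "s j = sqrt (d j)" for j
  define u where "u j = (\<lambda>p. of_real (1 / s j) * kernel_app I A (v j) p)" for j
  have s_sq: "0 \<le> s j" "(s j)\<^sup>2 = d j" if "j < card I" for j using d_nonneg[OF that]
    by (auto simp: s_def)
  have inner_images: "inner_on I (kernel_app I A (v j)) (kernel_app I A (v k))
      = of_real (d k) * of_bool (j = k)"
    if "j < card I" "k < card I" for j k
  proof -
    have "inner_on I (kernel_app I A (v j)) (kernel_app I A (v k))
        = inner_on I (v j) (kernel_app I ?N (v k))"
      by (simp add: kernel_app_mult inner_on_kernel_app_adjoint cong: inner_on_cong)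
    also have "\<dots> = inner_on I (v j) (\<lambda>p. of_real (d k) * v k p)"
      using that by (intro inner_on_cong) (simp_all add: eigen)
    also have "\<dots> = of_real (d k) * of_bool (j = k)" using onb that
      by (simp add: inner_on_linear onb_def)
    finally show ?thesis .
  qed
  have "inner_on I (u j) (u k) = of_bool (j = k \<and> s j \<noteq> 0)" if "j < card I" "k < card I" for j k
    unfolding u_def inner_on_linear inner_images[OF that] s_sq(2)[OF that(2), symmetric]
    by (simp add: power2_eq_square)
  moreover have "kernel_app I A (v j) p = of_real (s j) * u j p" if "j < card I" "p \<in> I" for j p
  proof (cases "s j = 0")
    case True
    then have "inner_on I (kernel_app I A (v j)) (kernel_app I A (v j)) = 0"
      using inner_images[OF that(1,1)] s_sq(2)[OF that(1)] by simp
    then show ?thesis using inner_on_self_eq_0[OF fin _ that(2), of "kernel_app I A (v j)"] True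
      by simp
  qed (simp add: u_def)
  ultimately have "singular_system I A u v s" using onb s_sq(1) by (simp add: singular_system_def)
  then show ?thesis by (rule that) (simp_all add: eigen s_sq(2))
qed

abbreviation mat_kernel :: "complex mat \<Rightarrow> nat kernel" where
  "mat_kernel A \<equiv> \<lambda>p q. A $$ (p, q)"

lemma psd_iff_pos_kernel: "psd d A \<longleftrightarrow> A \<in> carrier_mat d d \<and> pos_kernel {..<d} (mat_kernel A)"
proof (cases "A \<in> carrier_mat d d")
  case True
  have form: "(A *\<^sub>v v) \<bullet> conjugate v
      = inner_on {..<d} (\<lambda>i. v $ i) (kernel_app {..<d} (mat_kernel A) (\<lambda>i. v $ i))"
    if "v \<in> carrier_vec d" for v
    using True that
    by (auto simp: scalar_prod_def atLeast0LessThan inner_on_def kernel_app_def mult.commute intro!: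
      sum.cong)
  have vec: "inner_on {..<d} v (kernel_app {..<d} (mat_kernel A) v)
      = inner_on {..<d} (\<lambda>i. vec d v $ i) (kernel_app {..<d} (mat_kernel A) (\<lambda>i. vec d v $ i))"
        for v
    by (intro inner_on_cong kernel_app_cong) simp_all
  have "pos_kernel {..<d} (mat_kernel A) \<longleftrightarrow> (\<forall>v\<in>carrier_vec d. 0 \<le> (A *\<^sub>v v) \<bullet> conjugate v)"
    unfolding pos_kernel_def by (metis form vec vec_carrier)
  moreover have "z \<in> \<real> \<and> 0 \<le> Re z \<longleftrightarrow> 0 \<le> z" for z
    by (auto simp: less_eq_complex_def complex_is_Real_iff)
  ultimately show ?thesis using True by (simp add: psd_def)
qed (simp add: psd_def)

lemma psd_carrier: "psd d A \<Longrightarrow> A \<in> carrier_mat d d"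
  by (simp add: psd_def)

lemma mtrace_eq_kernel_trace: "A \<in> carrier_mat d d \<Longrightarrow> mtrace A = kernel_trace {..<d} (mat_kernel A)"
  by (simp add: mtrace_def kernel_trace_def)

lemma mat_adjoint_index:
  assumes "A \<in> carrier_mat n m" "i < m" "j < n"
  shows "mat_adjoint A $$ (i, j) = cnj (A $$ (j, i))"
  using assms by (simp add: mat_adjoint_def mat_of_rows_def)

lemma mat_adjoint_carrier: "A \<in> carrier_mat n m \<Longrightarrow> mat_adjoint A \<in> carrier_mat m n"
  by (simp add: mat_adjoint_def mat_of_rows_def)

lemma mat_mult_index:
  assumes "A \<in> carrier_mat n m" "B \<in> carrier_mat m k" "i < n" "j < k"
  shows "(A * B) $$ (i, j) = (\<Sum>r<m. A $$ (i, r) * B $$ (r, j))"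
  using assms by (auto simp: scalar_prod_def atLeast0LessThan)

lemma mat_kernel_mult:
  assumes "A \<in> carrier_mat d d" "B \<in> carrier_mat d d" "p < d" "q < d"
  shows "(A * B) $$ (p, q) = kernel_mult {..<d} (mat_kernel A) (mat_kernel B) p q"
  using mat_mult_index[OF assms] by (simp add: kernel_mult_def)

lemma mat_kernel_adjoint_mult:
  assumes "A \<in> carrier_mat d d" "p < d" "q < d"
  shows "(mat_adjoint A * A) $$ (p, q)
      = kernel_mult {..<d} (kernel_adjoint (mat_kernel A)) (mat_kernel A) p q"
  using mat_mult_index[OF mat_adjoint_carrier[OF assms(1)] assms(1-3)] assms(2)
  by (simp add: kernel_mult_def kernel_adjoint_def mat_adjoint_index[OF assms(1)])

lemma spectral_mat_square:
  assumes A_carrier: "A \<in> carrier_mat d d" and onb: "onb {..<d} v"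
    and eigen: "\<And>j p. j < d \<Longrightarrow> p < d \<Longrightarrow>
      kernel_app {..<d} (kernel_mult {..<d} (kernel_adjoint (mat_kernel A)) (mat_kernel A)) (v j) p
      = of_real ((s j)\<^sup>2) * v j p"
    and B_eq: "B = mat d d (\<lambda>(p, q). spectral_kernel {..<d} v s p q)"
  shows "B * B = mat_adjoint A * A"
proof (rule eq_matI)
  have carriers: "B \<in> carrier_mat d d" "mat_adjoint A \<in> carrier_mat d d"
    using B_eq mat_adjoint_carrier[OF A_carrier] by auto
  show "dim_row (B * B) = dim_row (mat_adjoint A * A)" "dim_col (B * B)
      = dim_col (mat_adjoint A * A)"
    using carriers A_carrier by auto
  fix p q assume "p < dim_row (mat_adjoint A * A)" "q < dim_col (mat_adjoint A * A)"
  with carriers A_carrier have "p < d" "q < d" by auto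
  let ?S = "spectral_kernel {..<d} v s"
  have "(B * B) $$ (p, q) = kernel_mult {..<d} ?S ?S p q"
    unfolding mat_kernel_mult[OF carriers(1,1) \<open>p < d\<close> \<open>q < d\<close>]
    using \<open>p < d\<close> \<open>q < d\<close> by (simp add: kernel_mult_def B_eq)
  also have "\<dots> = spectral_kernel {..<d} v (\<lambda>j. (s j)\<^sup>2) p q"
    by (rule kernel_mult_spectral_kernel) (use onb \<open>p < d\<close> \<open>q < d\<close> in auto)
  also have "\<dots> = kernel_mult {..<d} (kernel_adjoint (mat_kernel A)) (mat_kernel A) p q"
    by (rule spectral_kernel_eqI[symmetric]) (use onb \<open>p < d\<close> \<open>q < d\<close> eigen in auto)
  finally show "(B * B) $$ (p, q) = (mat_adjoint A * A) $$ (p, q)"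
    by (simp only: mat_kernel_adjoint_mult[OF A_carrier \<open>p < d\<close> \<open>q < d\<close>])
qed

lemma psd_square_root_unique:
  assumes A_carrier: "A \<in> carrier_mat d d" and onb: "onb {..<d} v"
    and s_nonneg: "\<And>j. j < d \<Longrightarrow> 0 \<le> (s j :: real)"
    and eigen: "\<And>j p. j < d \<Longrightarrow> p < d \<Longrightarrow>
      kernel_app {..<d} (kernel_mult {..<d} (kernel_adjoint (mat_kernel A)) (mat_kernel A)) (v j) p
      = of_real ((s j)\<^sup>2) * v j p"
    and C_root: "psd d C" "C * C = mat_adjoint A * A"
  shows "C = mat d d (\<lambda>(p, q). spectral_kernel {..<d} v s p q)"
proof -
  let ?N = "kernel_mult {..<d} (kernel_adjoint (mat_kernel A)) (mat_kernel A)"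
  have "kernel_mult {..<d} (mat_kernel C) (mat_kernel C) p q = ?N p q" if "p < d" "q < d" for p q
    using mat_kernel_mult[OF psd_carrier[OF C_root(1)] psd_carrier[OF C_root(1)] that]
      mat_kernel_adjoint_mult[OF A_carrier that]
    unfolding C_root(2) by simp
  then have "kernel_app {..<d} (kernel_mult {..<d} (mat_kernel C) (mat_kernel C)) x p
      = kernel_app {..<d} ?N x p"
    if "p < d" for x p
    using that by (simp add: kernel_app_def)
  then have "C $$ (p, q) = spectral_kernel {..<d} v s p q" if "p < d" "q < d" for p q
    using that onb s_nonneg C_root(1) eigen by (intro pos_kernel_sqrt_eq_spectral_kernel)
      (auto simp: psd_iff_pos_kernel)
  then show ?thesis using psd_carrier[OF C_root(1)] by (intro eq_matI) auto
qed

lemma trace_norm_eq_sum_singular_values: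
  assumes A_carrier: "A \<in> carrier_mat d d" and onb: "onb {..<d} v"
    and s_nonneg: "\<And>j. j < d \<Longrightarrow> 0 \<le> (s j :: real)"
    and eigen: "\<And>j p. j < d \<Longrightarrow> p < d \<Longrightarrow>
      kernel_app {..<d} (kernel_mult {..<d} (kernel_adjoint (mat_kernel A)) (mat_kernel A)) (v j) p
      = of_real ((s j)\<^sup>2) * v j p"
  shows "trace_norm A = (\<Sum>j<d. s j)"
proof -
  define B where "B = mat d d (\<lambda>(p, q). spectral_kernel {..<d} v s p q)"
  have "pos_kernel {..<d} (mat_kernel B)"
    by (rule pos_kernel_cong[OF pos_kernel_spectral_kernel[where d = s]])
      (use s_nonneg in \<open>auto simp: B_def\<close>)
  then have "psd d B" by (simp add: psd_iff_pos_kernel B_def)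
  have "(THE B. psd (dim_col A) B \<and> B * B = mat_adjoint A * A) = B"
  proof (rule the_equality)
    show "psd (dim_col A) B \<and> B * B = mat_adjoint A * A"
      using \<open>psd d B\<close> A_carrier spectral_mat_square[OF A_carrier onb eigen B_def] by simp
    show "C = B" if "psd (dim_col A) C \<and> C * C = mat_adjoint A * A" for C
      using psd_square_root_unique[OF A_carrier onb s_nonneg eigen, of C] that A_carrier
      by (simp add: B_def)
  qed
  moreover have "mtrace B = of_real (\<Sum>j<d. s j)"
    using kernel_trace_spectral_kernel[OF onb, of s]
    by (simp add: mtrace_def kernel_trace_def B_def)
  ultimately show ?thesis by (simp add: trace_norm_def)
qed

text \<open>Completely positive maps act on positive completions, so all trace norm estimates below go through
  this variational characterisation.\<close>

definition completion :: "'i set \<Rightarrow> 'i kernel \<Rightarrow> (bool \<times> 'i) kernel \<Rightarrow> bool" where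
  "completion I A Z \<longleftrightarrow> pos_kernel (UNIV \<times> I) Z \<and> (\<forall>p\<in>I. \<forall>q\<in>I. Z (False, p) (True, q) = A p q)"

definition corner :: "bool \<Rightarrow> (bool \<times> 'i) kernel \<Rightarrow> 'i kernel" where
  "corner e Z p q = Z (e, p) (e, q)"

lemma pos_kernel_corner:
  "finite I \<Longrightarrow> pos_kernel (UNIV \<times> I) Z \<Longrightarrow> pos_kernel I (corner e Z)"
  unfolding corner_def[abs_def] by (rule pos_kernel_pullback[of "UNIV \<times> I"]) auto

lemma trace_norm_singular_system:
  assumes A_carrier: "A \<in> carrier_mat d d"
  obtains u v s where "singular_system {..<d} (mat_kernel A) u v s" "trace_norm A = (\<Sum>j<d. s j)"
proof -
  obtain u v s where system: "singular_system {..<d} (mat_kernel A) u v s"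
    and eigen: "\<And>j p. j < card {..<d} \<Longrightarrow> p \<in> {..<d} \<Longrightarrow>
      kernel_app {..<d} (kernel_mult {..<d} (kernel_adjoint (mat_kernel A)) (mat_kernel A)) (v j) p
      = of_real ((s j)\<^sup>2) * v j p"
    by (rule singular_value_decomposition[of "{..<d}" "mat_kernel A"]) auto
  have "trace_norm A = (\<Sum>j<d. s j)"
    by (rule trace_norm_eq_sum_singular_values[OF A_carrier])
      (use system eigen in \<open>auto simp: singular_system_def\<close>)
  with system show ?thesis by (rule that)
qed

lemma trace_norm_completion:
  assumes A_carrier: "A \<in> carrier_mat d d"
  obtains Z where "completion {..<d} (mat_kernel A) Z"
    "\<And>e. kernel_trace {..<d} (corner e Z) = of_real (trace_norm A)"
proof -
  obtain u v s where system: "singular_system {..<d} (mat_kernel A) u v s"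
    and norm: "trace_norm A = (\<Sum>j<d. s j)"
    by (rule trace_norm_singular_system[OF A_carrier])
  have onb: "onb {..<d} v" and s_nonneg: "\<And>j. j < d \<Longrightarrow> 0 \<le> s j"
    and u_orth: "\<And>j k. j < d \<Longrightarrow> k < d \<Longrightarrow> inner_on {..<d} (u j) (u k) = of_bool (j = k \<and> s j \<noteq> 0)"
    and image: "\<And>j p. j < d \<Longrightarrow> p < d \<Longrightarrow>
        kernel_app {..<d} (mat_kernel A) (v j) p = of_real (s j) * u j p"
    using system by (simp_all add: singular_system_def)
  define y where "y j z = (if fst z then v j (snd z) else u j (snd z))" for j and z :: "bool \<times> nat"
  define Z where "Z z z' = (\<Sum>j<d. of_real (s j) * kernel_rank1 (y j) z z')" for z z'
  have "pos_kernel (UNIV \<times> {..<d}) Z"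
    unfolding Z_def by (intro pos_kernel_sum pos_kernel_scale pos_kernel_rank1)
      (use s_nonneg in auto)
  moreover have "Z (False, p) (True, q) = A $$ (p, q)" if "p < d" "q < d" for p q
    using onb_expand[OF _ onb, of p q "mat_kernel A"] that
    by (simp add: Z_def y_def kernel_rank1_def image mult.assoc)
  ultimately have "completion {..<d} (mat_kernel A) Z" by (simp add: completion_def)
  moreover have "kernel_trace {..<d} (corner e Z) = of_real (trace_norm A)" for e
  proof -
    have "inner_on {..<d} (y j \<circ> Pair e) (y j \<circ> Pair e) = of_bool (e \<or> s j \<noteq> 0)" if "j < d" for j
      using onb u_orth that by (cases e) (auto simp: y_def o_def onb_def)
    then have "(\<Sum>j<d. of_real (s j) * inner_on {..<d} (y j \<circ> Pair e) (y j \<circ> Pair e))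
        = of_real (\<Sum>j<d. s j)"
      unfolding of_real_sum by (intro sum.cong refl) (simp, blast)
    then show ?thesis
      unfolding kernel_trace_def corner_def Z_def norm
      by (subst sum.swap) (simp add: kernel_rank1_def inner_on_def sum_distrib_left mult_ac)
  qed
  ultimately show ?thesis by (rule that)
qed

lemma bessel_inequality:
  assumes "finite J"
    and orth: "\<And>j k. j \<in> J \<Longrightarrow> k \<in> J \<Longrightarrow> inner_on I (u j) (u k) = of_bool (j = k \<and> P j)"
  shows "(\<Sum>j\<in>J. (cmod (inner_on I (u j) g))\<^sup>2) \<le> Re (inner_on I g g)"
proof -
  define c where "c j = inner_on I (u j) g" for j
  define S where "S = (\<lambda>x. \<Sum>j\<in>J. c j * u j x)"
  have inner_u_S: "inner_on I (u j) S = c j * of_bool (P j)" if "j \<in> J" for j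
  proof -
    have "inner_on I (u j) S = (\<Sum>k\<in>J. c k * of_bool (j = k) * of_bool (P j))"
      unfolding S_def inner_on_sum_right using orth[OF that] by (intro sum.cong) auto
    then show ?thesis using \<open>finite J\<close> that by (simp flip: sum_distrib_right)
  qed
  have inner_g_S: "inner_on I g S = of_real (\<Sum>j\<in>J. (cmod (c j))\<^sup>2)"
    unfolding S_def inner_on_sum_right inner_on_cnj[of I _ g, symmetric] c_def
    by (simp add: complex_norm_square del: of_real_power)
  have "inner_on I S S = (\<Sum>j\<in>J. c j * cnj (inner_on I (u j) S))"
    unfolding inner_on_cnj by (subst (2) S_def) (rule inner_on_sum_right)
  also have "\<dots> = of_real (\<Sum>j\<in>J. if P j then (cmod (c j))\<^sup>2 else 0)"
    unfolding of_real_sum using inner_u_S by (intro sum.cong)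
      (auto simp: complex_norm_square simp del: of_real_power)
  finally have norm_S_le: "Re (inner_on I S S) \<le> (\<Sum>j\<in>J. (cmod (c j))\<^sup>2)"
    by (simp add: sum_mono)
  have "0 \<le> Re (inner_on I (\<lambda>x. g x - S x) (\<lambda>x. g x - S x))"
    using inner_on_self_nonneg[of I "\<lambda>x. g x - S x"] by (simp add: less_eq_complex_def)
  also have "\<dots> = Re (inner_on I g g) - 2 * (\<Sum>j\<in>J. (cmod (c j))\<^sup>2) + Re (inner_on I S S)"
    using inner_g_S arg_cong[OF inner_on_cnj[of I g S], of Re] by (simp add: inner_on_linear)
  finally show ?thesis using norm_S_le by (simp add: c_def)
qed

lemma sum_form_le_trace:
  assumes fin: "finite I" and A_pos: "pos_kernel I A" and "finite J"
    and orth: "\<And>j k. j \<in> J \<Longrightarrow> k \<in> J \<Longrightarrow> inner_on I (u j) (u k) = of_bool (j = k \<and> P j)"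
  shows "(\<Sum>j\<in>J. Re (inner_on I (u j) (kernel_app I A (u j)))) \<le> Re (kernel_trace I A)"
proof -
  obtain g where gram: "\<And>p q. p \<in> I \<Longrightarrow> q \<in> I \<Longrightarrow> A p q = (\<Sum>k<card I. kernel_rank1 (g k) p q)"
    using pos_kernel_gramE[OF fin A_pos] by blast
  have form: "Re (inner_on I x (kernel_app I A x)) = (\<Sum>k<card I. (cmod (inner_on I x (g k)))\<^sup>2)"
    for x
  proof -
    have "kernel_app I A x p = (\<Sum>k<card I. inner_on I (g k) x * g k p)" if "p \<in> I" for p
    proof -
      have "kernel_app I A x p = (\<Sum>q\<in>I. \<Sum>k<card I. kernel_rank1 (g k) p q * x q)"
        using that by (simp add: kernel_app_def gram sum_distrib_right)
      also have "\<dots> = (\<Sum>k<card I. kernel_app I (kernel_rank1 (g k)) x p)"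
        unfolding kernel_app_def by (rule sum.swap)
      finally show ?thesis by (simp add: kernel_app_rank1 mult.commute)
    qed
    then have "inner_on I x (kernel_app I A x)
        = inner_on I x (\<lambda>p. \<Sum>k<card I. inner_on I (g k) x * g k p)"
      by (intro inner_on_cong) auto
    also have "\<dots> = (\<Sum>k<card I. inner_on I x (g k) * cnj (inner_on I x (g k)))"
      unfolding inner_on_sum_right inner_on_cnj by (simp add: mult.commute)
    finally show ?thesis by (simp add: cmod_power2 flip: power2_eq_square)
  qed
  have "(\<Sum>j\<in>J. Re (inner_on I (u j) (kernel_app I A (u j))))
      = (\<Sum>k<card I. \<Sum>j\<in>J. (cmod (inner_on I (u j) (g k)))\<^sup>2)"
    unfolding form by (rule sum.swap)
  also have "\<dots> \<le> (\<Sum>k<card I. Re (inner_on I (g k) (g k)))"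
    by (intro sum_mono bessel_inequality[OF \<open>finite J\<close> orth])
  also have "\<dots> = Re (kernel_trace I A)"
  proof -
    have "kernel_trace I A = (\<Sum>p\<in>I. \<Sum>k<card I. kernel_rank1 (g k) p p)"
      by (simp add: kernel_trace_def gram)
    also have "\<dots> = (\<Sum>k<card I. inner_on I (g k) (g k))"
      by (subst sum.swap) (simp add: kernel_rank1_def inner_on_def mult.commute)
    finally show ?thesis by simp
  qed
  finally show ?thesis .
qed

lemma completion_form:
  assumes fin: "finite I" and completion: "completion I A Z"
  shows "2 * Re (inner_on I u (kernel_app I A v))
    \<le> Re (inner_on I u (kernel_app I (corner False Z) u))
        + Re (inner_on I v (kernel_app I (corner True Z) v))"
proof -
  have pos: "pos_kernel (UNIV \<times> I) Z"
    and upper_block: "\<And>p q. p \<in> I \<Longrightarrow> q \<in> I \<Longrightarrow> Z (False, p) (True, q) = A p q"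
    using completion by (auto simp: completion_def)
  have "herm_kernel (UNIV \<times> I) Z" by (rule pos_kernel_herm[OF _ pos]) (simp add: fin)
  then have "Z (True, q) (False, p) = cnj (Z (False, p) (True, q))" if "p \<in> I" "q \<in> I" for p q
    using that unfolding herm_kernel_def by blast
  then have lower_block: "Z (True, q) (False, p) = cnj (A p q)" if "p \<in> I" "q \<in> I" for p q
    using upper_block that by simp
  define c where "c = inner_on I u (kernel_app I A v)"
  have c_False: "c = (\<Sum>p\<in>I. \<Sum>q\<in>I. cnj (u p) * Z (False, p) (True, q) * v q)"
    by (simp add: c_def inner_on_kernel_app upper_block)
  have c_True: "cnj c = (\<Sum>p\<in>I. \<Sum>q\<in>I. cnj (v p) * Z (True, p) (False, q) * u q)"
    unfolding c_def inner_on_kernel_app by (subst sum.swap) (simp add: lower_block mult_ac)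
  let ?x = "\<lambda>z. if fst z then - v (snd z) else u (snd z)"
  have "0 \<le> inner_on (UNIV \<times> I) ?x (kernel_app (UNIV \<times> I) Z ?x)"
    using pos by (simp add: pos_kernel_def)
  also have "\<dots> = inner_on I u (kernel_app I (corner False Z) u) - c - cnj c
      + inner_on I v (kernel_app I (corner True Z) v)"
    unfolding c_True unfolding c_False inner_on_kernel_app corner_def
    by (simp add: sum.cartesian_product' UNIV_bool sum.distrib sum_negf sum_subtractf)
  finally show ?thesis by (simp add: less_eq_complex_def c_def)
qed

lemma trace_norm_le_completion:
  assumes A_carrier: "A \<in> carrier_mat d d" and completion: "completion {..<d} (mat_kernel A) Z"
  shows "trace_norm A \<le> (Re (kernel_trace {..<d} (corner False Z))
      + Re (kernel_trace {..<d} (corner True Z))) / 2"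
proof -
  obtain u v s where system: "singular_system {..<d} (mat_kernel A) u v s"
    and norm: "trace_norm A = (\<Sum>j<d. s j)"
    by (rule trace_norm_singular_system[OF A_carrier])
  have onb: "onb {..<d} v" and s_nonneg: "\<And>j. j < d \<Longrightarrow> 0 \<le> s j"
    and u_orth: "\<And>j k. j < d \<Longrightarrow> k < d \<Longrightarrow> inner_on {..<d} (u j) (u k) = of_bool (j = k \<and> s j \<noteq> 0)"
    and image: "\<And>j p. j < d \<Longrightarrow> p < d \<Longrightarrow>
        kernel_app {..<d} (mat_kernel A) (v j) p = of_real (s j) * u j p"
    using system by (simp_all add: singular_system_def)
  let ?f = "\<lambda>e w. Re (inner_on {..<d} w (kernel_app {..<d} (corner e Z) w))"
  have corner: "pos_kernel {..<d} (corner e Z)" for e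
    using completion by (intro pos_kernel_corner) (auto simp: completion_def)
  have "2 * s j \<le> ?f False (u j) + ?f True (v j)" if j_less: "j < d" for j
  proof -
    have "inner_on {..<d} (u j) (kernel_app {..<d} (mat_kernel A) (v j))
        = inner_on {..<d} (u j) (\<lambda>p. of_real (s j) * u j p)"
      using j_less by (intro inner_on_cong) (auto simp: image)
    also have "\<dots> = of_real (s j)" using u_orth[OF j_less j_less] by (simp add: inner_on_linear)
    finally show ?thesis using completion_form[OF _ completion, of "u j" "v j"] by simp
  qed
  then have "2 * trace_norm A \<le> (\<Sum>j<d. ?f False (u j) + ?f True (v j))"
    unfolding norm sum_distrib_left by (intro sum_mono) auto
  also have "\<dots> = (\<Sum>j<d. ?f False (u j)) + (\<Sum>j<d. ?f True (v j))" by (rule sum.distrib)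
  also have "\<dots> \<le> Re (kernel_trace {..<d} (corner False Z))
      + Re (kernel_trace {..<d} (corner True Z))"
  proof (rule add_mono)
    show "(\<Sum>j<d. ?f False (u j)) \<le> Re (kernel_trace {..<d} (corner False Z))"
      by (rule sum_form_le_trace[OF _ corner _, where P = "\<lambda>j. s j \<noteq> 0"]) (use u_orth in auto)
    show "(\<Sum>j<d. ?f True (v j)) \<le> Re (kernel_trace {..<d} (corner True Z))"
      by (rule sum_form_le_trace[OF _ corner _, where P = "\<lambda>_. True"])
        (use onb in \<open>auto simp: onb_def\<close>)
  qed
  finally show ?thesis by simp
qed

lemma trace_norm_nonneg:
  assumes "A \<in> carrier_mat d d"
  shows "0 \<le> trace_norm A"
proof -
  obtain Z where completion: "completion {..<d} (mat_kernel A) Z"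
    and corner_trace: "\<And>e. kernel_trace {..<d} (corner e Z) = of_real (trace_norm A)"
    using trace_norm_completion[OF assms] by blast
  have "pos_kernel {..<d} (corner True Z)"
    using completion by (intro pos_kernel_corner) (auto simp: completion_def)
  then have "0 \<le> kernel_trace {..<d} (corner True Z)"
    unfolding kernel_trace_def by (intro sum_nonneg pos_kernel_diag) auto
  then show ?thesis by (simp add: corner_trace less_eq_complex_def)
qed

lemma trace_norm_psd_le:
  assumes "psd d A"
  shows "trace_norm A \<le> Re (mtrace A)"
proof -
  have A_psd: "A \<in> carrier_mat d d" "pos_kernel {..<d} (mat_kernel A)" using assms
    by (auto simp: psd_iff_pos_kernel)
  let ?Z = "\<lambda>z z' :: bool \<times> nat. A $$ (snd z, snd z')"
  have "completion {..<d} (mat_kernel A) ?Z"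
    unfolding completion_def by (intro conjI pos_kernel_pullback[OF _ A_psd(2)]) auto
  from trace_norm_le_completion[OF A_psd(1) this] show ?thesis
    by (simp add: corner_def[abs_def] mtrace_eq_kernel_trace[OF A_psd(1)])
qed

text \<open>For \<open>0 \<le> T \<le> 1\<close> the block kernel with unit corners and off-diagonal entries \<open>1 - 2T\<close> is positive,
  because \<open>-1 \<le> 1 - 2T \<le> 1\<close>.\<close>

lemma kernel_pair_traceless_le:
  assumes D_carrier: "D \<in> carrier_mat d d" and traceless: "mtrace D = 0"
    and T_pos: "pos_kernel {..<d} T" and T_le_one: "kernel_le {..<d} T kernel_one"
  shows "Re (kernel_pair {..<d} T (mat_kernel D)) \<le> trace_norm D / 2"
proof -
  let ?I = "{..<d}"
  obtain Z where completion: "completion ?I (mat_kernel D) Z"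
    and corner_trace: "\<And>e. kernel_trace ?I (corner e Z) = of_real (trace_norm D)"
    using trace_norm_completion[OF D_carrier] by blast
  define sg :: "bool \<times> nat \<Rightarrow> complex" where "sg z = (if fst z then - 1 else 1)" for z
  define M where "M z z' = (of_bool (snd z = snd z') - T (snd z) (snd z'))
      + T (snd z) (snd z') * kernel_rank1 sg z z'" for z z'
  have M_pos: "pos_kernel (UNIV \<times> ?I) M"
    unfolding M_def using T_pos T_le_one[unfolded kernel_le_def]
    by (intro pos_kernel_add pos_kernel_mult_rank1; intro pos_kernel_pullback[of ?I _ snd]) auto
  have Z_pos: "pos_kernel (UNIV \<times> ?I) Z" using completion by (simp add: completion_def)
  define b where "b e f = kernel_pair ?I (\<lambda>p q. Z (e, p) (f, q)) (\<lambda>p q. M (e, p) (f, q))" for e f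
  have diag: "b e e = of_real (trace_norm D)" for e
  proof -
    have "M (e, p) (e, q) = of_bool (p = q)" for p q
      by (simp add: M_def kernel_rank1_def sg_def)
    then show ?thesis
      using corner_trace[of e] kernel_pair_one[of ?I "corner e Z"]
      by (simp add: b_def corner_def[abs_def])
  qed
  have off_diag: "b False True
      = kernel_trace ?I (mat_kernel D) - 2 * kernel_pair ?I (mat_kernel D) T"
  proof -
    have "M (False, p) (True, q) = of_bool (p = q) - 2 * T p q" for p q
      by (simp add: M_def kernel_rank1_def sg_def)
    then have "b False True = kernel_pair ?I (mat_kernel D) (\<lambda>p q. of_bool (p = q) - 2 * T p q)"
      unfolding b_def using completion by (intro kernel_pair_cong) (simp_all add: completion_def)
    then show ?thesis by (simp add: kernel_pair_linear kernel_pair_one)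
  qed
  have "b True False = cnj (b False True)"
    unfolding b_def by (rule kernel_pair_adjoint_blocks) (auto intro: pos_kernel_herm Z_pos M_pos)
  moreover have "0 \<le> (\<Sum>e\<in>UNIV. \<Sum>f\<in>UNIV. b e f)"
    unfolding b_def kernel_pair_prod[symmetric] using Z_pos M_pos
    by (intro kernel_pair_nonneg) simp_all
  ultimately have "0 \<le> 2 * trace_norm D + 2 * Re (b False True)"
    by (simp add: UNIV_bool diag less_eq_complex_def)
  then show ?thesis
    using traceless
    by (simp add: off_diag mtrace_eq_kernel_trace[OF D_carrier] kernel_pair_commute[of ?I T])
qed

section \<open>The link product\<close>

definition kernel_link :: "'k set \<Rightarrow> ('i \<times> 'k) kernel \<Rightarrow> ('k \<times> 'j) kernel \<Rightarrow> ('i \<times> 'j) kernel" where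
  "kernel_link K A B p q = (\<Sum>x\<in>K. \<Sum>y\<in>K. A (fst p, x) (fst q, y) * B (x, snd p) (y, snd q))"

definition kernel_flip :: "('i \<times> 'j) kernel \<Rightarrow> ('j \<times> 'i) kernel" where
  "kernel_flip A p q = A (prod.swap p) (prod.swap q)"

definition kernel_tensor :: "'i kernel \<Rightarrow> 'j kernel \<Rightarrow> ('i \<times> 'j) kernel" where
  "kernel_tensor A B p q = A (fst p) (fst q) * B (snd p) (snd q)"

definition partial_trace :: "'j set \<Rightarrow> ('i \<times> 'j) kernel \<Rightarrow> 'i kernel" where
  "partial_trace J A i j = (\<Sum>a\<in>J. A (i, a) (j, a))"

definition id_kernel :: "('i \<times> 'i) kernel" where
  "id_kernel = kernel_rank1 (\<lambda>p. of_bool (fst p = snd p))"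

lemma sum_swap3:
  "(\<Sum>x\<in>A. \<Sum>k\<in>C. \<Sum>l\<in>D. f x k l) = (\<Sum>k\<in>C. \<Sum>l\<in>D. \<Sum>x\<in>A. (f x k l :: 'a :: comm_monoid_add))"
  by (subst sum.swap) (intro sum.cong refl sum.swap)

lemma sum_swap4:
  "(\<Sum>x\<in>A. \<Sum>y\<in>B. \<Sum>k\<in>C. \<Sum>l\<in>D. f x y k l)
      = (\<Sum>k\<in>C. \<Sum>l\<in>D. \<Sum>x\<in>A. \<Sum>y\<in>B. (f x y k l :: 'a :: comm_monoid_add))"
  by (simp only: sum_swap3[where A = B] sum_swap3[where A = A])

lemma kernel_pair_reindex:
  assumes "bij_betw f I J"
  shows "kernel_pair J A C = kernel_pair I (\<lambda>p q. A (f p) (f q)) (\<lambda>p q. C (f p) (f q))"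
  unfolding kernel_pair_def by (simp add: sum.reindex_bij_betw[OF assms, symmetric])

lemma kernel_trace_reindex:
  "bij_betw f I J \<Longrightarrow> kernel_trace J A = kernel_trace I (\<lambda>p q. A (f p) (f q))"
  unfolding kernel_trace_def using sum.reindex_bij_betw[of f I J "\<lambda>p. A p p"] by simp

lemma pos_kernel_reindex:
  assumes "finite I" "bij_betw f I J"
  shows "pos_kernel J A \<longleftrightarrow> pos_kernel I (\<lambda>p q. A (f p) (f q))"
proof
  have J_eq: "finite J" "f ` I = J" using assms by (auto simp: bij_betw_def)
  show "pos_kernel I (\<lambda>p q. A (f p) (f q))" if "pos_kernel J A"
    using J_eq by (intro pos_kernel_pullback[OF _ that]) auto
  assume "pos_kernel I (\<lambda>p q. A (f p) (f q))"
  then have "pos_kernel J (\<lambda>p q. A (f (inv_into I f p)) (f (inv_into I f q)))"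
    using assms J_eq by (intro pos_kernel_pullback[of I "\<lambda>p q. A (f p) (f q)" "inv_into I f"])
      (auto simp: inv_into_into)
  then show "pos_kernel J A" by (rule pos_kernel_cong)
    (simp add: bij_betw_inv_into_right[OF assms(2)])
qed

lemma kernel_flip_flip [simp]: "kernel_flip (kernel_flip A) = A"
  by (simp add: kernel_flip_def fun_eq_iff)

lemma kernel_flip_link:
  "kernel_flip (kernel_link K A B) = kernel_link K (kernel_flip B) (kernel_flip A)"
  by (simp add: kernel_flip_def kernel_link_def fun_eq_iff mult.commute)

lemma kernel_link_assoc: "kernel_link L (kernel_link K A B) C = kernel_link K A (kernel_link L B C)"
proof (intro ext)
  fix p q
  have "kernel_link L (kernel_link K A B) C p q = (\<Sum>u\<in>L. \<Sum>v\<in>L. \<Sum>x\<in>K. \<Sum>y\<in>K.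
      A (fst p, x) (fst q, y) * (B (x, u) (y, v) * C (u, snd p) (v, snd q)))"
    by (simp add: kernel_link_def sum_distrib_right mult.assoc)
  also have "\<dots> = kernel_link K A (kernel_link L B C) p q"
    unfolding kernel_link_def fst_conv snd_conv sum_distrib_left by (rule sum_swap4)
  finally show "kernel_link L (kernel_link K A B) C p q = kernel_link K A (kernel_link L B C) p q" .
qed

lemma kernel_link_cong:
  assumes "\<And>p q. p \<in> I \<times> K \<Longrightarrow> q \<in> I \<times> K \<Longrightarrow> A p q = A' p q"
    and "\<And>p q. p \<in> K \<times> J \<Longrightarrow> q \<in> K \<times> J \<Longrightarrow> B p q = B' p q"
    and "p \<in> I \<times> J" "q \<in> I \<times> J"
  shows "kernel_link K A B p q = kernel_link K A' B' p q"
  unfolding kernel_link_def using assms by (intro sum.cong refl arg_cong2[where f = "(*)"]) auto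

lemma kernel_link_mix:
  "kernel_link K (\<lambda>p q. a * A p q + b * A' p q) B
      = (\<lambda>p q. a * kernel_link K A B p q + b * kernel_link K A' B p q)"
  by (simp add: kernel_link_def fun_eq_iff algebra_simps sum.distrib sum_distrib_left)

lemma kernel_link_id_right:
  assumes "finite K" "p \<in> I \<times> K" "q \<in> I \<times> K"
  shows "kernel_link K A id_kernel p q = A p q"
  using assms by (auto simp: kernel_link_def id_kernel_def kernel_rank1_def simp flip: mult.assoc)

lemma kernel_link_id_left:
  assumes "finite K" "p \<in> K \<times> J" "q \<in> K \<times> J"
  shows "kernel_link K id_kernel B p q = B p q"
  using assms
  by (auto simp: kernel_link_def id_kernel_def kernel_rank1_def mult.assoc simp flip:
    sum_distrib_left)

lemma kernel_pair_flip:
  "kernel_pair (J \<times> I) (kernel_flip A) (kernel_flip C) = kernel_pair (I \<times> J) A C"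
proof -
  have "bij_betw prod.swap (J \<times> I) (I \<times> J)" by (auto simp: bij_betw_def)
  from kernel_pair_reindex[OF this] show ?thesis by (simp add: kernel_flip_def[abs_def])
qed

lemma kernel_pair_link_left:
  "kernel_pair (I \<times> J) (kernel_link K A B) C
      = kernel_pair (I \<times> K) A (kernel_link J C (kernel_flip B))"
proof -
  have "kernel_pair J (\<lambda>a b. kernel_link K A B (i, a) (j, b)) (\<lambda>a b. C (i, a) (j, b))
      = kernel_pair K (\<lambda>x y. A (i, x) (j, y))
          (\<lambda>x y. kernel_link J C (kernel_flip B) (i, x) (j, y))" for i j
  proof -
    have "kernel_pair J (\<lambda>a b. kernel_link K A B (i, a) (j, b)) (\<lambda>a b. C (i, a) (j, b))
        = (\<Sum>a\<in>J. \<Sum>b\<in>J. \<Sum>x\<in>K. \<Sum>y\<in>K. A (i, x) (j, y) * (C (i, a) (j, b) * B (x, a) (y, b)))"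
      by (simp add: kernel_pair_def kernel_link_def sum_distrib_left mult_ac)
    also have "\<dots> = kernel_pair K (\<lambda>x y. A (i, x) (j, y))
        (\<lambda>x y. kernel_link J C (kernel_flip B) (i, x) (j, y))"
      unfolding kernel_pair_def kernel_link_def kernel_flip_def prod.swap_def fst_conv snd_conv
        sum_distrib_left
      by (rule sum_swap4)
    finally show ?thesis .
  qed
  then show ?thesis by (simp add: kernel_pair_prod)
qed

lemma kernel_pair_link_right:
  "kernel_pair (I \<times> J) (kernel_link K A B) C
      = kernel_pair (K \<times> J) B (kernel_link I (kernel_flip A) C)"
proof -
  have "kernel_pair (I \<times> J) (kernel_link K A B) C
      = kernel_pair (J \<times> I) (kernel_link K (kernel_flip B) (kernel_flip A)) (kernel_flip C)"
    unfolding kernel_flip_link[symmetric] by (rule kernel_pair_flip[symmetric])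
  also have "\<dots> = kernel_pair (J \<times> K) (kernel_flip B)
      (kernel_flip (kernel_link I (kernel_flip A) C))"
    by (simp add: kernel_pair_link_left kernel_flip_link)
  also have "\<dots> = kernel_pair (K \<times> J) B (kernel_link I (kernel_flip A) C)" by (rule kernel_pair_flip)
  finally show ?thesis .
qed

lemma kernel_link_rank1:
  "kernel_link K (kernel_rank1 u) (kernel_rank1 v)
      = kernel_rank1 (\<lambda>p. \<Sum>x\<in>K. u (fst p, x) * v (x, snd p))"
  by (simp add: kernel_link_def kernel_rank1_def fun_eq_iff sum_product mult_ac)

lemma pos_kernel_flip:
  assumes "finite I" "finite J" "pos_kernel (I \<times> J) A"
  shows "pos_kernel (J \<times> I) (kernel_flip A)"
  unfolding kernel_flip_def[abs_def] by (rule pos_kernel_pullback[OF _ assms(3)])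
    (use assms in auto)

lemma pos_kernel_tensor:
  assumes "finite I" "finite J" "pos_kernel I A" "pos_kernel J B"
  shows "pos_kernel (I \<times> J) (kernel_tensor A B)"
  unfolding kernel_tensor_def[abs_def] using assms
  by (intro pos_kernel_mult pos_kernel_pullback[of I A fst] pos_kernel_pullback[of J B snd]) auto

lemma pos_kernel_link:
  assumes "finite I" "finite J" "finite K" "pos_kernel (I \<times> K) A" "pos_kernel (K \<times> J) B"
  shows "pos_kernel (I \<times> J) (kernel_link K A B)"
proof -
  let ?A = "\<lambda>z w. A (fst (fst z), snd z) (fst (fst w), snd w)"
  let ?B = "\<lambda>z w. B (snd z, snd (fst z)) (snd w, snd (fst w))"
  have "pos_kernel ((I \<times> J) \<times> K) (\<lambda>z w. ?A z w * ?B z w)"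
  proof (rule pos_kernel_mult)
    show "pos_kernel ((I \<times> J) \<times> K) ?A"
      by (rule pos_kernel_pullback[of "I \<times> K" A "\<lambda>z. (fst (fst z), snd z)"]) (use assms in auto)
    show "pos_kernel ((I \<times> J) \<times> K) ?B"
      by (rule pos_kernel_pullback[of "K \<times> J" B "\<lambda>z. (snd z, snd (fst z))"]) (use assms in auto)
  qed (use assms in simp)
  from pos_kernel_marginal[OF this] show ?thesis by (simp add: kernel_link_def[abs_def])
qed

lemma kernel_link_mono:
  assumes "finite I" "finite J" "finite K" "pos_kernel (I \<times> K) A" "kernel_le (K \<times> J) B C"
  shows "kernel_le (I \<times> J) (kernel_link K A B) (kernel_link K A C)"
proof -
  have "kernel_link K A (\<lambda>p q. C p q - B p q)
      = (\<lambda>p q. kernel_link K A C p q - kernel_link K A B p q)"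
    by (simp add: kernel_link_def fun_eq_iff right_diff_distrib sum_subtractf)
  then show ?thesis using pos_kernel_link[OF assms(1-4)] assms(5) by (fastforce simp: kernel_le_def)
qed

lemma pos_kernel_id: "pos_kernel I id_kernel"
  unfolding id_kernel_def by (rule pos_kernel_rank1)

lemma pos_kernel_partial_trace:
  assumes "finite I" "finite J" "pos_kernel (I \<times> J) A"
  shows "pos_kernel I (partial_trace J A)"
  unfolding partial_trace_def[abs_def]
  by (intro pos_kernel_sum pos_kernel_pullback[OF _ assms(3)]) (use assms in auto)

lemma kernel_trace_prod: "kernel_trace (I \<times> J) A = kernel_trace I (partial_trace J A)"
  by (simp add: kernel_trace_def partial_trace_def sum.cartesian_product')

lemma partial_trace_link:
  assumes "finite K" "\<And>x y. x \<in> K \<Longrightarrow> y \<in> K \<Longrightarrow> partial_trace J B x y = t * of_bool (x = y)"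
  shows "partial_trace J (kernel_link K A B) i j = t * partial_trace K A i j"
proof -
  have "partial_trace J (kernel_link K A B) i j
      = (\<Sum>x\<in>K. \<Sum>y\<in>K. A (i, x) (j, y) * partial_trace J B x y)"
  proof -
    have "(\<Sum>a\<in>J. \<Sum>x\<in>K. \<Sum>y\<in>K. A (i, x) (j, y) * B (x, a) (y, a))
        = (\<Sum>x\<in>K. \<Sum>a\<in>J. \<Sum>y\<in>K. A (i, x) (j, y) * B (x, a) (y, a))"
      by (rule sum.swap)
    also have "\<dots> = (\<Sum>x\<in>K. \<Sum>y\<in>K. \<Sum>a\<in>J. A (i, x) (j, y) * B (x, a) (y, a))"
      by (intro sum.cong refl sum.swap)
    finally show ?thesis by (simp add: partial_trace_def kernel_link_def sum_distrib_left)
  qed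
  also have "\<dots> = (\<Sum>x\<in>K. \<Sum>y\<in>K. t * A (i, x) (j, y) * of_bool (x = y))"
    using assms(2) by (intro sum.cong) auto
  finally show ?thesis using assms(1) by (simp add: partial_trace_def sum_distrib_left)
qed

lemma kernel_trace_flip: "kernel_trace (J \<times> I) (kernel_flip A) = kernel_trace (I \<times> J) A"
  by (simp add: kernel_trace_def kernel_flip_def sum.cartesian_product' sum.swap[of _ J])

lemma kernel_trace_link_flip:
  assumes "finite K" "\<And>x y. x \<in> K \<Longrightarrow> y \<in> K \<Longrightarrow> partial_trace J A x y = t * of_bool (x = y)"
  shows "kernel_trace (J \<times> I) (kernel_link K (kernel_flip A) B) = t * kernel_trace (K \<times> I) B"
proof -
  have "kernel_trace (J \<times> I) (kernel_link K (kernel_flip A) B)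
      = kernel_trace (I \<times> J) (kernel_link K (kernel_flip B) A)"
    by (simp add: kernel_trace_flip[of J I, symmetric] kernel_flip_link)
  also have "\<dots> = t * kernel_trace (I \<times> K) (kernel_flip B)"
    unfolding kernel_trace_prod
    by (simp add: kernel_trace_def partial_trace_link[OF assms] sum_distrib_left)
  finally show ?thesis by (simp add: kernel_trace_flip)
qed

lemma kernel_link_tensor_partial_trace:
  "kernel_link K A (kernel_tensor (partial_trace L B) C) p q
    = kernel_tensor (partial_trace L (kernel_link K A B)) C p q"
proof -
  have "(\<Sum>x\<in>K. \<Sum>y\<in>K. \<Sum>l\<in>L. A (fst p, x) (fst q, y) * B (x, l) (y, l))
      = (\<Sum>l\<in>L. \<Sum>x\<in>K. \<Sum>y\<in>K. A (fst p, x) (fst q, y) * B (x, l) (y, l))"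
    by (rule sum_swap3[symmetric])
  then show ?thesis
    by (simp add: kernel_link_def kernel_tensor_def partial_trace_def sum_distrib_left flip:
      mult.assoc sum_distrib_right)
qed

lemma kernel_pair_tensor_one:
  assumes "finite J"
  shows "kernel_pair (I \<times> J) A (kernel_tensor B kernel_one) = kernel_pair I (partial_trace J A) B"
  using assms
  by (simp add: kernel_pair_prod)
    (simp add: kernel_pair_def kernel_tensor_def partial_trace_def sum_distrib_right
      flip: mult.assoc)

lemma kernel_le_link_inverse:
  assumes fin: "finite M" "finite N" and \<Omega>_pos: "pos_kernel (M \<times> M) \<Omega>"
    and inverse: "\<And>p q. p \<in> M \<times> M \<Longrightarrow> q \<in> M \<times> M \<Longrightarrow> kernel_link M \<Omega> \<Xi> p q = id_kernel p q"
    and dominated: "kernel_le (M \<times> N) \<rho> (kernel_tensor (partial_trace M \<Xi>) kernel_one)"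
  shows "kernel_le (M \<times> N) (kernel_link M \<Omega> \<rho>) kernel_one"
proof -
  have "partial_trace M (kernel_link M \<Omega> \<Xi>) j k = of_bool (j = k)" if "j \<in> M" "k \<in> M" for j k
    using fin(1) that by (simp add: partial_trace_def inverse id_kernel_def kernel_rank1_def)
  then have tensor_one: "kernel_tensor (partial_trace M (kernel_link M \<Omega> \<Xi>)) kernel_one p q
      = kernel_one p q"
    if "p \<in> M \<times> N" "q \<in> M \<times> N" for p q
    using that by (auto simp: kernel_tensor_def prod_eq_iff)
  have "kernel_le (M \<times> N) (kernel_link M \<Omega> \<rho>)
      (kernel_link M \<Omega> (kernel_tensor (partial_trace M \<Xi>) kernel_one))"
    by (rule kernel_link_mono[OF fin(1,2,1) \<Omega>_pos dominated])
  then show ?thesis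
    unfolding kernel_le_def by (rule pos_kernel_cong)
      (simp add: kernel_link_tensor_partial_trace tensor_one)
qed

lemma kernel_pair_link_inverse:
  assumes "finite M"
    and inverse: "\<And>p q. p \<in> M \<times> M \<Longrightarrow> q \<in> M \<times> M \<Longrightarrow> kernel_link M \<Xi> \<Omega> p q = id_kernel p q"
  shows "kernel_pair (N \<times> M) (kernel_flip (kernel_link M \<Omega> \<rho>)) (kernel_link M (kernel_flip F) \<Xi>)
    = kernel_pair (M \<times> N) \<rho> F"
proof -
  have "kernel_pair (N \<times> M) (kernel_flip (kernel_link M \<Omega> \<rho>)) (kernel_link M (kernel_flip F) \<Xi>)
      = kernel_pair (N \<times> M) (kernel_flip \<rho>) (kernel_link M (kernel_flip F) (kernel_link M \<Xi> \<Omega>))"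
    by (simp only: kernel_flip_link kernel_pair_link_left kernel_flip_flip kernel_link_assoc)
  also have "\<dots> = kernel_pair (N \<times> M) (kernel_flip \<rho>) (kernel_flip F)"
  proof (rule kernel_pair_cong)
    fix p q assume grid: "p \<in> N \<times> M" "q \<in> N \<times> M"
    have "kernel_link M (kernel_flip F) (kernel_link M \<Xi> \<Omega>) p q
        = kernel_link M (kernel_flip F) id_kernel p q"
      by (rule kernel_link_cong[OF refl inverse grid])
    then show "kernel_link M (kernel_flip F) (kernel_link M \<Xi> \<Omega>) p q = kernel_flip F p q"
      using kernel_link_id_right[OF assms(1) grid] by simp
  qed simp
  finally show ?thesis by (simp only: kernel_pair_flip)
qed

section \<open>Bipartite matrices\<close>

abbreviation grid :: "nat \<Rightarrow> nat \<Rightarrow> (nat \<times> nat) set" where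
  "grid r n \<equiv> {..<r} \<times> {..<n}"

definition grid_index :: "nat \<Rightarrow> nat \<times> nat \<Rightarrow> nat" where
  "grid_index n z = fst z * n + snd z"

definition bip_kernel :: "nat \<Rightarrow> complex mat \<Rightarrow> (nat \<times> nat) kernel" where
  "bip_kernel n A p q = A $$ (grid_index n p, grid_index n q)"

definition bip_mat :: "nat \<Rightarrow> nat \<Rightarrow> (nat \<times> nat) kernel \<Rightarrow> complex mat" where
  "bip_mat r n C = mat (r * n) (r * n) (\<lambda>(p, q). C (p div n, p mod n) (q div n, q mod n))"

lemma grid_index_less: "i < r \<Longrightarrow> a < n \<Longrightarrow> i * n + a < r * (n :: nat)"
proof -
  assume "i < r" "a < n"
  then have "i * n + a < Suc i * n" by simp
  also have "\<dots> \<le> r * n" using \<open>i < r\<close> by (intro mult_le_mono1) simp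
  finally show ?thesis .
qed

lemma div_mod_grid:
  assumes "p < r * (n :: nat)"
  shows "p div n < r" "p mod n < n"
proof -
  have "n > 0" using assms by (cases n) auto
  then show "p div n < r" "p mod n < n" using assms by (auto simp: less_mult_imp_div_less)
qed

lemma grid_index_div_mod [simp]: "grid_index n (p div n, p mod n) = p"
  by (simp add: grid_index_def)

lemma bij_betw_grid_index: "bij_betw (grid_index n) (grid r n) {..<r * n}"
  by (rule bij_betw_byWitness[where f' = "\<lambda>p. (p div n, p mod n)"])
    (auto simp: grid_index_def grid_index_less div_mod_grid)

lemma psd_iff_pos_bip_kernel:
  "psd (r * n) A \<longleftrightarrow> A \<in> carrier_mat (r * n) (r * n) \<and> pos_kernel (grid r n) (bip_kernel n A)"
  using pos_kernel_reindex[OF _ bij_betw_grid_index[of n r], of "mat_kernel A"]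
  by (simp add: psd_iff_pos_kernel bip_kernel_def[abs_def])

lemma bip_mat_carrier [simp]: "bip_mat r n C \<in> carrier_mat (r * n) (r * n)"
  by (simp add: bip_mat_def)

lemma bip_kernel_bip_mat: "p \<in> grid r n \<Longrightarrow> q \<in> grid r n \<Longrightarrow> bip_kernel n (bip_mat r n C) p q = C p q"
  by (auto simp: bip_kernel_def bip_mat_def grid_index_def grid_index_less)

lemma psd_bip_mat: "pos_kernel (grid r n) C \<Longrightarrow> psd (r * n) (bip_mat r n C)"
  unfolding psd_iff_pos_bip_kernel using pos_kernel_cong[OF _ bip_kernel_bip_mat] by simp

lemma mtrace_eq_bip_kernel_trace:
  "A \<in> carrier_mat (r * n) (r * n) \<Longrightarrow> mtrace A = kernel_trace (grid r n) (bip_kernel n A)"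
  by (simp add: mtrace_eq_kernel_trace kernel_trace_reindex[OF bij_betw_grid_index]
    bip_kernel_def[abs_def])

lemma mtrace_bip_mat: "mtrace (bip_mat r n C) = kernel_trace (grid r n) C"
  unfolding mtrace_eq_bip_kernel_trace[OF bip_mat_carrier] kernel_trace_def
  by (intro sum.cong refl bip_kernel_bip_mat)

lemma state_bip_mat: "state_kernel (grid r n) C \<Longrightarrow> state (r * n) (bip_mat r n C)"
  by (simp add: state_def state_kernel_def psd_bip_mat mtrace_bip_mat)

lemma state_kernel_bip_kernel: "state (r * n) A \<Longrightarrow> state_kernel (grid r n) (bip_kernel n A)"
  by (simp add: state_def state_kernel_def psd_iff_pos_bip_kernel
    mtrace_eq_bip_kernel_trace[of A r n, symmetric])

lemma mtrace_mult:
  assumes "A \<in> carrier_mat d d" "B \<in> carrier_mat d d"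
  shows "mtrace (A * B) = kernel_pair {..<d} (mat_kernel A) (kernel_transpose (mat_kernel B))"
proof -
  have "A * B \<in> carrier_mat d d" using assms by simp
  then show ?thesis
    by (simp add: mtrace_eq_kernel_trace kernel_trace_def mat_kernel_mult[OF assms] kernel_mult_def
        kernel_pair_def kernel_transpose_def del: index_mult_mat)
qed

abbreviation effect_kernel :: "nat \<Rightarrow> complex mat \<Rightarrow> (nat \<times> nat) kernel" where
  "effect_kernel n A \<equiv> kernel_transpose (bip_kernel n A)"

lemma mtrace_mult_bip_kernel:
  assumes "A \<in> carrier_mat (r * n) (r * n)" "B \<in> carrier_mat (r * n) (r * n)"
  shows "mtrace (A * B) = kernel_pair (grid r n) (bip_kernel n A)
      (effect_kernel n B)"
  unfolding mtrace_mult[OF assms] kernel_pair_reindex[OF bij_betw_grid_index]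
  by (simp add: bip_kernel_def[abs_def] kernel_transpose_def[abs_def])

lemma trace_norm_bip_completion:
  assumes A_carrier: "A \<in> carrier_mat (r * n) (r * n)"
  obtains Z where "completion (grid r n) (bip_kernel n A) Z"
    "\<And>e. kernel_trace (grid r n) (corner e Z) = of_real (trace_norm A)"
proof -
  obtain Z where completion: "completion {..<r * n} (mat_kernel A) Z"
    and corner_trace: "\<And>e. kernel_trace {..<r * n} (corner e Z) = of_real (trace_norm A)"
    using trace_norm_completion[OF A_carrier] by blast
  let ?Z = "\<lambda>z w. Z (map_prod id (grid_index n) z) (map_prod id (grid_index n) w)"
  have "completion (grid r n) (bip_kernel n A) ?Z"
    using completion unfolding completion_def
    by (auto simp: bip_kernel_def grid_index_def grid_index_less intro!:
      pos_kernel_pullback[of "UNIV \<times> {..<r * n}"])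
  moreover have "kernel_trace (grid r n) (corner e ?Z) = of_real (trace_norm A)" for e
    using corner_trace[of e] kernel_trace_reindex[OF bij_betw_grid_index[of n r], of "corner e Z"]
    by (simp add: corner_def[abs_def])
  ultimately show ?thesis by (rule that)
qed

lemma trace_norm_le_bip_completion:
  assumes A_carrier: "A \<in> carrier_mat (r * n) (r * n)"
    and completion: "completion (grid r n) (bip_kernel n A) Z"
  shows "trace_norm A \<le> (Re (kernel_trace (grid r n) (corner False Z))
      + Re (kernel_trace (grid r n) (corner True Z))) / 2"
proof -
  let ?f = "\<lambda>p. (p div n, p mod n)"
  let ?Z = "\<lambda>z w. Z (map_prod id ?f z) (map_prod id ?f w)"
  have "completion {..<r * n} (mat_kernel A) ?Z"
    using completion unfolding completion_def
    by (auto simp: bip_kernel_def div_mod_grid intro!: pos_kernel_pullback[of "UNIV \<times> grid r n"])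
  moreover have "kernel_trace {..<r * n} (corner e ?Z) = kernel_trace (grid r n) (corner e Z)" for e
    by (subst kernel_trace_reindex[OF bij_betw_grid_index])
      (auto simp: kernel_trace_def corner_def grid_index_def intro!: sum.cong)
  ultimately show ?thesis using trace_norm_le_completion[OF A_carrier, of ?Z] by simp
qed

lemma abs_kernel_pair_traceless_le:
  assumes traceless: "D \<in> carrier_mat (r * n) (r * n)" "mtrace D = 0"
    and T_effect: "pos_kernel (grid r n) T" "kernel_le (grid r n) T kernel_one"
  shows "\<bar>Re (kernel_pair (grid r n) T (bip_kernel n D))\<bar> \<le> trace_norm D / 2"
proof -
  have upper: "Re (kernel_pair (grid r n) S (bip_kernel n D)) \<le> trace_norm D / 2"
    if S_effect: "pos_kernel (grid r n) S" "kernel_le (grid r n) S kernel_one" for S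
  proof -
    let ?f = "\<lambda>p. (p div n, p mod n)"
    let ?S = "\<lambda>p q. S (?f p) (?f q)"
    have div_mod_eq: "p div n = q div n \<and> p mod n = q mod n \<longleftrightarrow> p = q" for p q
      by (metis div_mult_mod_eq)
    have div_mod_index: "?f (grid_index n p) = p" if "p \<in> grid r n" for p using that
      by (auto simp: grid_index_def)
    have "pos_kernel {..<r * n} ?S" by (rule pos_kernel_pullback[OF _ S_effect(1)])
      (auto simp: div_mod_grid)
    moreover have "kernel_le {..<r * n} ?S kernel_one"
      unfolding kernel_le_def
      using pos_kernel_pullback[OF _ S_effect(2)[unfolded kernel_le_def], of ?f "{..<r * n}"]
      by (rule pos_kernel_cong) (auto simp: div_mod_grid div_mod_eq)
    ultimately have "Re (kernel_pair {..<r * n} ?S (mat_kernel D)) \<le> trace_norm D / 2"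
      by (rule kernel_pair_traceless_le[OF traceless])
    also have "kernel_pair {..<r * n} ?S (mat_kernel D) = kernel_pair (grid r n) S (bip_kernel n D)"
      unfolding kernel_pair_reindex[OF bij_betw_grid_index] by (rule kernel_pair_cong)
        (simp_all add: div_mod_index bip_kernel_def)
    finally show ?thesis .
  qed
  let ?T' = "\<lambda>p q. kernel_one p q - T p q"
  have "kernel_pair (grid r n) ?T' (bip_kernel n D)
      = mtrace D - kernel_pair (grid r n) T (bip_kernel n D)"
    by (simp add: kernel_pair_commute[of _ _ "bip_kernel n D"] kernel_pair_linear kernel_pair_one
        mtrace_eq_bip_kernel_trace[OF traceless(1)])
  moreover have "pos_kernel (grid r n) ?T'" "kernel_le (grid r n) ?T' kernel_one"
    using T_effect by (simp_all add: kernel_le_def)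
  ultimately show ?thesis using upper[of ?T'] upper[OF T_effect] traceless(2) by simp
qed

section \<open>Choi kernels of linear maps\<close>

text \<open>The Choi kernel of \<open>\<phi>\<close> has the entries \<open>c (i, a) (j, b) = \<langle>a|\<phi>(|i\<rangle>\<langle>j|)|b\<rangle>\<close>, with the input
  index first.\<close>

definition has_choi_kernel :: "nat \<Rightarrow> nat \<Rightarrow> cmap \<Rightarrow> (nat \<times> nat) kernel \<Rightarrow> bool" where
  "has_choi_kernel r n \<phi> c \<longleftrightarrow> (\<forall>X\<in>carrier_mat r r. \<phi> X \<in> carrier_mat n n \<and>
     (\<forall>a<n. \<forall>b<n. \<phi> X $$ (a, b) = (\<Sum>i<r. \<Sum>j<r. X $$ (i, j) * c (i, a) (j, b))))"

lemma has_choi_kernel_carrier: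
  "has_choi_kernel r n \<phi> c \<Longrightarrow> X \<in> carrier_mat r r \<Longrightarrow> \<phi> X \<in> carrier_mat n n"
  by (simp add: has_choi_kernel_def)

lemma has_choi_kernel_index:
  "has_choi_kernel r n \<phi> c \<Longrightarrow> X \<in> carrier_mat r r \<Longrightarrow> a < n \<Longrightarrow> b < n \<Longrightarrow>
    \<phi> X $$ (a, b) = (\<Sum>i<r. \<Sum>j<r. X $$ (i, j) * c (i, a) (j, b))"
  by (simp add: has_choi_kernel_def)

lemma munit_carrier [simp]: "munit d i j \<in> carrier_mat d d"
  by (simp add: munit_def)

lemma munit_index: "x < d \<Longrightarrow> y < d \<Longrightarrow> munit d i j $$ (x, y) = of_bool (x = i) * of_bool (y = j)"
  by (simp add: munit_def)

lemma sum_munit: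
  assumes "i < d" "j < d"
  shows "(\<Sum>x<d. \<Sum>y<d. munit d i j $$ (x, y) * f x y) = f i j"
  using assms by (simp add: munit_index mult.assoc flip: sum_distrib_left)

lemma has_choi_kernel_munit:
  assumes "has_choi_kernel r n \<phi> c" "i < r" "j < r" "a < n" "b < n"
  shows "\<phi> (munit r i j) $$ (a, b) = c (i, a) (j, b)"
  using has_choi_kernel_index[OF assms(1) munit_carrier assms(4,5)] sum_munit[OF assms(2,3)] by simp

lemma has_choi_kernel_of_lin_map:
  assumes linear: "lin_map r n \<phi>"
  shows "has_choi_kernel r n \<phi> (\<lambda>p q. \<phi> (munit r (fst p) (fst q)) $$ (snd p, snd q))"
  unfolding has_choi_kernel_def
proof (intro ballI conjI allI impI)
  fix X :: "complex mat" assume X_carrier: "X \<in> carrier_mat r r"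
  show image_carrier: "\<phi> X \<in> carrier_mat n n" using linear X_carrier by (simp add: lin_map_def)
  fix a b assume ab_less: "a < n" "b < n"
  define part where "part S = mat r r (\<lambda>z. if z \<in> S then X $$ z else 0)" for S
  have "\<phi> (part S) $$ (a, b) = (\<Sum>z\<in>S. X $$ z * \<phi> (munit r (fst z) (snd z)) $$ (a, b))"
    if "finite S" "S \<subseteq> grid r r" for S
    using that
  proof (induction S rule: finite_induct)
    case empty
    have "part {} = 0 \<cdot>\<^sub>m X" using X_carrier by (intro eq_matI) (auto simp: part_def)
    then have "\<phi> (part {}) = 0 \<cdot>\<^sub>m \<phi> X" using linear X_carrier by (simp add: lin_map_def)
    then show ?case using image_carrier ab_less by simp
  next
    case (insert z S)
    let ?E = "munit r (fst z) (snd z)"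
    have "part (insert z S) = part S + X $$ z \<cdot>\<^sub>m ?E"
      using insert.hyps insert.prems X_carrier by (intro eq_matI) (auto simp: part_def munit_def)
    then have "\<phi> (part (insert z S)) = \<phi> (part S) + X $$ z \<cdot>\<^sub>m \<phi> ?E"
      using linear by (simp add: lin_map_def part_def)
    moreover have "\<phi> (part S) \<in> carrier_mat n n" "\<phi> ?E \<in> carrier_mat n n"
      using linear by (simp_all add: lin_map_def part_def)
    ultimately show ?case using insert ab_less by simp
  qed
  from this[of "grid r r"] have "\<phi> (part (grid r r)) $$ (a, b)
      = (\<Sum>i<r. \<Sum>j<r. X $$ (i, j) * \<phi> (munit r i j) $$ (a, b))"
    by (simp add: sum.cartesian_product')
  moreover have "part (grid r r) = X" using X_carrier by (intro eq_matI) (auto simp: part_def)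
  ultimately show "\<phi> X $$ (a, b) = (\<Sum>i<r. \<Sum>j<r. X $$ (i, j) *
      \<phi> (munit r (fst (i, a)) (fst (j, b))) $$ (snd (i, a), snd (j, b)))" by simp
qed

lemma lin_map_of_has_choi_kernel:
  assumes "has_choi_kernel r n \<phi> c"
  shows "lin_map r n \<phi>"
proof -
  note carrier = has_choi_kernel_carrier[OF assms] and index = has_choi_kernel_index[OF assms]
  have "\<phi> (A + B) = \<phi> A + \<phi> B" if "A \<in> carrier_mat r r" "B \<in> carrier_mat r r" for A B
    using that carrier[of A] carrier[of B] carrier[of "A + B"]
    by (intro eq_matI) (auto simp: index distrib_right sum.distrib)
  moreover have "\<phi> (k \<cdot>\<^sub>m A) = k \<cdot>\<^sub>m \<phi> A" if "A \<in> carrier_mat r r" for A k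
    using that carrier[of A] carrier[of "k \<cdot>\<^sub>m A"]
    by (intro eq_matI) (auto simp: index sum_distrib_left mult.assoc)
  ultimately show ?thesis using carrier by (simp add: lin_map_def)
qed

definition map_of_kernel :: "nat \<Rightarrow> nat \<Rightarrow> (nat \<times> nat) kernel \<Rightarrow> cmap" where
  "map_of_kernel r n c X = mat n n (\<lambda>(a, b). \<Sum>i<r. \<Sum>j<r. X $$ (i, j) * c (i, a) (j, b))"

lemma has_choi_kernel_map_of_kernel: "has_choi_kernel r n (map_of_kernel r n c) c"
  by (simp add: has_choi_kernel_def map_of_kernel_def)

lemma has_choi_kernel_comp:
  assumes choi_\<alpha>: "has_choi_kernel r m \<alpha> c" and choi_\<phi>: "has_choi_kernel m n \<phi> d"
  shows "has_choi_kernel r n (\<lambda>X. \<phi> (\<alpha> X)) (kernel_link {..<m} c d)"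
  unfolding has_choi_kernel_def
proof (intro ballI conjI allI impI)
  fix X :: "complex mat" assume X_carrier: "X \<in> carrier_mat r r"
  have image_carrier: "\<alpha> X \<in> carrier_mat m m" by (rule has_choi_kernel_carrier[OF choi_\<alpha> X_carrier])
  then show "\<phi> (\<alpha> X) \<in> carrier_mat n n" by (rule has_choi_kernel_carrier[OF choi_\<phi>])
  fix a b assume ab_less: "a < n" "b < n"
  have "\<phi> (\<alpha> X) $$ (a, b)
      = (\<Sum>x<m. \<Sum>y<m. \<Sum>i<r. \<Sum>j<r. X $$ (i, j) * (c (i, x) (j, y) * d (x, a) (y, b)))"
    by (simp add: has_choi_kernel_index[OF choi_\<phi> image_carrier ab_less]
      has_choi_kernel_index[OF choi_\<alpha> X_carrier] sum_distrib_right mult.assoc)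
  also have "\<dots> = (\<Sum>i<r. \<Sum>j<r. X $$ (i, j) * kernel_link {..<m} c d (i, a) (j, b))"
    unfolding kernel_link_def fst_conv snd_conv sum_distrib_left by (rule sum_swap4)
  finally show "\<phi> (\<alpha> X) $$ (a, b)
      = (\<Sum>i<r. \<Sum>j<r. X $$ (i, j) * kernel_link {..<m} c d (i, a) (j, b))" .
qed

lemma has_choi_kernel_diff:
  assumes "has_choi_kernel r n \<phi> c" "has_choi_kernel r n \<psi> d"
  shows "has_choi_kernel r n (\<lambda>X. \<phi> X - \<psi> X) (\<lambda>p q. c p q - d p q)"
proof -
  have "\<phi> X - \<psi> X \<in> carrier_mat n n" if "X \<in> carrier_mat r r" for X
    using has_choi_kernel_carrier[OF assms(2) that] by (rule minus_carrier_mat)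
  moreover have "(\<phi> X - \<psi> X) $$ (a, b)
      = (\<Sum>i<r. \<Sum>j<r. X $$ (i, j) * (c (i, a) (j, b) - d (i, a) (j, b)))"
    if "X \<in> carrier_mat r r" "a < n" "b < n" for X a b
    using has_choi_kernel_carrier[OF assms(2) that(1)] that
    by (simp add: has_choi_kernel_index[OF assms(1) that] has_choi_kernel_index[OF assms(2) that]
        right_diff_distrib sum_subtractf)
  ultimately show ?thesis by (simp add: has_choi_kernel_def)
qed

lemma bip_kernel_id_tensor:
  assumes choi_\<phi>: "has_choi_kernel r n \<phi> c" and "p \<in> grid m n" "q \<in> grid m n"
  shows "bip_kernel n (id_tensor m r n \<phi> P) p q = kernel_link {..<r} (bip_kernel r P) c p q"
proof -
  obtain i a j b where pq_eq: "p = (i, a)" "q = (j, b)" "i < m" "j < m" "a < n" "b < n" using assms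
    by auto
  let ?X = "mat r r (\<lambda>(x, y). P $$ (i * r + x, j * r + y))"
  have "bip_kernel n (id_tensor m r n \<phi> P) p q = \<phi> ?X $$ (a, b)"
    using pq_eq by (simp add: bip_kernel_def id_tensor_def grid_index_def grid_index_less)
  also have "\<dots> = (\<Sum>x<r. \<Sum>y<r. ?X $$ (x, y) * c (x, a) (y, b))"
    by (rule has_choi_kernel_index[OF choi_\<phi>]) (use pq_eq in auto)
  finally show ?thesis by (simp add: kernel_link_def bip_kernel_def grid_index_def pq_eq)
qed

lemma bip_kernel_tensor_id:
  assumes choi_\<psi>: "has_choi_kernel r n \<psi> c" and "p \<in> grid n d" "q \<in> grid n d"
  shows "bip_kernel d (tensor_id r n d \<psi> P) p q
      = kernel_link {..<r} (kernel_flip c) (bip_kernel d P) p q"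
proof -
  obtain a x b y where pq_eq: "p = (a, x)" "q = (b, y)" "a < n" "b < n" "x < d" "y < d" using assms
    by auto
  let ?X = "mat r r (\<lambda>(i, j). P $$ (i * d + x, j * d + y))"
  have "bip_kernel d (tensor_id r n d \<psi> P) p q = \<psi> ?X $$ (a, b)"
    using pq_eq by (simp add: bip_kernel_def tensor_id_def grid_index_def grid_index_less)
  also have "\<dots> = (\<Sum>i<r. \<Sum>j<r. ?X $$ (i, j) * c (i, a) (j, b))"
    by (rule has_choi_kernel_index[OF choi_\<psi>]) (use pq_eq in auto)
  finally show ?thesis
    by (simp add: kernel_link_def kernel_flip_def bip_kernel_def grid_index_def pq_eq mult.commute)
qed

lemma id_tensor_carrier [simp]: "id_tensor m r n \<phi> P \<in> carrier_mat (m * n) (m * n)"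
  by (simp add: id_tensor_def)

lemma tensor_id_carrier [simp]: "tensor_id r n d \<psi> P \<in> carrier_mat (n * d) (n * d)"
  by (simp add: tensor_id_def)

section \<open>Channel kernels\<close>

definition channel_kernel :: "nat \<Rightarrow> nat \<Rightarrow> (nat \<times> nat) kernel \<Rightarrow> bool" where
  "channel_kernel r n c \<longleftrightarrow> pos_kernel (grid r n) c \<and>
     (\<forall>i<r. \<forall>j<r. partial_trace {..<n} c i j = of_bool (i = j))"

lemma channel_kernel_pos: "channel_kernel r n c \<Longrightarrow> pos_kernel (grid r n) c"
  by (simp add: channel_kernel_def)

lemma channel_kernel_partial_trace:
  "channel_kernel r n c \<Longrightarrow> i < r \<Longrightarrow> j < r \<Longrightarrow> partial_trace {..<n} c i j = of_bool (i = j)"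
  by (simp add: channel_kernel_def)

lemma channel_kernel_trace: "channel_kernel r n c \<Longrightarrow> kernel_trace (grid r n) c = of_nat r"
  by (simp add: kernel_trace_prod) (simp add: kernel_trace_def channel_kernel_partial_trace)

lemma channel_kernel_adjoint:
  assumes "channel_kernel r n c" "p \<in> grid r n" "q \<in> grid r n"
  shows "cnj (c q p) = c p q"
  using pos_kernel_herm[OF _ channel_kernel_pos[OF assms(1)]] assms(2,3) unfolding herm_kernel_def
  by (metis complex_cnj_cnj finite_cartesian_product finite_lessThan)

lemma channel_kernel_link:
  assumes "channel_kernel r m c" "channel_kernel m n d"
  shows "channel_kernel r n (kernel_link {..<m} c d)"
  using assms partial_trace_link[of "{..<m}" "{..<n}" d 1 c]
  by (simp add: channel_kernel_def pos_kernel_link)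

lemma channel_kernel_depolarising:
  assumes "0 < n"
  shows "channel_kernel r n (\<lambda>p q. of_real (1 / n) * kernel_one p q)"
  unfolding channel_kernel_def
proof (intro conjI allI impI)
  show "pos_kernel (grid r n) (\<lambda>p q. of_real (1 / n) * kernel_one p q)"
    by (intro pos_kernel_scale pos_kernel_one) auto
qed (use assms in \<open>simp add: partial_trace_def\<close>)

lemma channel_kernel_id: "channel_kernel m m id_kernel"
  unfolding channel_kernel_def
proof (intro conjI allI impI)
  show "pos_kernel (grid m m) id_kernel" by (rule pos_kernel_id)
qed (auto simp: partial_trace_def id_kernel_def kernel_rank1_def)

lemma channel_kernel_mix:
  assumes "channel_kernel r n c" "channel_kernel r n d" "0 \<le> t" "t \<le> (1::real)"
  shows "channel_kernel r n (\<lambda>p q. of_real (1 - t) * c p q + of_real t * d p q)"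
  unfolding channel_kernel_def
proof (intro conjI allI impI)
  show "pos_kernel (grid r n) (\<lambda>p q. of_real (1 - t) * c p q + of_real t * d p q)"
    using assms by (intro pos_kernel_add pos_kernel_scale channel_kernel_pos) auto
  fix i j assume ij_less: "i < r" "j < r"
  have "partial_trace {..<n} (\<lambda>p q. of_real (1 - t) * c p q + of_real t * d p q) i j
      = of_real (1 - t) * partial_trace {..<n} c i j + of_real t * partial_trace {..<n} d i j"
    by (simp add: partial_trace_def sum.distrib sum_distrib_left)
  also have "\<dots> = of_bool (i = j)"
    using ij_less channel_kernel_partial_trace[OF assms(1)]
      channel_kernel_partial_trace[OF assms(2)]
    by (simp add: algebra_simps)
  finally show "partial_trace {..<n} (\<lambda>p q. of_real (1 - t) * c p q + of_real t * d p q) i j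
      = of_bool (i = j)" .
qed

lemma max_ent_block:
  assumes "x < d" "y < d"
  shows "mat d d (\<lambda>(i, j). max_ent d $$ (x * d + i, y * d + j)) = munit d x y"
    and "mat d d (\<lambda>(i, j). max_ent d $$ (i * d + x, j * d + y)) = munit d x y"
  using assms by (auto intro!: eq_matI simp: max_ent_def munit_def grid_index_less)

lemma psd_max_ent: "psd (d * d) (max_ent d)"
proof -
  have "pos_kernel {..<d * d} (kernel_rank1 (\<lambda>p. of_bool (p div d = p mod d)))"
    by (rule pos_kernel_rank1)
  then have "pos_kernel {..<d * d} (mat_kernel (max_ent d))"
    by (rule pos_kernel_cong) (auto simp: max_ent_def kernel_rank1_def)
  then show ?thesis by (simp add: psd_iff_pos_kernel max_ent_def)
qed

lemma mtrace_munit: "i < d \<Longrightarrow> mtrace (munit d i j) = of_bool (i = j)"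
  by (auto simp: mtrace_def munit_index munit_def intro!: sum.neutral)

lemma mtrace_has_choi_kernel:
  assumes "has_choi_kernel r n \<phi> c" "X \<in> carrier_mat r r"
  shows "mtrace (\<phi> X) = (\<Sum>i<r. \<Sum>j<r. X $$ (i, j) * partial_trace {..<n} c i j)"
proof -
  have "mtrace (\<phi> X) = (\<Sum>a<n. \<Sum>i<r. \<Sum>j<r. X $$ (i, j) * c (i, a) (j, a))"
    using has_choi_kernel_carrier[OF assms]
    by (simp add: mtrace_def has_choi_kernel_index[OF assms])
  also have "\<dots> = (\<Sum>i<r. \<Sum>j<r. \<Sum>a<n. X $$ (i, j) * c (i, a) (j, a))" by (rule sum_swap3)
  finally show ?thesis by (simp add: partial_trace_def sum_distrib_left)
qed

lemma channel_kernel_of_channel: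
  assumes channel_\<phi>: "channel r n \<phi>" and choi_c: "has_choi_kernel r n \<phi> c"
  shows "channel_kernel r n c"
proof (cases "r = 0")
  case True
  then show ?thesis by (simp add: channel_kernel_def pos_kernel_def inner_on_def)
next
  case False
  have "psd (r * n) (id_tensor r r n \<phi> (max_ent r))"
    using channel_\<phi> psd_max_ent False by (simp add: channel_def CP_map_def)
  then have "pos_kernel (grid r n) (bip_kernel n (id_tensor r r n \<phi> (max_ent r)))"
    by (simp add: psd_iff_pos_bip_kernel)
  then have pos: "pos_kernel (grid r n) c"
    by (rule pos_kernel_cong)
      (auto simp: bip_kernel_def id_tensor_def grid_index_def grid_index_less max_ent_block
        has_choi_kernel_munit[OF choi_c])
  have "partial_trace {..<n} c i j = of_bool (i = j)" if "i < r" "j < r" for i j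
    using channel_\<phi> mtrace_has_choi_kernel[OF choi_c munit_carrier, of i j] sum_munit[OF that]
      mtrace_munit[OF that(1)]
    by (simp add: channel_def TP_map_def)
  with pos show ?thesis by (simp add: channel_kernel_def)
qed

lemma channel_of_channel_kernel:
  assumes channel_c: "channel_kernel r n c" and choi_\<phi>: "has_choi_kernel r n \<phi> c"
  shows "channel r n \<phi>"
  unfolding channel_def
proof (intro conjI)
  show "lin_map r n \<phi>" by (rule lin_map_of_has_choi_kernel[OF choi_\<phi>])
  show "CP_map r n \<phi>"
    unfolding CP_map_def
  proof (intro allI impI)
    fix m P assume "psd (m * r) P"
    then have "pos_kernel (grid m n) (kernel_link {..<r} (bip_kernel r P) c)"
      using channel_kernel_pos[OF channel_c] by (intro pos_kernel_link)
        (auto simp: psd_iff_pos_bip_kernel)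
    then have "pos_kernel (grid m n) (bip_kernel n (id_tensor m r n \<phi> P))"
      by (rule pos_kernel_cong) (rule bip_kernel_id_tensor[OF choi_\<phi>])
    then show "psd (m * n) (id_tensor m r n \<phi> P)" by (simp add: psd_iff_pos_bip_kernel)
  qed
  show "TP_map r n \<phi>"
    unfolding TP_map_def
  proof
    fix X :: "complex mat" assume X_carrier: "X \<in> carrier_mat r r"
    show "mtrace (\<phi> X) = mtrace X"
      unfolding mtrace_has_choi_kernel[OF choi_\<phi> X_carrier] using X_carrier
      by (simp add: mtrace_def channel_kernel_partial_trace[OF channel_c])
  qed
qed

theorem channel_iff_channel_kernel:
  "channel r n \<phi> \<longleftrightarrow> (\<exists>c. channel_kernel r n c \<and> has_choi_kernel r n \<phi> c)"
proof
  assume channel_\<phi>: "channel r n \<phi>"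
  then have "lin_map r n \<phi>" by (simp add: channel_def)
  from has_choi_kernel_of_lin_map[OF this] show "\<exists>c. channel_kernel r n c \<and> has_choi_kernel r n \<phi> c"
    using channel_kernel_of_channel[OF channel_\<phi>] by blast
qed (blast intro: channel_of_channel_kernel)

lemma channelE:
  assumes "channel r n \<phi>"
  obtains c where "channel_kernel r n c" "has_choi_kernel r n \<phi> c"
  using assms by (auto simp: channel_iff_channel_kernel)

lemma channel_map_of_kernel: "channel_kernel r n c \<Longrightarrow> channel r n (map_of_kernel r n c)"
  by (rule channel_of_channel_kernel[OF _ has_choi_kernel_map_of_kernel])

lemma channel_image_eq:
  assumes agree: "\<And>\<alpha> c. channel_kernel r m c \<Longrightarrow> has_choi_kernel r m \<alpha> c \<Longrightarrow> f \<alpha> = g c"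
  shows "{f \<alpha> | \<alpha>. channel r m \<alpha>} = {g c | c. channel_kernel r m c}"
proof (rule subset_antisym; rule subsetI)
  fix x assume "x \<in> {f \<alpha> | \<alpha>. channel r m \<alpha>}"
  then obtain \<alpha> where "x = f \<alpha>" "channel r m \<alpha>" by blast
  then show "x \<in> {g c | c. channel_kernel r m c}" using agree by (blast elim: channelE)
next
  fix x assume "x \<in> {g c | c. channel_kernel r m c}"
  then obtain c where c_channel: "x = g c" "channel_kernel r m c" by blast
  then have "x = f (map_of_kernel r m c)" using agree[OF c_channel(2) has_choi_kernel_map_of_kernel]
    by simp
  then show "x \<in> {f \<alpha> | \<alpha>. channel r m \<alpha>}" using channel_map_of_kernel[OF c_channel(2)] by blast
qed

section \<open>The conditional norm\<close>

definition cond_value :: "nat \<Rightarrow> nat \<Rightarrow> (nat \<times> nat) kernel \<Rightarrow> real" where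
  "cond_value r n \<rho> = Sup {Re (kernel_pair (grid r n) \<rho> c) | c. channel_kernel r n c}"

lemma cond_value_cong:
  "(\<And>p q. p \<in> grid r n \<Longrightarrow> q \<in> grid r n \<Longrightarrow> \<rho> p q = \<rho>' p q) \<Longrightarrow> cond_value r n \<rho> = cond_value r n \<rho>'"
  unfolding cond_value_def using kernel_pair_cong[of "grid r n" \<rho> \<rho>'] by simp

lemma cond_value_upper:
  assumes "channel_kernel r n c"
  shows "Re (kernel_pair (grid r n) \<rho> c) \<le> cond_value r n \<rho>"
  unfolding cond_value_def
proof (rule cSup_upper)
  have "Re (kernel_pair (grid r n) \<rho> c) \<le> (\<Sum>p\<in>grid r n. \<Sum>q\<in>grid r n. cmod (\<rho> p q)) * r"
    if "channel_kernel r n c" for c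
    using kernel_pair_le_trace[OF _ channel_kernel_pos[OF that]] channel_kernel_trace[OF that]
    by simp
  then show "bdd_above {Re (kernel_pair (grid r n) \<rho> c) | c. channel_kernel r n c}"
    by (intro bdd_aboveI) blast
qed (use assms in blast)

lemma cond_value_least:
  assumes "0 < n" "\<And>c. channel_kernel r n c \<Longrightarrow> Re (kernel_pair (grid r n) \<rho> c) \<le> b"
  shows "cond_value r n \<rho> \<le> b"
  unfolding cond_value_def
  by (rule cSup_least) (use channel_kernel_depolarising[OF assms(1)] assms(2) in blast)+

lemma cond_value_approx:
  assumes "0 < n" "0 < e"
  obtains c where "channel_kernel r n c" "cond_value r n \<rho> - e < Re (kernel_pair (grid r n) \<rho> c)"
  using cond_value_least[OF assms(1), of r \<rho> "cond_value r n \<rho> - e"] assms(2) by fastforce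

lemma cond_value_scale:
  assumes "0 < n" "0 < t"
  shows "cond_value r n (\<lambda>p q. of_real t * \<rho> p q) = t * cond_value r n \<rho>"
proof (rule antisym)
  have scale: "Re (kernel_pair (grid r n) (\<lambda>p q. of_real t * \<rho> p q) c)
      = t * Re (kernel_pair (grid r n) \<rho> c)" for c
    unfolding kernel_pair_commute[of _ _ c] kernel_pair_linear by simp
  show "cond_value r n (\<lambda>p q. of_real t * \<rho> p q) \<le> t * cond_value r n \<rho>"
    by (rule cond_value_least[OF assms(1)]) (use scale cond_value_upper assms(2) in simp)
  have "cond_value r n \<rho> \<le> cond_value r n (\<lambda>p q. of_real t * \<rho> p q) / t"
  proof (rule cond_value_least[OF assms(1)])
    fix c assume "channel_kernel r n c"
    from cond_value_upper[OF this, of "\<lambda>p q. of_real t * \<rho> p q"]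
    show "Re (kernel_pair (grid r n) \<rho> c) \<le> cond_value r n (\<lambda>p q. of_real t * \<rho> p q) / t"
      using assms(2) by (simp add: scale pos_le_divide_eq mult.commute)
  qed
  then show "t * cond_value r n \<rho> \<le> cond_value r n (\<lambda>p q. of_real t * \<rho> p q)"
    using assms(2) by (simp add: pos_le_divide_eq mult.commute)
qed

lemma cond_value_nonneg:
  assumes "0 < n" "pos_kernel (grid r n) \<rho>"
  shows "0 \<le> cond_value r n \<rho>"
proof -
  have depolarising: "channel_kernel r n (\<lambda>p q. of_real (1 / n) * kernel_one p q)"
    by (rule channel_kernel_depolarising[OF assms(1)])
  have "0 \<le> kernel_pair (grid r n) \<rho> (\<lambda>p q. of_real (1 / n) * kernel_one p q)"
    by (rule kernel_pair_nonneg[OF _ assms(2) channel_kernel_pos[OF depolarising]]) simp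
  then show ?thesis using cond_value_upper[OF depolarising, of \<rho>] by (simp add: less_eq_complex_def)
qed

lemma kernel_pair_le_cond_value:
  assumes "channel_kernel m n J"
  shows "Re (kernel_pair (grid m n) \<rho> J) \<le> cond_value m m (kernel_link {..<n} \<rho> (kernel_flip J))"
proof -
  have "kernel_pair (grid m m) (kernel_link {..<n} \<rho> (kernel_flip J)) id_kernel
      = kernel_pair (grid m n) \<rho> (kernel_link {..<m} id_kernel J)"
    by (simp add: kernel_pair_link_left)
  also have "\<dots> = kernel_pair (grid m n) \<rho> J"
    by (rule kernel_pair_cong) (simp_all add: kernel_link_id_left)
  finally show ?thesis
    using cond_value_upper[OF channel_kernel_id, of m "kernel_link {..<n} \<rho> (kernel_flip J)"]
    by simp
qed

lemma cond_value_link_le: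
  assumes "0 < n" "channel_kernel r m c"
  shows "cond_value m n (kernel_link {..<r} (kernel_flip c) \<rho>) \<le> cond_value r n \<rho>"
proof (rule cond_value_least[OF assms(1)])
  fix d assume "channel_kernel m n d"
  from cond_value_upper[OF channel_kernel_link[OF assms(2) this], of \<rho>]
  show "Re (kernel_pair (grid m n) (kernel_link {..<r} (kernel_flip c) \<rho>) d) \<le> cond_value r n \<rho>"
    by (simp add: kernel_pair_link_right)
qed

lemma mtrace_adjoint_mult:
  assumes "A \<in> carrier_mat d d" "B \<in> carrier_mat d d"
  shows "mtrace (mat_adjoint A * B) = (\<Sum>l<d. \<Sum>k<d. B $$ (l, k) * cnj (A $$ (l, k)))"
  unfolding mtrace_mult[OF mat_adjoint_carrier[OF assms(1)] assms(2)] kernel_pair_def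
    kernel_transpose_def
  by (subst sum.swap) (simp add: mat_adjoint_index[OF assms(1)] mult.commute)

lemma hs_adj_index:
  assumes choi_\<phi>: "channel_kernel r n c" "has_choi_kernel r n \<phi> c"
    and "Z \<in> carrier_mat n n" "i < r" "j < r"
  shows "hs_adj r n \<phi> Z $$ (i, j) = (\<Sum>l<n. \<Sum>k<n. Z $$ (l, k) * c (j, k) (i, l))"
proof -
  have "\<phi> (munit r i j) \<in> carrier_mat n n"
    by (rule has_choi_kernel_carrier[OF choi_\<phi>(2) munit_carrier])
  from mtrace_adjoint_mult[OF this assms(3)] show ?thesis
    using assms(4,5) channel_kernel_adjoint[OF choi_\<phi>(1), of "(j, _)" "(i, _)"]
    by (simp add: hs_adj_def has_choi_kernel_munit[OF choi_\<phi>(2)])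
qed

lemma pairing_eq_kernel_pair:
  assumes choi_\<alpha>: "channel_kernel r n c" "has_choi_kernel r n \<alpha> c"
    and X_carrier: "X \<in> carrier_mat (r * n) (r * n)"
  shows "pairing r n X \<alpha> = kernel_pair (grid r n) (bip_kernel n X) c"
proof -
  have choi_entry: "effect_kernel n (choi n r (hs_adj r n \<alpha>)) p q = c p q"
    if in_grid: "p \<in> grid r n" "q \<in> grid r n" for p q
  proof -
    obtain i a j b where pq_eq: "p = (i, a)" "q = (j, b)" "i < r" "j < r" "a < n" "b < n"
      using in_grid by auto
    have "effect_kernel n (choi n r (hs_adj r n \<alpha>)) p q = hs_adj r n \<alpha> (munit n b a) $$ (j, i)"
      using pq_eq by (simp add: kernel_transpose_def bip_kernel_def grid_index_def choi_def
        tensor_id_def grid_index_less max_ent_block)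
    also have "\<dots> = c p q"
      using hs_adj_index[OF choi_\<alpha> munit_carrier, of j i b a]
        sum_munit[of b n a "\<lambda>l k. c (i, k) (j, l)"] pq_eq by simp
    finally show ?thesis .
  qed
  have carrier: "choi n r (hs_adj r n \<alpha>) \<in> carrier_mat (r * n) (r * n)" by (simp add: choi_def)
  show ?thesis
    unfolding pairing_def mtrace_mult_bip_kernel[OF X_carrier carrier]
    by (intro kernel_pair_cong choi_entry) auto
qed

lemma cond_dnorm_eq_cond_value:
  assumes "\<rho> \<in> carrier_mat (r * n) (r * n)"
  shows "cond_dnorm r n \<rho> = cond_value r n (bip_kernel n \<rho>)"
  unfolding cond_dnorm_def cond_value_def
  by (intro arg_cong[where f = Sup] channel_image_eq) (simp add: pairing_eq_kernel_pair assms)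

lemma has_choi_kernel_map_transp:
  assumes choi_\<phi>: "channel_kernel m n c" "has_choi_kernel m n \<phi> c"
  shows "has_choi_kernel n m (map_transp m n \<phi>) (kernel_flip c)"
proof -
  have "map_transp m n \<phi> Z $$ (x, y) = (\<Sum>k<n. \<Sum>l<n. Z $$ (k, l) * kernel_flip c (k, x) (l, y))"
    if Z_carrier: "Z \<in> carrier_mat n n" and xy_less: "x < m" "y < m" for Z x y
  proof -
    have "map_transp m n \<phi> Z $$ (x, y) = hs_adj m n \<phi> (transp Z) $$ (y, x)"
      using xy_less by (simp add: map_transp_def transp_def hs_adj_def)
    also have "\<dots> = (\<Sum>l<n. \<Sum>k<n. Z $$ (k, l) * c (x, k) (y, l))"
      using hs_adj_index[OF choi_\<phi>, of "transp Z" y x] Z_carrier xy_less by (simp add: transp_def)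
    also have "\<dots> = (\<Sum>k<n. \<Sum>l<n. Z $$ (k, l) * c (x, k) (y, l))" by (rule sum.swap)
    finally show ?thesis by (simp add: kernel_flip_def)
  qed
  then show ?thesis by (simp add: has_choi_kernel_def map_transp_def transp_def hs_adj_def)
qed

lemma cond_dnorm_map_transp:
  assumes choi_\<Phi>: "channel_kernel m n J" "has_choi_kernel m n \<Phi> J"
  shows "cond_dnorm r m (id_tensor r n m (map_transp m n \<Phi>) \<rho>)
    = cond_value r m (kernel_link {..<n} (bip_kernel n \<rho>) (kernel_flip J))"
  unfolding cond_dnorm_eq_cond_value[OF id_tensor_carrier]
  by (intro cond_value_cong bip_kernel_id_tensor has_choi_kernel_map_transp[OF choi_\<Phi>])

section \<open>Success probabilities\<close>

definition ensemble_kernel ::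
    "nat \<Rightarrow> nat \<Rightarrow> (nat \<Rightarrow> real) \<Rightarrow> (nat \<Rightarrow> complex mat) \<Rightarrow> (nat \<Rightarrow> complex mat) \<Rightarrow> (nat \<times> nat) kernel"
  where
  "ensemble_kernel n k lam rho M p q = (\<Sum>i<k. of_real (lam i) *
     kernel_link {..<n} (bip_kernel n (rho i)) (kernel_flip (effect_kernel n (M i))) p q)"

lemma ensemble_carrier: "ensemble d k lam rho \<Longrightarrow> i < k \<Longrightarrow> rho i \<in> carrier_mat d d"
  by (simp add: ensemble_def state_def psd_def)

lemma measurement_carrier: "measurement d k M \<Longrightarrow> i < k \<Longrightarrow> M i \<in> carrier_mat d d"
  by (simp add: measurement_def psd_def)

lemma measurement_iff_bip_kernel:
  "measurement (r * n) k M \<longleftrightarrow> (\<forall>i<k. psd (r * n) (M i)) \<and>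
     (\<forall>p\<in>grid r n. \<forall>q\<in>grid r n. (\<Sum>i<k. bip_kernel n (M i) p q) = of_bool (p = q))"
proof -
  note index = bij_betw_grid_index[of n r]
  have image: "grid_index n ` grid r n = {..<r * n}" by (rule bij_betw_imp_surj_on[OF index])
  have one_index: "1\<^sub>m (r * n) $$ (grid_index n p, grid_index n q) = (of_bool (p = q) :: complex)"
    if in_grid: "p \<in> grid r n" "q \<in> grid r n" for p q
  proof -
    have "grid_index n p < r * n" "grid_index n q < r * n" using image in_grid by blast+
    then show ?thesis by (simp add: inj_on_eq_iff[OF bij_betw_imp_inj_on[OF index] in_grid])
  qed
  have "(\<forall>a<r * n. \<forall>b<r * n. (\<Sum>i<k. M i $$ (a, b)) = 1\<^sub>m (r * n) $$ (a, b))
      \<longleftrightarrow> (\<forall>a\<in>grid_index n ` grid r n. \<forall>b\<in>grid_index n ` grid r n.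
        (\<Sum>i<k. M i $$ (a, b)) = 1\<^sub>m (r * n) $$ (a, b))"
    unfolding image by auto
  also have "\<dots> \<longleftrightarrow> (\<forall>p\<in>grid r n. \<forall>q\<in>grid r n. (\<Sum>i<k. bip_kernel n (M i) p q) = of_bool (p = q))"
    unfolding ball_simps(9) bip_kernel_def by (intro ball_cong refl) (simp only: one_index)
  finally show ?thesis by (simp only: measurement_def)
qed

lemma pos_kernel_ensemble_kernel:
  assumes "ensemble (r * n) k lam rho" "measurement (n * n) k M"
  shows "pos_kernel (grid r n) (ensemble_kernel n k lam rho M)"
  unfolding ensemble_kernel_def using assms
  by (intro pos_kernel_sum pos_kernel_scale pos_kernel_link pos_kernel_flip pos_kernel_transpose)
    (auto simp: ensemble_def measurement_def state_def psd_iff_pos_bip_kernel)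

lemma kernel_pair_ensemble_kernel:
  "kernel_pair (grid r n) (ensemble_kernel n k lam rho M) c = (\<Sum>i<k. of_real (lam i) *
     kernel_pair (grid r n) (bip_kernel n (rho i)) (kernel_link {..<n} c (effect_kernel n (M i))))"
proof -
  have "kernel_pair (grid r n) (ensemble_kernel n k lam rho M) c
      = (\<Sum>i<k. of_real (lam i) * kernel_pair (grid r n)
          (kernel_link {..<n} (bip_kernel n (rho i)) (kernel_flip (effect_kernel n (M i)))) c)"
    unfolding kernel_pair_commute[of _ _ c] ensemble_kernel_def kernel_pair_sum
      kernel_pair_linear ..
  then show ?thesis by (simp add: kernel_pair_link_left)
qed

lemma psucc_tensor_id:
  assumes choi_\<psi>: "has_choi_kernel r n \<psi> c"
    and game: "ensemble (r * n) k lam rho" "measurement (n * n) k M"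
  shows "psucc k lam (\<lambda>i. tensor_id r n n \<psi> (rho i)) M
    = Re (kernel_pair (grid r n) (ensemble_kernel n k lam rho M) c)"
proof -
  have "mtrace (tensor_id r n n \<psi> (rho i) * M i)
      = kernel_pair (grid r n) (bip_kernel n (rho i))
          (kernel_link {..<n} c (effect_kernel n (M i)))"
    if "i < k" for i
  proof -
    have "mtrace (tensor_id r n n \<psi> (rho i) * M i) = kernel_pair (grid n n)
        (kernel_link {..<r} (kernel_flip c) (bip_kernel n (rho i))) (effect_kernel n (M i))"
      unfolding mtrace_mult_bip_kernel[OF tensor_id_carrier measurement_carrier[OF game(2) that]]
      by (intro kernel_pair_cong bip_kernel_tensor_id[OF choi_\<psi>]) auto
    then show ?thesis by (simp add: kernel_pair_link_right)
  qed
  then show ?thesis by (simp add: psucc_def kernel_pair_ensemble_kernel)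
qed

lemma Sup_psucc_eq_cond_value:
  assumes choi_J: "has_choi_kernel m n \<Phi> J"
    and game: "ensemble (r * n) k lam rho" "measurement (n * n) k M"
  shows "Sup {psucc k lam (\<lambda>i. tensor_id r n n (\<lambda>X. \<Phi> (\<alpha> X)) (rho i)) M | \<alpha>. channel r m \<alpha>}
    = cond_value r m (kernel_link {..<n} (ensemble_kernel n k lam rho M) (kernel_flip J))"
  unfolding cond_value_def
proof (intro arg_cong[where f = Sup] channel_image_eq)
  fix \<alpha> c assume "has_choi_kernel r m \<alpha> c"
  from psucc_tensor_id[OF has_choi_kernel_comp[OF this choi_J] game]
  show "psucc k lam (\<lambda>i. tensor_id r n n (\<lambda>X. \<Phi> (\<alpha> X)) (rho i)) M
      = Re (kernel_pair (grid r m)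
          (kernel_link {..<n} (ensemble_kernel n k lam rho M) (kernel_flip J)) c)"
    by (simp add: kernel_pair_link_left)
qed

lemma psucc_le_1:
  assumes ensemble: "ensemble d k lam rho" and measurement: "measurement d k N"
  shows "psucc k lam rho N \<le> 1"
proof -
  have "Re (mtrace (rho i * N i)) \<le> 1" if i_less: "i < k" for i
  proof -
    let ?T = "\<lambda>j. kernel_transpose (mat_kernel (N j))"
    have others_pos: "pos_kernel {..<d} (\<lambda>p q. \<Sum>j\<in>{..<k} - {i}. ?T j p q)"
      using measurement by (intro pos_kernel_sum pos_kernel_transpose)
        (auto simp: measurement_def psd_iff_pos_kernel)
    have "(\<Sum>j<k. ?T j p q) = of_bool (p = q)" if "p < d" "q < d" for p q
      using measurement that by (auto simp: measurement_def kernel_transpose_def)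
    then have "(\<Sum>j\<in>{..<k} - {i}. ?T j p q) = of_bool (p = q) - ?T i p q" if "p < d" "q < d" for p q
      using i_less that by (simp add: sum_diff1)
    then have "kernel_le {..<d} (?T i) kernel_one"
      unfolding kernel_le_def by (intro pos_kernel_cong[OF others_pos]) simp
    moreover have "pos_kernel {..<d} (mat_kernel (rho i))"
      using ensemble i_less by (simp add: ensemble_def state_def psd_iff_pos_kernel)
    ultimately have "Re (kernel_pair {..<d} (mat_kernel (rho i)) (?T i))
        \<le> Re (kernel_trace {..<d} (mat_kernel (rho i)))"
      using kernel_pair_mono[of "{..<d}" "mat_kernel (rho i)" "?T i" kernel_one]
      by (simp add: kernel_pair_one)
    also have "\<dots> = 1"
      using ensemble i_less mtrace_eq_kernel_trace[OF ensemble_carrier[OF ensemble i_less]]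
      by (simp add: ensemble_def state_def)
    finally show ?thesis
      using mtrace_mult[OF ensemble_carrier[OF ensemble i_less]
        measurement_carrier[OF measurement i_less]] by simp
  qed
  then have "psucc k lam rho N \<le> (\<Sum>i<k. lam i * 1)"
    unfolding psucc_def using ensemble by (intro sum_mono mult_left_mono) (auto simp: ensemble_def)
  then show ?thesis using ensemble by (simp add: ensemble_def)
qed

lemma psucc_opt_upper:
  assumes "ensemble d k lam rho" "measurement d k N"
  shows "psucc k lam rho N \<le> psucc_opt d k lam rho"
  unfolding psucc_opt_def
proof (rule cSup_upper)
  show "bdd_above {psucc k lam rho M | M. measurement d k M}"
    using psucc_le_1[OF assms(1)] by (intro bdd_aboveI) blast
qed (use assms in blast)

lemma measurement_pullback:
  assumes channel_c: "channel_kernel r n c" and measurement: "measurement (n * n) k M"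
  shows "measurement (r * n) k
    (\<lambda>i. bip_mat r n (kernel_transpose (kernel_link {..<n} c (effect_kernel n (M i)))))"
    (is "measurement _ _ ?N")
  unfolding measurement_iff_bip_kernel
proof (intro conjI allI impI ballI)
  fix i assume "i < k"
  then have "pos_kernel (grid n n) (bip_kernel n (M i))" using measurement
    by (simp add: measurement_iff_bip_kernel psd_iff_pos_bip_kernel)
  then show "psd (r * n) (?N i)"
    using channel_c by (intro psd_bip_mat pos_kernel_transpose pos_kernel_link)
      (auto simp: channel_kernel_pos)
next
  fix p q assume in_grid: "p \<in> grid r n" "q \<in> grid r n"
  have "(\<Sum>i<k. bip_kernel n (?N i) p q)
      = (\<Sum>x<n. \<Sum>y<n. c (fst q, x) (fst p, y) * (\<Sum>i<k. bip_kernel n (M i) (y, snd p) (x, snd q)))"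
    using in_grid unfolding sum_distrib_left
    by (subst sum_swap3[symmetric])
      (simp add: bip_kernel_bip_mat kernel_transpose_def kernel_link_def)
  also have "\<dots> = (\<Sum>x<n. \<Sum>y<n. c (fst q, x) (fst p, y) * of_bool (y = x) * of_bool (snd p = snd q))"
    using measurement in_grid unfolding measurement_iff_bip_kernel by (intro sum.cong refl) auto
  also have "\<dots> = partial_trace {..<n} c (fst q) (fst p) * of_bool (snd p = snd q)"
    by (simp add: partial_trace_def flip: sum_distrib_right)
  also have "\<dots> = of_bool (p = q)"
    using channel_kernel_partial_trace[OF channel_c, of "fst q" "fst p"] in_grid
    by (auto simp: prod_eq_iff)
  finally show "(\<Sum>i<k. bip_kernel n (?N i) p q) = of_bool (p = q)" .
qed

lemma cond_value_ensemble_kernel_le: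
  assumes "0 < n" and ensemble: "ensemble (r * n) k lam rho"
    and measurement: "measurement (n * n) k M"
  shows "cond_value r n (ensemble_kernel n k lam rho M) \<le> psucc_opt (r * n) k lam rho"
proof (rule cond_value_least[OF assms(1)])
  fix c assume channel_c: "channel_kernel r n c"
  let ?L = "\<lambda>i. kernel_link {..<n} c (effect_kernel n (M i))"
  let ?N = "\<lambda>i. bip_mat r n (kernel_transpose (?L i))"
  have "mtrace (rho i * ?N i) = kernel_pair (grid r n) (bip_kernel n (rho i)) (?L i)" if "i < k"
    for i
    unfolding mtrace_mult_bip_kernel[OF ensemble_carrier[OF ensemble that] bip_mat_carrier]
    by (rule kernel_pair_cong) (simp_all add: bip_kernel_bip_mat kernel_transpose_def)
  then have "Re (kernel_pair (grid r n) (ensemble_kernel n k lam rho M) c) = psucc k lam rho ?N"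
    by (simp add: kernel_pair_ensemble_kernel psucc_def)
  also have "\<dots> \<le> psucc_opt (r * n) k lam rho"
    by (rule psucc_opt_upper[OF ensemble measurement_pullback[OF channel_c measurement]])
  finally show "Re (kernel_pair (grid r n) (ensemble_kernel n k lam rho M) c)
      \<le> psucc_opt (r * n) k lam rho" .
qed

section \<open>The diamond norm\<close>

definition scaled_channel_kernel :: "nat \<Rightarrow> nat \<Rightarrow> real \<Rightarrow> (nat \<times> nat) kernel \<Rightarrow> bool" where
  "scaled_channel_kernel m n t G \<longleftrightarrow> pos_kernel (grid m n) G \<and>
     (\<forall>x<m. \<forall>y<m. partial_trace {..<n} G x y = of_real t * of_bool (x = y))"

definition balanced_kernel :: "nat \<Rightarrow> nat \<Rightarrow> real \<Rightarrow> (nat \<times> nat) kernel \<Rightarrow> bool" where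
  "balanced_kernel m n t F \<longleftrightarrow>
     (\<exists>G H. scaled_channel_kernel m n t G \<and> scaled_channel_kernel m n t H \<and>
       F = (\<lambda>p q. G p q - H p q))"

lemma balanced_kernel_channel_diff:
  assumes "channel_kernel m n c" "channel_kernel m n d"
  shows "balanced_kernel m n 1 (\<lambda>p q. c p q - d p q)"
  using assms unfolding balanced_kernel_def channel_kernel_def scaled_channel_kernel_def
  by (intro exI[of _ c] exI[of _ d]) simp

lemma balanced_kernel_partial_trace:
  assumes "balanced_kernel m n t F" "x < m" "y < m"
  shows "partial_trace {..<n} F x y = 0"
proof -
  obtain G H where "F = (\<lambda>p q. G p q - H p q)" "partial_trace {..<n} G x y
      = partial_trace {..<n} H x y"
    using assms unfolding balanced_kernel_def scaled_channel_kernel_def by metis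
  then show ?thesis by (simp add: partial_trace_def sum_subtractf)
qed

definition block_link :: "'k set \<Rightarrow> ('i \<times> 'k) kernel \<Rightarrow> ('e \<times> 'k \<times> 'j) kernel \<Rightarrow> ('e \<times> 'i \<times> 'j) kernel"
  where
  "block_link K A Z z w = kernel_link K A (\<lambda>p q. Z (fst z, p) (fst w, q)) (snd z) (snd w)"

lemma pos_kernel_block_link:
  assumes fin: "finite E" "finite I" "finite J" "finite K"
    and pos: "pos_kernel (I \<times> K) A" "pos_kernel (E \<times> K \<times> J) Z"
  shows "pos_kernel (E \<times> I \<times> J) (block_link K A Z)"
proof -
  let ?B = "\<lambda>p q. Z (fst (snd p), fst p, snd (snd p)) (fst (snd q), fst q, snd (snd q))"
  have "pos_kernel (K \<times> E \<times> J) ?B" by (rule pos_kernel_pullback[OF _ pos(2)]) (use fin in auto)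
  with pos(1) have "pos_kernel (I \<times> E \<times> J) (kernel_link K A ?B)" using fin
    by (intro pos_kernel_link) auto
  from pos_kernel_pullback[OF _ this, of "\<lambda>z. (fst (snd z), fst z, snd (snd z))" "E \<times> I \<times> J"]
  show ?thesis using fin by (simp add: block_link_def[abs_def] kernel_link_def image_subset_iff)
qed

lemma corner_block_link: "corner e (block_link K A Z) = kernel_link K A (corner e Z)"
  by (simp add: corner_def[abs_def] block_link_def fun_eq_iff)

lemma block_link_completion:
  assumes "completion (K \<times> J) B Z" "p \<in> I \<times> J" "q \<in> I \<times> J"
  shows "block_link K A Z (False, p) (True, q) = kernel_link K A B p q"
  unfolding block_link_def fst_conv snd_conv
  by (rule kernel_link_cong[OF refl _ assms(2,3)]) (use assms(1) in \<open>auto simp: completion_def\<close>)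

lemma completion_link_balanced:
  assumes balanced: "balanced_kernel m n t F" and completion: "completion (grid m d) B Z"
  obtains W where "completion (grid n d) (kernel_link {..<m} (kernel_flip F) B) W"
    "\<And>e. kernel_trace (grid n d) (corner e W)
        = of_real (2 * t) * kernel_trace (grid m d) (corner e Z)"
proof -
  obtain G H where scaled: "scaled_channel_kernel m n t G" "scaled_channel_kernel m n t H"
    and F_eq: "F = (\<lambda>p q. G p q - H p q)"
    using balanced unfolding balanced_kernel_def by blast
  let ?L = "\<lambda>K. block_link {..<m} (kernel_flip K) Z"
  define sign :: "bool \<times> nat \<times> nat \<Rightarrow> complex" where "sign z = (if fst z then 1 else - 1)" for z
  let ?W = "\<lambda>z w. ?L G z w + ?L H z w * kernel_rank1 sign z w"
  have "pos_kernel (UNIV \<times> grid n d) (?L K)" if "scaled_channel_kernel m n t K" for K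
    using completion that
    by (intro pos_kernel_block_link pos_kernel_flip)
      (auto simp: completion_def scaled_channel_kernel_def)
  then have "pos_kernel (UNIV \<times> grid n d) ?W"
    using scaled by (intro pos_kernel_add pos_kernel_mult_rank1)
  moreover have "?W (False, p) (True, q) = kernel_link {..<m} (kernel_flip F) B p q"
    if "p \<in> grid n d" "q \<in> grid n d" for p q
    using block_link_completion[OF completion that]
    by (simp add: F_eq sign_def kernel_rank1_def kernel_link_def kernel_flip_def left_diff_distrib
      sum_subtractf)
  ultimately have "completion (grid n d) (kernel_link {..<m} (kernel_flip F) B) ?W"
    by (simp add: completion_def)
  moreover have "kernel_trace (grid n d) (corner e ?W)
      = of_real (2 * t) * kernel_trace (grid m d) (corner e Z)" for e
  proof -
    have "kernel_trace (grid n d) (corner e ?W)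
        = kernel_trace (grid n d) (corner e (?L G)) + kernel_trace (grid n d) (corner e (?L H))"
      by (simp add: kernel_trace_def corner_def kernel_rank1_def sign_def sum.distrib)
    moreover have "kernel_trace (grid n d) (corner e (?L K))
        = of_real t * kernel_trace (grid m d) (corner e Z)"
      if "scaled_channel_kernel m n t K" for K
      unfolding corner_block_link
      by (rule kernel_trace_link_flip) (use that in \<open>simp_all add: scaled_channel_kernel_def\<close>)
    ultimately show ?thesis using scaled by simp
  qed
  ultimately show ?thesis by (rule that)
qed

lemma trace_norm_tensor_id_le:
  assumes balanced: "balanced_kernel m n t F" "has_choi_kernel m n \<Delta> F" and "0 \<le> t"
    and X_unit: "X \<in> carrier_mat (m * d) (m * d)" "trace_norm X \<le> 1"
  shows "trace_norm (tensor_id m n d \<Delta> X) \<le> 2 * t"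
proof -
  obtain Z where completion: "completion (grid m d) (bip_kernel d X) Z"
    and corner_trace: "\<And>e. kernel_trace (grid m d) (corner e Z) = of_real (trace_norm X)"
    by (rule trace_norm_bip_completion[OF X_unit(1)]) blast
  obtain W where link_completion: "completion (grid n d)
      (kernel_link {..<m} (kernel_flip F) (bip_kernel d X)) W"
    and link_corner_trace: "\<And>e. kernel_trace (grid n d) (corner e W)
        = of_real (2 * t) * kernel_trace (grid m d) (corner e Z)"
    by (rule completion_link_balanced[OF balanced(1) completion]) blast
  have "completion (grid n d) (bip_kernel d (tensor_id m n d \<Delta> X)) W"
    using link_completion bip_kernel_tensor_id[OF balanced(2)] by (simp add: completion_def)
  from trace_norm_le_bip_completion[OF tensor_id_carrier this]
  have "trace_norm (tensor_id m n d \<Delta> X) \<le> 2 * t * trace_norm X"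
    by (simp add: link_corner_trace corner_trace)
  also have "\<dots> \<le> 2 * t" using X_unit(2) \<open>0 \<le> t\<close> by (simp add: mult_left_le)
  finally show ?thesis .
qed

lemma dnorm_upper:
  assumes balanced: "balanced_kernel m n t F" "has_choi_kernel m n \<Delta> F" and "0 \<le> t"
    and X_unit: "X \<in> carrier_mat (m * m) (m * m)" "trace_norm X \<le> 1"
  shows "trace_norm (tensor_id m n m \<Delta> X) \<le> dnorm m n \<Delta>"
  unfolding dnorm_def
proof (rule cSup_upper)
  show "bdd_above {trace_norm (tensor_id m n m \<Delta> X) | X. X \<in> carrier_mat (m * m) (m * m)
      \<and> trace_norm X \<le> 1}"
    using trace_norm_tensor_id_le[OF balanced \<open>0 \<le> t\<close>] by (intro bdd_aboveI) blast
qed (use X_unit in blast)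

lemma trace_norm_zero: "trace_norm (0\<^sub>m d d) \<le> 0"
  using trace_norm_psd_le[of d "0\<^sub>m d d"] pos_kernel_cong[OF pos_kernel_zero, of "{..<d}"
    "mat_kernel (0\<^sub>m d d)"]
  by (simp add: psd_iff_pos_kernel mtrace_def)

lemma dnorm_le:
  assumes balanced: "balanced_kernel m n t F" "has_choi_kernel m n \<Delta> F" and "0 \<le> t"
  shows "dnorm m n \<Delta> \<le> 2 * t"
  unfolding dnorm_def
proof (rule cSup_least)
  show "{trace_norm (tensor_id m n m \<Delta> X) | X.
      X \<in> carrier_mat (m * m) (m * m) \<and> trace_norm X \<le> 1} \<noteq> {}"
    using order_trans[OF trace_norm_zero[of "m * m"] zero_le_one]
      zero_carrier_mat[of "m * m" "m * m"] by blast
qed (use trace_norm_tensor_id_le[OF balanced \<open>0 \<le> t\<close>] in blast)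

lemma dnorm_nonneg:
  assumes "balanced_kernel m n t F" "has_choi_kernel m n \<Delta> F" "0 \<le> t"
  shows "0 \<le> dnorm m n \<Delta>"
  using trace_norm_nonneg[OF tensor_id_carrier, of m n m \<Delta> "0\<^sub>m (m * m) (m * m)"]
    dnorm_upper[OF assms zero_carrier_mat] trace_norm_zero[of "m * m"] by linarith

section \<open>Duality for the conditional norm\<close>

lemma kernel_pair_le_cond_value_majorant:
  assumes "0 < n" and \<rho>_pos: "pos_kernel (grid r n) \<rho>" and Y_pos: "pos_kernel (grid r n) Y"
    and "0 < \<kappa>"
    and dominated: "kernel_le {..<r} (partial_trace {..<n} Y) (\<lambda>i j. of_real \<kappa> * kernel_one i j)"
  shows "Re (kernel_pair (grid r n) \<rho> Y) \<le> \<kappa> * cond_value r n \<rho>"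
proof -
  define D where "D i j = of_real \<kappa> * kernel_one i j - partial_trace {..<n} Y i j" for i j
  let ?E = "kernel_tensor D kernel_one"
  let ?c = "\<lambda>p q. of_real (1 / \<kappa>) * (Y p q + of_real (1 / n) * ?E p q)"
  have E_pos: "pos_kernel (grid r n) ?E"
    using dominated by (intro pos_kernel_tensor pos_kernel_one)
      (auto simp: kernel_le_def D_def[abs_def])
  have channel_c: "channel_kernel r n ?c"
    unfolding channel_kernel_def
  proof (intro conjI allI impI)
    show "pos_kernel (grid r n) ?c"
      using \<open>0 < \<kappa>\<close> by (intro pos_kernel_scale pos_kernel_add Y_pos E_pos) auto
    fix i j assume "i < r" "j < r"
    have "partial_trace {..<n} ?c i j = of_real (1 / \<kappa>) * (partial_trace {..<n} Y i j + D i j)"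
      using \<open>0 < n\<close>
      by (simp add: partial_trace_def kernel_tensor_def sum.distrib flip: sum_divide_distrib)
    then show "partial_trace {..<n} ?c i j = of_bool (i = j)" using \<open>0 < \<kappa>\<close> by (simp add: D_def)
  qed
  have pair: "kernel_pair (grid r n) \<rho> ?c
      = of_real (1 / \<kappa>) * (kernel_pair (grid r n) \<rho> Y
          + of_real (1 / n) * kernel_pair (grid r n) \<rho> ?E)"
    by (simp only: kernel_pair_linear)
  have "0 \<le> Re (kernel_pair (grid r n) \<rho> ?E)"
    using kernel_pair_nonneg[OF _ \<rho>_pos E_pos] by (simp add: less_eq_complex_def)
  then have "Re (kernel_pair (grid r n) \<rho> Y) \<le> \<kappa> * Re (kernel_pair (grid r n) \<rho> ?c)"
    unfolding pair using \<open>0 < \<kappa>\<close> by simp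
  also have "\<dots> \<le> \<kappa> * cond_value r n \<rho>"
    using cond_value_upper[OF channel_c] \<open>0 < \<kappa>\<close> by simp
  finally show ?thesis .
qed

lemma kernel_convex_tensor_one_minus:
  "kernel_convex {(\<lambda>p q. kernel_tensor \<sigma> kernel_one p q - \<rho> p q) | \<sigma>.
      pos_kernel I \<sigma> \<and> kernel_trace I \<sigma> = t}"
  unfolding kernel_convex_def
proof (intro ballI allI impI)
  let ?C = "{(\<lambda>p q. kernel_tensor \<sigma> kernel_one p q - \<rho> p q) | \<sigma>.
    pos_kernel I \<sigma> \<and> kernel_trace I \<sigma> = t}"
  fix A B and s :: real assume "A \<in> ?C" "B \<in> ?C" and s_bounds: "0 \<le> s" "s \<le> 1"
  then obtain \<sigma> \<tau> where AB_eq: "A = (\<lambda>p q. kernel_tensor \<sigma> kernel_one p q - \<rho> p q)"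
      "B = (\<lambda>p q. kernel_tensor \<tau> kernel_one p q - \<rho> p q)"
    and states: "pos_kernel I \<sigma>" "kernel_trace I \<sigma> = t" "pos_kernel I \<tau>" "kernel_trace I \<tau> = t"
      by blast
  let ?mix = "\<lambda>i j. of_real (1 - s) * \<sigma> i j + of_real s * \<tau> i j"
  have "pos_kernel I ?mix" using s_bounds states by (intro pos_kernel_add pos_kernel_scale) auto
  moreover have "kernel_trace I ?mix
      = of_real (1 - s) * kernel_trace I \<sigma> + of_real s * kernel_trace I \<tau>"
    by (simp add: kernel_trace_def sum.distrib sum_distrib_left)
  then have "kernel_trace I ?mix = t" by (simp add: states algebra_simps)
  moreover have "(\<lambda>p q. of_real (1 - s) * A p q + of_real s * B p q)
      = (\<lambda>p q. kernel_tensor ?mix kernel_one p q - \<rho> p q)"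
    by (simp add: AB_eq kernel_tensor_def fun_eq_iff algebra_simps)
  ultimately show "(\<lambda>p q. of_real (1 - s) * A p q + of_real s * B p q) \<in> ?C" by blast
qed

lemma kernel_top_value_pos:
  assumes fin: "finite I" and dominated: "kernel_le I A (\<lambda>p q. of_real \<kappa> * kernel_one p q)"
    and trace_pos: "0 < Re (kernel_trace I A)"
  shows "0 < \<kappa>"
proof -
  have "Re (kernel_trace I A) \<le> card I * \<kappa>"
    using kernel_pair_mono[OF fin pos_kernel_one[OF fin] dominated] fin
    by (simp add: kernel_pair_commute[of I kernel_one] kernel_pair_one kernel_trace_def)
  with trace_pos have "0 < card I * \<kappa>" by linarith
  then show ?thesis by (simp add: zero_less_mult_iff)
qed

lemma cond_value_test_state:
  assumes "0 < r" "0 < n" and \<rho>_pos: "pos_kernel (grid r n) \<rho>"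
    and \<mu>_bounds: "0 \<le> \<mu>" "cond_value r n \<rho> \<le> \<mu>"
    and Y_state: "state_kernel (grid r n) Y"
  obtains \<sigma> where "pos_kernel {..<r} \<sigma>" "kernel_trace {..<r} \<sigma> = of_real \<mu>"
    "Re (kernel_pair (grid r n) \<rho> Y) \<le> Re (kernel_pair (grid r n) Y (kernel_tensor \<sigma> kernel_one))"
proof -
  let ?y = "partial_trace {..<n} Y"
  have Y_pos: "pos_kernel (grid r n) Y" and Y_trace: "kernel_trace (grid r n) Y = 1"
    using Y_state by (auto simp: state_kernel_def)
  have y_pos: "pos_kernel {..<r} ?y" by (rule pos_kernel_partial_trace[OF _ _ Y_pos]) auto
  obtain u \<kappa> where unit: "inner_on {..<r} u u = 1"
    and eigen: "\<And>p. p \<in> {..<r} \<Longrightarrow> kernel_app {..<r} ?y u p = of_real \<kappa> * u p"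
    and dominated: "kernel_le {..<r} ?y (\<lambda>p q. of_real \<kappa> * kernel_one p q)"
    by (rule herm_kernel_top_eigenvector[OF _ _ pos_kernel_herm[OF _ y_pos]]) (use \<open>0 < r\<close> in auto)
  have "0 < \<kappa>" using kernel_top_value_pos[OF _ dominated] Y_trace by (simp add: kernel_trace_prod)
  let ?\<sigma> = "\<lambda>i j. of_real \<mu> * kernel_rank1 (\<lambda>i. cnj (u i)) i j"
  have "kernel_trace {..<r} ?\<sigma> = of_real \<mu> * inner_on {..<r} u u"
    by (simp add: kernel_trace_def kernel_rank1_def inner_on_def sum_distrib_left)
  moreover have "kernel_pair {..<r} ?y (kernel_rank1 (\<lambda>i. cnj (u i)))
      = inner_on {..<r} u (kernel_app {..<r} ?y u)"
    by (simp add: kernel_pair_def inner_on_kernel_app kernel_rank1_def mult_ac)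
  then have "kernel_pair {..<r} ?y (kernel_rank1 (\<lambda>i. cnj (u i))) = of_real \<kappa>"
    using inner_on_cong[of "{..<r}" u u "kernel_app {..<r} ?y u" "\<lambda>p. of_real \<kappa> * u p"] eigen unit
    by (simp add: inner_on_linear)
  then have "Re (kernel_pair (grid r n) Y (kernel_tensor ?\<sigma> kernel_one)) = \<kappa> * \<mu>"
    by (simp add: kernel_pair_tensor_one kernel_pair_linear)
  moreover have "Re (kernel_pair (grid r n) \<rho> Y) \<le> \<kappa> * cond_value r n \<rho>"
    by (rule kernel_pair_le_cond_value_majorant[OF \<open>0 < n\<close> \<rho>_pos Y_pos \<open>0 < \<kappa>\<close> dominated])
  moreover have "\<kappa> * cond_value r n \<rho> \<le> \<kappa> * \<mu>" using \<mu>_bounds(2) \<open>0 < \<kappa>\<close> by simp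
  ultimately show ?thesis
    using unit \<mu>_bounds(1) by (intro that[of ?\<sigma>] pos_kernel_scale pos_kernel_rank1) auto
qed

lemma cond_value_dual:
  assumes "0 < r" "0 < n" and \<rho>_pos: "pos_kernel (grid r n) \<rho>" and "cond_value r n \<rho> < l"
  obtains \<sigma> \<eta> where "pos_kernel {..<r} \<sigma>" "0 < (\<eta> :: real)"
    "kernel_trace {..<r} (\<lambda>i j. \<sigma> i j + of_real \<eta> * kernel_one i j) = of_real l"
    "kernel_le (grid r n) \<rho> (kernel_tensor (\<lambda>i j. \<sigma> i j + of_real \<eta> * kernel_one i j) kernel_one)"
proof -
  obtain \<mu> where \<mu>_between: "cond_value r n \<rho> < \<mu>" "\<mu> < l" using \<open>cond_value r n \<rho> < l\<close> dense
    by blast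
  then have "0 \<le> \<mu>" using cond_value_nonneg[OF assms(2) \<rho>_pos] by simp
  define C where "C = {(\<lambda>p q. kernel_tensor \<sigma> kernel_one p q - \<rho> p q) | \<sigma>.
    pos_kernel {..<r} \<sigma> \<and> kernel_trace {..<r} \<sigma> = of_real \<mu>}"
  define \<eta> where "\<eta> = (l - \<mu>) / r"
  have "0 < \<eta>" using \<mu>_between \<open>0 < r\<close> by (simp add: \<eta>_def)
  obtain A where "A \<in> C"
    and A_pos: "pos_kernel (grid r n) (\<lambda>p q. A p q + of_real \<eta> * kernel_one p q)"
  proof (rule pos_kernel_minimax[of "grid r n" C \<eta>])
    let ?\<sigma> = "\<lambda>i j. of_real (\<mu> / r) * kernel_one i j"
    have "pos_kernel {..<r} ?\<sigma>" using \<open>0 \<le> \<mu>\<close> by (intro pos_kernel_scale pos_kernel_one) auto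
    moreover have "kernel_trace {..<r} ?\<sigma> = of_real \<mu>" using \<open>0 < r\<close> by (simp add: kernel_trace_def)
    ultimately show "C \<noteq> {}" unfolding C_def by blast
    show "kernel_convex C" unfolding C_def by (rule kernel_convex_tensor_one_minus)
    fix A assume "A \<in> C"
    then obtain \<sigma> where "A = (\<lambda>p q. kernel_tensor \<sigma> kernel_one p q - \<rho> p q)" "pos_kernel {..<r} \<sigma>"
      by (auto simp: C_def)
    then show "herm_kernel (grid r n) A"
      using herm_kernel_diff[OF pos_kernel_herm[OF _ pos_kernel_tensor[OF _ _ _ pos_kernel_one]]
        pos_kernel_herm[OF _ \<rho>_pos]]
      by simp
  next
    fix Y m assume Y_state: "state_kernel (grid r n) Y" and "0 < (m :: real)"
    obtain \<sigma> where "pos_kernel {..<r} \<sigma>" "kernel_trace {..<r} \<sigma> = of_real \<mu>"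
      and test: "Re (kernel_pair (grid r n) \<rho> Y)
          \<le> Re (kernel_pair (grid r n) Y (kernel_tensor \<sigma> kernel_one))"
      by (rule cond_value_test_state[OF assms(1,2) \<rho>_pos \<open>0 \<le> \<mu>\<close> less_imp_le[OF \<mu>_between(1)]
        Y_state])
    then have "(\<lambda>p q. kernel_tensor \<sigma> kernel_one p q - \<rho> p q) \<in> C" unfolding C_def by blast
    moreover have "- m < Re (kernel_pair (grid r n) Y
        (\<lambda>p q. kernel_tensor \<sigma> kernel_one p q - \<rho> p q))"
      unfolding kernel_pair_linear using test \<open>0 < m\<close> by (simp add: kernel_pair_commute[of _ Y \<rho>])
    ultimately show "\<exists>A\<in>C. - m < Re (kernel_pair (grid r n) Y A)" by blast
  qed (use \<open>0 < \<eta>\<close> in auto)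
  then obtain \<sigma> where \<sigma>_state: "pos_kernel {..<r} \<sigma>" "kernel_trace {..<r} \<sigma> = of_real \<mu>"
    and A_eq: "A = (\<lambda>p q. kernel_tensor \<sigma> kernel_one p q - \<rho> p q)" by (auto simp: C_def)
  have "kernel_trace {..<r} (\<lambda>i j. \<sigma> i j + of_real \<eta> * kernel_one i j) = of_real l"
    using \<sigma>_state(2) \<open>0 < r\<close> by (simp add: kernel_trace_def sum.distrib \<eta>_def)
  moreover have "kernel_le (grid r n) \<rho> (kernel_tensor
      (\<lambda>i j. \<sigma> i j + of_real \<eta> * kernel_one i j) kernel_one)"
    unfolding kernel_le_def
    by (rule pos_kernel_cong[OF A_pos]) (auto simp: A_eq kernel_tensor_def distrib_right)
  ultimately show ?thesis by (rule that[OF \<sigma>_state(1) \<open>0 < \<eta>\<close>])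
qed

section \<open>Channel discrimination\<close>

lemma kernel_link_scaled_onb:
  assumes onb: "onb {..<m} v" and nonzero: "\<And>j. j < m \<Longrightarrow> s j \<noteq> 0"
    and \<xi>_eq: "\<And>x j. \<xi> (x, j) = s j * v j x" and \<omega>_eq: "\<And>j x. \<omega> (j, x) = cnj (v j x) / s j"
    and grid: "p \<in> grid m m" "q \<in> grid m m"
  shows "kernel_link {..<m} (kernel_rank1 \<xi>) (kernel_rank1 \<omega>) p q = id_kernel p q"
    and "kernel_link {..<m} (kernel_rank1 \<omega>) (kernel_rank1 \<xi>) p q = id_kernel p q"
proof -
  have "(\<Sum>j<m. \<xi> (x, j) * \<omega> (j, z)) = of_bool (x = z)" if "x < m" "z < m" for x z
  proof -
    have "(\<Sum>j<m. \<xi> (x, j) * \<omega> (j, z)) = (\<Sum>j<m. v j x * cnj (v j z))"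
      by (rule sum.cong) (use nonzero in \<open>auto simp: \<xi>_eq \<omega>_eq\<close>)
    then show ?thesis using onb that by (simp add: onb_def)
  qed
  then show "kernel_link {..<m} (kernel_rank1 \<xi>) (kernel_rank1 \<omega>) p q = id_kernel p q"
    using grid by (simp add: kernel_link_rank1 id_kernel_def kernel_rank1_def mem_Times_iff)
  have "(\<Sum>x<m. \<omega> (j, x) * \<xi> (x, k)) = of_bool (j = k)" if "j < m" "k < m" for j k
  proof -
    have "(\<Sum>x<m. \<omega> (j, x) * \<xi> (x, k)) = s k / s j * inner_on {..<m} (v j) (v k)"
      by (simp add: inner_on_def \<xi>_eq \<omega>_eq sum_distrib_left mult_ac)
    then show ?thesis using onb nonzero that by (auto simp: onb_def)
  qed
  then show "kernel_link {..<m} (kernel_rank1 \<omega>) (kernel_rank1 \<xi>) p q = id_kernel p q"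
    using grid by (simp add: kernel_link_rank1 id_kernel_def kernel_rank1_def mem_Times_iff)
qed

lemma pos_definite_kernel_factor:
  assumes \<sigma>_pos: "pos_kernel {..<m :: nat} \<sigma>" and "0 < \<eta>"
  obtains \<Xi> \<Omega> :: "(nat \<times> nat) kernel" where "pos_kernel (grid m m) \<Xi>" "pos_kernel (grid m m) \<Omega>"
    "\<And>x y. x < m \<Longrightarrow> y < m \<Longrightarrow> partial_trace {..<m} \<Xi> x y = \<sigma> x y + of_real \<eta> * kernel_one x y"
    "\<And>p q. p \<in> grid m m \<Longrightarrow> q \<in> grid m m \<Longrightarrow> kernel_link {..<m} \<Xi> \<Omega> p q = id_kernel p q"
    "\<And>p q. p \<in> grid m m \<Longrightarrow> q \<in> grid m m \<Longrightarrow> kernel_link {..<m} \<Omega> \<Xi> p q = id_kernel p q"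
proof -
  obtain v d where onb: "onb {..<m} v" and d_nonneg: "\<And>j. j < m \<Longrightarrow> 0 \<le> d j"
    and spectral: "\<And>x y. x < m \<Longrightarrow> y < m \<Longrightarrow> \<sigma> x y = spectral_kernel {..<m} v d x y"
    by (rule pos_kernel_spectral[OF finite_lessThan \<sigma>_pos]) auto
  define s :: "nat \<Rightarrow> complex" where "s j = of_real (sqrt (d j + \<eta>))" for j
  have s_root: "s j \<noteq> 0" "s j * cnj (s j) = of_real (d j) + of_real \<eta>" if "j < m" for j
    using d_nonneg[OF that] \<open>0 < \<eta>\<close> by (auto simp: s_def simp flip: of_real_mult of_real_add)
  define \<xi> where "\<xi> z = s (snd z) * v (snd z) (fst z)" for z
  define \<omega> where "\<omega> z = cnj (v (fst z) (snd z)) / s (fst z)" for z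
  show ?thesis
  proof (rule that[of "kernel_rank1 \<xi>" "kernel_rank1 \<omega>"])
    fix x y assume "x < m" "y < m"
    then have complete: "(\<Sum>j<m. v j x * cnj (v j y)) = kernel_one x y" using onb
      by (simp add: onb_def)
    have "partial_trace {..<m} (kernel_rank1 \<xi>) x y
        = (\<Sum>j<m. (s j * cnj (s j)) * (v j x * cnj (v j y)))"
      by (simp add: partial_trace_def kernel_rank1_def \<xi>_def mult_ac)
    also have "\<dots> = (\<Sum>j<m. (of_real (d j) + of_real \<eta>) * (v j x * cnj (v j y)))"
      by (simp add: s_root)
    also have "\<dots> = \<sigma> x y + of_real \<eta> * kernel_one x y"
      unfolding complete[symmetric] spectral[OF \<open>x < m\<close> \<open>y < m\<close>]
      by (simp add: spectral_kernel_def kernel_rank1_def distrib_right sum.distrib sum_distrib_left)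
    finally show "partial_trace {..<m} (kernel_rank1 \<xi>) x y = \<sigma> x y + of_real \<eta> * kernel_one x y" .
  qed (use kernel_link_scaled_onb[OF onb s_root(1), where \<xi> = \<xi> and \<omega> = \<omega>]
    in \<open>simp_all add: pos_kernel_rank1 \<xi>_def \<omega>_def\<close>)
qed

lemma abs_kernel_pair_balanced_factor_le:
  assumes balanced: "balanced_kernel m n t F" "has_choi_kernel m n \<Delta> F" "0 \<le> t"
    and pos: "pos_kernel (grid m n) \<rho>" "pos_kernel (grid m m) \<Xi>" "pos_kernel (grid m m) \<Omega>"
    and dominated: "kernel_le (grid m n) \<rho> (kernel_tensor (partial_trace {..<m} \<Xi>) kernel_one)"
    and inverse: "\<And>p q. p \<in> grid m m \<Longrightarrow> q \<in> grid m m \<Longrightarrow> kernel_link {..<m} \<Xi> \<Omega> p q = id_kernel p q"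
      "\<And>p q. p \<in> grid m m \<Longrightarrow> q \<in> grid m m \<Longrightarrow> kernel_link {..<m} \<Omega> \<Xi> p q = id_kernel p q"
    and \<Xi>_trace: "0 < l" "kernel_trace (grid m m) \<Xi> = of_real l"
  shows "\<bar>Re (kernel_pair (grid m n) \<rho> F)\<bar> \<le> l * (dnorm m n \<Delta> / 2)"
proof -
  define X where "X = bip_mat m m (\<lambda>p q. of_real (1 / l) * \<Xi> p q)"
  have X_carrier: "X \<in> carrier_mat (m * m) (m * m)" by (simp add: X_def)
  have "psd (m * m) X" unfolding X_def using \<Xi>_trace(1)
    by (intro psd_bip_mat pos_kernel_scale pos(2)) simp
  moreover have "mtrace X = 1"
    using \<Xi>_trace by (simp add: X_def mtrace_bip_mat kernel_trace_def flip: sum_divide_distrib)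
  ultimately have X_norm: "trace_norm X \<le> 1" using trace_norm_psd_le[of "m * m" X] by simp
  define D where "D = tensor_id m n m \<Delta> X"
  have D_entry: "bip_kernel m D p q = of_real (1 / l) * kernel_link {..<m} (kernel_flip F) \<Xi> p q"
    if "p \<in> grid n m" "q \<in> grid n m" for p q
    using that
    by (simp add: D_def bip_kernel_tensor_id[OF balanced(2)] X_def kernel_link_def
      bip_kernel_bip_mat mem_Times_iff sum_distrib_left mult_ac)
  have "kernel_trace (grid n m) (kernel_link {..<m} (kernel_flip F) \<Xi>)
      = 0 * kernel_trace (grid m m) \<Xi>"
    by (rule kernel_trace_link_flip) (simp_all add: balanced_kernel_partial_trace[OF balanced(1)])
  then have "mtrace D = 0"
    by (simp add: D_def mtrace_eq_bip_kernel_trace[OF tensor_id_carrier] kernel_trace_def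
      D_entry[unfolded D_def]
        flip: sum_divide_distrib)
  let ?\<tau> = "kernel_flip (kernel_link {..<m} \<Omega> \<rho>)"
  have "pos_kernel (grid n m) ?\<tau>" by (intro pos_kernel_flip pos_kernel_link pos) auto
  moreover have "kernel_le (grid n m) ?\<tau> kernel_one"
    using pos_kernel_flip[OF _ _
      kernel_le_link_inverse[OF _ _ pos(3) inverse(2) dominated, unfolded kernel_le_def]]
    unfolding kernel_le_def by (rule pos_kernel_cong) (auto simp: kernel_flip_def)
  ultimately have "\<bar>Re (kernel_pair (grid n m) ?\<tau> (bip_kernel m D))\<bar> \<le> trace_norm D / 2"
    using \<open>mtrace D = 0\<close> by (intro abs_kernel_pair_traceless_le) (simp_all add: D_def)
  also have "kernel_pair (grid n m) ?\<tau> (bip_kernel m D)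
      = kernel_pair (grid n m) ?\<tau>
          (\<lambda>p q. of_real (1 / l) * kernel_link {..<m} (kernel_flip F) \<Xi> p q)"
    by (rule kernel_pair_cong) (simp_all add: D_entry)
  also have "\<dots> = of_real (1 / l) * kernel_pair (grid m n) \<rho> F"
    unfolding kernel_pair_linear by (simp add: kernel_pair_link_inverse[OF _ inverse(1)])
  also have "trace_norm D \<le> dnorm m n \<Delta>" unfolding D_def
    by (rule dnorm_upper[OF balanced X_carrier X_norm])
  finally show ?thesis using \<Xi>_trace(1) by (simp add: abs_mult pos_divide_le_eq mult.commute)
qed

lemma le_mult_at_right:
  assumes "\<And>l :: real. a < l \<Longrightarrow> x \<le> l * k"
  shows "x \<le> a * k"
proof -
  have "((\<lambda>l. l * k) \<longlongrightarrow> a * k) (at_right a)" by (intro tendsto_intros)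
  then show ?thesis
  proof (rule tendsto_lowerbound)
    show "\<forall>\<^sub>F l in at_right a. x \<le> l * k"
      by (rule eventually_mono[OF eventually_at_right_less assms])
  qed simp
qed

lemma abs_kernel_pair_balanced_le:
  assumes "0 < m" "0 < n" and \<rho>_pos: "pos_kernel (grid m n) \<rho>"
    and balanced: "balanced_kernel m n t F" "has_choi_kernel m n \<Delta> F" "0 \<le> t"
  shows "\<bar>Re (kernel_pair (grid m n) \<rho> F)\<bar> \<le> cond_value m n \<rho> * (dnorm m n \<Delta> / 2)"
proof (rule le_mult_at_right)
  fix l assume l_gt: "cond_value m n \<rho> < l"
  obtain \<sigma> \<eta> where \<sigma>_pos: "pos_kernel {..<m} \<sigma>" "0 < (\<eta> :: real)"
    and trace: "kernel_trace {..<m} (\<lambda>i j. \<sigma> i j + of_real \<eta> * kernel_one i j) = of_real l"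
    and dominated: "kernel_le (grid m n) \<rho> (kernel_tensor
        (\<lambda>i j. \<sigma> i j + of_real \<eta> * kernel_one i j) kernel_one)"
    by (rule cond_value_dual[OF assms(1,2) \<rho>_pos l_gt])
  obtain \<Xi> \<Omega> :: "(nat \<times> nat) kernel" where pos: "pos_kernel (grid m m) \<Xi>" "pos_kernel (grid m m) \<Omega>"
    and marginal: "\<And>x y. x < m \<Longrightarrow> y < m \<Longrightarrow>
        partial_trace {..<m} \<Xi> x y = \<sigma> x y + of_real \<eta> * kernel_one x y"
    and inverse: "\<And>p q. p \<in> grid m m \<Longrightarrow> q \<in> grid m m \<Longrightarrow> kernel_link {..<m} \<Xi> \<Omega> p q = id_kernel p q"
      "\<And>p q. p \<in> grid m m \<Longrightarrow> q \<in> grid m m \<Longrightarrow> kernel_link {..<m} \<Omega> \<Xi> p q = id_kernel p q"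
    by (rule pos_definite_kernel_factor[OF \<sigma>_pos]) blast
  show "\<bar>Re (kernel_pair (grid m n) \<rho> F)\<bar> \<le> l * (dnorm m n \<Delta> / 2)"
  proof (rule abs_kernel_pair_balanced_factor_le[OF balanced \<rho>_pos pos _ inverse])
    show "kernel_le (grid m n) \<rho> (kernel_tensor (partial_trace {..<m} \<Xi>) kernel_one)"
      using dominated unfolding kernel_le_def by (rule pos_kernel_cong)
        (auto simp: kernel_tensor_def marginal)
    show "kernel_trace (grid m m) \<Xi> = of_real l"
      unfolding kernel_trace_prod trace[symmetric] by (simp add: kernel_trace_def marginal)
    show "0 < l" using cond_value_nonneg[OF assms(2) \<rho>_pos] l_gt by linarith
  qed
qed

section \<open>The pre-processing distance\<close>

locale channel_pair =
  fixes m0 m n :: nat and \<Phi> \<Psi> :: cmap and c d :: "(nat \<times> nat) kernel"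
  assumes pos: "0 < m0" "0 < m" "0 < n"
    and \<Phi>: "channel_kernel m0 n c" "has_choi_kernel m0 n \<Phi> c"
    and \<Psi>: "channel_kernel m n d" "has_choi_kernel m n \<Psi> d"
begin

lemma balanced_pre_diff:
  assumes "channel_kernel m m0 l"
  shows "balanced_kernel m n 1 (\<lambda>p q. kernel_link {..<m0} l c p q - d p q)"
  by (rule balanced_kernel_channel_diff[OF channel_kernel_link[OF assms \<Phi>(1)] \<Psi>(1)])

lemma has_choi_kernel_pre_diff:
  assumes "has_choi_kernel m m0 \<Lambda> l"
  shows "has_choi_kernel m n (\<lambda>X. \<Phi> (\<Lambda> X) - \<Psi> X) (\<lambda>p q. kernel_link {..<m0} l c p q - d p q)"
  by (rule has_choi_kernel_diff[OF has_choi_kernel_comp[OF assms \<Phi>(2)] \<Psi>(2)])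

lemma delta_pre_le_dnorm:
  assumes "channel m m0 \<Lambda>"
  shows "delta_pre m0 m n \<Phi> \<Psi> \<le> dnorm m n (\<lambda>X. \<Phi> (\<Lambda> X) - \<Psi> X)"
  unfolding delta_pre_def
proof (rule cInf_lower)
  show "bdd_below {dnorm m n (\<lambda>X. \<Phi> (\<Lambda> X) - \<Psi> X) | \<Lambda>. channel m m0 \<Lambda>}"
  proof (rule bdd_belowI)
    fix x assume "x \<in> {dnorm m n (\<lambda>X. \<Phi> (\<Lambda> X) - \<Psi> X) | \<Lambda>. channel m m0 \<Lambda>}"
    then obtain \<Lambda> where x_eq: "x = dnorm m n (\<lambda>X. \<Phi> (\<Lambda> X) - \<Psi> X)" and "channel m m0 \<Lambda>" by blast
    then obtain l where choi_\<Lambda>: "channel_kernel m m0 l" "has_choi_kernel m m0 \<Lambda> l"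
      by (blast elim: channelE)
    show "0 \<le> x" unfolding x_eq
      by (rule dnorm_nonneg[OF balanced_pre_diff[OF choi_\<Lambda>(1)]
        has_choi_kernel_pre_diff[OF choi_\<Lambda>(2)]]) simp
  qed
qed (use assms in blast)

lemma delta_pre_lessE:
  assumes "delta_pre m0 m n \<Phi> \<Psi> < \<epsilon>"
  obtains \<Lambda> l where "channel_kernel m m0 l" "has_choi_kernel m m0 \<Lambda> l"
    "dnorm m n (\<lambda>X. \<Phi> (\<Lambda> X) - \<Psi> X) < \<epsilon>"
proof -
  let ?S = "{dnorm m n (\<lambda>X. \<Phi> (\<Lambda> X) - \<Psi> X) | \<Lambda>. channel m m0 \<Lambda>}"
  have "?S \<noteq> {}" using channel_map_of_kernel[OF channel_kernel_depolarising[OF pos(1)]] by blast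
  from cInf_lessD[OF this assms[unfolded delta_pre_def]] obtain \<Lambda>
    where "channel m m0 \<Lambda>" and less: "dnorm m n (\<lambda>X. \<Phi> (\<Lambda> X) - \<Psi> X) < \<epsilon>"
    by blast
  from \<open>channel m m0 \<Lambda>\<close> obtain l where "channel_kernel m m0 l" "has_choi_kernel m m0 \<Lambda> l"
    by (rule channelE)
  then show ?thesis using less by (rule that)
qed

definition cond_value_bound :: "real \<Rightarrow> nat \<Rightarrow> (nat \<times> nat) kernel \<Rightarrow> bool" where
  "cond_value_bound \<epsilon> r \<rho> \<longleftrightarrow> cond_value r m (kernel_link {..<n} \<rho> (kernel_flip d))
     \<le> cond_value r m0 (kernel_link {..<n} \<rho> (kernel_flip c)) + \<epsilon> / 2 * cond_value r n \<rho>"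

lemma cond_value_bound_of_delta_pre:
  assumes \<rho>_pos: "pos_kernel (grid r n) \<rho>" and delta_pre_le: "delta_pre m0 m n \<Phi> \<Psi> \<le> \<epsilon>"
  shows "cond_value_bound \<epsilon> r \<rho>"
proof -
  let ?V = "cond_value r m0 (kernel_link {..<n} \<rho> (kernel_flip c))" and ?k = "cond_value r n \<rho> / 2"
  have "cond_value r m (kernel_link {..<n} \<rho> (kernel_flip d)) - ?V \<le> t * ?k" if t_gt: "\<epsilon> < t" for t
  proof -
    obtain \<Lambda> l where choi_\<Lambda>: "channel_kernel m m0 l" "has_choi_kernel m m0 \<Lambda> l"
      and dnorm: "dnorm m n (\<lambda>X. \<Phi> (\<Lambda> X) - \<Psi> X) < t"
      by (rule delta_pre_lessE[OF le_less_trans[OF delta_pre_le t_gt]])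
    have "Re (kernel_pair (grid r m) (kernel_link {..<n} \<rho> (kernel_flip d)) a) \<le> ?V + t * ?k"
      if channel_a: "channel_kernel r m a" for a
    proof -
      let ?\<rho> = "kernel_link {..<r} (kernel_flip a) \<rho>"
        and ?F = "\<lambda>p q. kernel_link {..<m0} l c p q - d p q"
      have pulled_pos: "pos_kernel (grid m n) ?\<rho>"
        by (intro pos_kernel_link pos_kernel_flip channel_kernel_pos[OF channel_a] \<rho>_pos) auto
      have pull: "kernel_pair (grid m n) ?\<rho> b = kernel_pair (grid r n) \<rho> (kernel_link {..<m} a b)"
        for b
        by (simp add: kernel_pair_link_right)
      have "kernel_pair (grid m n) ?\<rho> (kernel_link {..<m0} l c)
          = kernel_pair (grid r m0) (kernel_link {..<n} \<rho> (kernel_flip c)) (kernel_link {..<m} a l)"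
        by (subst pull) (simp only: kernel_pair_link_left kernel_flip_flip kernel_link_assoc)
      then have "Re (kernel_pair (grid m n) ?\<rho> (kernel_link {..<m0} l c)) \<le> ?V"
        using cond_value_upper[OF channel_kernel_link[OF channel_a choi_\<Lambda>(1)]] by simp
      moreover have "\<bar>Re (kernel_pair (grid m n) ?\<rho> ?F)\<bar>
          \<le> cond_value m n ?\<rho> * (dnorm m n (\<lambda>X. \<Phi> (\<Lambda> X) - \<Psi> X) / 2)"
        by (rule abs_kernel_pair_balanced_le[OF pos(2,3) pulled_pos balanced_pre_diff[OF choi_\<Lambda>(1)]
          has_choi_kernel_pre_diff[OF choi_\<Lambda>(2)]]) simp
      moreover have "cond_value m n ?\<rho> * (dnorm m n (\<lambda>X. \<Phi> (\<Lambda> X) - \<Psi> X) / 2)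
          \<le> cond_value r n \<rho> * (t / 2)"
        by (intro mult_mono cond_value_link_le[OF pos(3) channel_a] cond_value_nonneg[OF pos(3)]
          \<rho>_pos)
          (use dnorm dnorm_nonneg[OF balanced_pre_diff[OF choi_\<Lambda>(1)]
            has_choi_kernel_pre_diff[OF choi_\<Lambda>(2)]] in auto)
      moreover have "kernel_pair (grid r m) (kernel_link {..<n} \<rho> (kernel_flip d)) a
          = kernel_pair (grid m n) ?\<rho> d"
        by (subst pull) (simp only: kernel_pair_link_left kernel_flip_flip)
      moreover have "kernel_pair (grid m n) ?\<rho> d
          = kernel_pair (grid m n) ?\<rho> (kernel_link {..<m0} l c) - kernel_pair (grid m n) ?\<rho> ?F"
        by (simp only: kernel_pair_linear) simp
      ultimately show ?thesis by (simp add: mult.commute)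
    qed
    from cond_value_least[OF pos(2) this] show ?thesis by (simp add: algebra_simps)
  qed
  from le_mult_at_right[of \<epsilon>, OF this] show ?thesis by (simp add: cond_value_bound_def)
qed

lemma delta_pre_le_of_pos_kernel:
  fixes \<epsilon> \<eta> :: real
  assumes channel_l: "channel_kernel m m0 l" and channel_g: "channel_kernel m n g"
    and "0 \<le> \<epsilon>" "0 < \<eta>"
    and G_pos: "pos_kernel (grid m n) (\<lambda>p q. kernel_link {..<m0} l c p q + of_real (\<epsilon> / 2) * g p q
        - d p q + of_real \<eta> * kernel_one p q)"
      (is "pos_kernel _ ?G")
  shows "delta_pre m0 m n \<Phi> \<Psi> \<le> \<epsilon> + 2 * n * \<eta>"
proof -
  let ?H = "\<lambda>p q. of_real (\<epsilon> / 2) * g p q + of_real \<eta> * kernel_one p q"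
  have H_trace: "partial_trace {..<n} ?H x y = of_real (\<epsilon> / 2 + n * \<eta>) * of_bool (x = y)"
    if "x < m" "y < m" for x y
  proof -
    have "partial_trace {..<n} ?H x y
        = of_real (\<epsilon> / 2) * partial_trace {..<n} g x y + of_real (n * \<eta>) * of_bool (x = y)"
      by (simp add: partial_trace_def sum.distrib sum_distrib_left)
    then show ?thesis
      by (simp only: channel_kernel_partial_trace[OF channel_g that] of_real_add distrib_right)
  qed
  have G_trace: "partial_trace {..<n} ?G x y = of_real (\<epsilon> / 2 + n * \<eta>) * of_bool (x = y)"
    if "x < m" "y < m" for x y
  proof -
    have "partial_trace {..<n} ?G x y = partial_trace {..<n} (kernel_link {..<m0} l c) x y
        - partial_trace {..<n} d x y + partial_trace {..<n} ?H x y"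
      by (simp add: partial_trace_def sum.distrib sum_subtractf)
    then show ?thesis
      unfolding H_trace[OF that] channel_kernel_partial_trace[OF \<Psi>(1) that]
        channel_kernel_partial_trace[OF channel_kernel_link[OF channel_l \<Phi>(1)] that] by simp
  qed
  have "pos_kernel (grid m n) ?H"
    using \<open>0 \<le> \<epsilon>\<close> \<open>0 < \<eta>\<close>
    by (intro pos_kernel_add pos_kernel_scale pos_kernel_one channel_kernel_pos[OF channel_g]) auto
  with G_pos G_trace H_trace have "balanced_kernel m n (\<epsilon> / 2 + n * \<eta>)
      (\<lambda>p q. kernel_link {..<m0} l c p q - d p q)"
    unfolding balanced_kernel_def scaled_channel_kernel_def
    by (intro exI[of _ ?G] exI[of _ ?H] conjI allI impI) auto
  then have "dnorm m n (\<lambda>X. \<Phi> (map_of_kernel m m0 l X) - \<Psi> X) \<le> 2 * (\<epsilon> / 2 + n * \<eta>)"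
    using has_choi_kernel_pre_diff[OF has_choi_kernel_map_of_kernel] by (rule dnorm_le)
      (use assms in simp)
  then show ?thesis
    using delta_pre_le_dnorm[OF channel_map_of_kernel[OF channel_l]] by (simp add: algebra_simps)
qed

lemma kernel_convex_pre_processings:
  "kernel_convex {(\<lambda>p q. kernel_link {..<m0} l c p q + s * g p q - d p q) | l g.
    channel_kernel m m0 l \<and> channel_kernel m n g}"
  unfolding kernel_convex_def
proof (intro ballI allI impI)
  let ?f = "\<lambda>l g p q. kernel_link {..<m0} l c p q + s * g p q - d p q"
  let ?C = "{?f l g | l g. channel_kernel m m0 l \<and> channel_kernel m n g}"
  fix A B and t :: real assume "A \<in> ?C" "B \<in> ?C" and t_bounds: "0 \<le> t" "t \<le> 1"
  then obtain l g l' g' where AB_eq: "A = ?f l g" "B = ?f l' g'"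
    and channels: "channel_kernel m m0 l" "channel_kernel m n g" "channel_kernel m m0 l'"
      "channel_kernel m n g'" by blast
  have "(\<lambda>p q. of_real (1 - t) * A p q + of_real t * B p q)
      = ?f (\<lambda>p q. of_real (1 - t) * l p q + of_real t * l' p q)
          (\<lambda>p q. of_real (1 - t) * g p q + of_real t * g' p q)"
    unfolding AB_eq kernel_link_mix by (simp add: fun_eq_iff algebra_simps)
  moreover have "channel_kernel m m0 (\<lambda>p q. of_real (1 - t) * l p q + of_real t * l' p q)"
    by (rule channel_kernel_mix[OF channels(1,3) t_bounds])
  moreover have "channel_kernel m n (\<lambda>p q. of_real (1 - t) * g p q + of_real t * g' p q)"
    by (rule channel_kernel_mix[OF channels(2,4) t_bounds])
  ultimately show "(\<lambda>p q. of_real (1 - t) * A p q + of_real t * B p q) \<in> ?C"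
    unfolding mem_Collect_eq by (intro exI conjI)
qed

lemma cond_value_bound_test:
  assumes "0 \<le> \<epsilon>" "0 < \<mu>" and bound: "cond_value_bound \<epsilon> m \<rho>"
  obtains l g where "channel_kernel m m0 l" "channel_kernel m n g"
    "- \<mu> < Re (kernel_pair (grid m n) \<rho>
        (\<lambda>p q. kernel_link {..<m0} l c p q + of_real (\<epsilon> / 2) * g p q - d p q))"
proof -
  let ?V = "cond_value m m0 (kernel_link {..<n} \<rho> (kernel_flip c))"
  define \<delta> where "\<delta> = \<mu> / (\<epsilon> + 2)"
  have "(\<epsilon> + 2) * \<delta> = \<mu>" using \<open>0 \<le> \<epsilon>\<close> by (simp add: \<delta>_def)
  moreover have "0 < \<delta>" using \<open>0 < \<mu>\<close> \<open>0 \<le> \<epsilon>\<close> by (simp add: \<delta>_def)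
  ultimately have small: "\<delta> + \<epsilon> / 2 * \<delta> < \<mu>" using \<open>0 < \<mu>\<close> by (simp add: distrib_right)
  obtain l where channel_l: "channel_kernel m m0 l"
    and l_value: "?V - \<delta> < Re (kernel_pair (grid m m0) (kernel_link {..<n} \<rho> (kernel_flip c)) l)"
    by (rule cond_value_approx[OF pos(1) \<open>0 < \<delta>\<close>])
  obtain g where channel_g: "channel_kernel m n g"
    and g_value: "cond_value m n \<rho> - \<delta> < Re (kernel_pair (grid m n) \<rho> g)"
    by (rule cond_value_approx[OF pos(3) \<open>0 < \<delta>\<close>])
  have "Re (kernel_pair (grid m n) \<rho> d) \<le> ?V + \<epsilon> / 2 * cond_value m n \<rho>"
    using kernel_pair_le_cond_value[OF \<Psi>(1)] bound unfolding cond_value_bound_def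
    by (rule order_trans)
  also have "\<dots> < Re (kernel_pair (grid m n) \<rho> (kernel_link {..<m0} l c))
      + \<epsilon> / 2 * Re (kernel_pair (grid m n) \<rho> g) + \<mu>"
    using l_value small mult_left_mono[OF less_imp_le[OF g_value], of "\<epsilon> / 2"] \<open>0 \<le> \<epsilon>\<close>
    by (simp add: kernel_pair_link_left right_diff_distrib)
  finally have "- \<mu> < Re (kernel_pair (grid m n) \<rho>
      (\<lambda>p q. kernel_link {..<m0} l c p q + of_real (\<epsilon> / 2) * g p q - d p q))"
    unfolding kernel_pair_linear by simp
  with channel_l channel_g show ?thesis by (rule that)
qed

lemma delta_pre_le_of_cond_value_bound:
  assumes "0 \<le> \<epsilon>" and bound: "\<And>\<rho>. state_kernel (grid m n) \<rho> \<Longrightarrow> cond_value_bound \<epsilon> m \<rho>"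
  shows "delta_pre m0 m n \<Phi> \<Psi> \<le> \<epsilon>"
proof (rule field_le_epsilon)
  fix e :: real assume "0 < e"
  define \<eta> where "\<eta> = e / (2 * n)"
  have "0 < \<eta>" using \<open>0 < e\<close> pos by (simp add: \<eta>_def)
  let ?f = "\<lambda>l g p q. kernel_link {..<m0} l c p q + of_real (\<epsilon> / 2) * g p q - d p q"
  let ?C = "{?f l g | l g. channel_kernel m m0 l \<and> channel_kernel m n g}"
  obtain A where "A \<in> ?C"
    and A_pos: "pos_kernel (grid m n) (\<lambda>p q. A p q + of_real \<eta> * kernel_one p q)"
  proof (rule pos_kernel_minimax[of "grid m n" ?C \<eta>])
    show "?C \<noteq> {}" using channel_kernel_depolarising[OF pos(1)] \<Psi>(1) by blast
    show "kernel_convex ?C" by (rule kernel_convex_pre_processings)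
    show "herm_kernel (grid m n) A" if A_in: "A \<in> ?C" for A
    proof -
      obtain l g where "A = ?f l g" "channel_kernel m m0 l" "channel_kernel m n g"
        using A_in by blast
      moreover have "herm_kernel (grid m n) b" if "channel_kernel m n b" for b
        by (rule pos_kernel_herm[OF _ channel_kernel_pos[OF that]]) simp
      ultimately show ?thesis
        using channel_kernel_link[OF _ \<Phi>(1)] \<Psi>(1)
        by (simp add: herm_kernel_diff herm_kernel_add herm_kernel_scale del: of_real_divide)
    qed
    fix \<rho> \<mu> assume \<rho>_state: "state_kernel (grid m n) \<rho>" and "0 < (\<mu> :: real)"
    obtain l g where "channel_kernel m m0 l" "channel_kernel m n g"
      and test: "- \<mu> < Re (kernel_pair (grid m n) \<rho> (?f l g))"
      by (rule cond_value_bound_test[OF assms(1) \<open>0 < \<mu>\<close> bound[OF \<rho>_state]])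
    then have "?f l g \<in> ?C" by blast
    with test show "\<exists>A\<in>?C. - \<mu> < Re (kernel_pair (grid m n) \<rho> A)" by (rule bexI)
  qed (use \<open>0 < \<eta>\<close> in auto)
  then obtain l g where "A = ?f l g" "channel_kernel m m0 l" "channel_kernel m n g" by blast
  with delta_pre_le_of_pos_kernel[of l g \<epsilon> \<eta>] A_pos have "delta_pre m0 m n \<Phi> \<Psi> \<le> \<epsilon> + 2 * n * \<eta>"
    using \<open>0 \<le> \<epsilon>\<close> \<open>0 < \<eta>\<close> by simp
  then show "delta_pre m0 m n \<Phi> \<Psi> \<le> \<epsilon> + e" using pos by (simp add: \<eta>_def)
qed

lemma cond_value_bound_cong:
  assumes "\<And>p q. p \<in> grid r n \<Longrightarrow> q \<in> grid r n \<Longrightarrow> \<rho> p q = \<rho>' p q"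
  shows "cond_value_bound \<epsilon> r \<rho> \<longleftrightarrow> cond_value_bound \<epsilon> r \<rho>'"
proof -
  have "cond_value r k (kernel_link {..<n} \<rho> b) = cond_value r k (kernel_link {..<n} \<rho>' b)" for k b
    by (intro cond_value_cong kernel_link_cong[OF assms refl])
  moreover have "cond_value r n \<rho> = cond_value r n \<rho>'" by (rule cond_value_cong[OF assms])
  ultimately show ?thesis by (simp add: cond_value_bound_def)
qed

lemma cond_ii_iff_cond_value_bound:
  "cond_ii m0 m n \<Phi> \<Psi> \<epsilon> r \<longleftrightarrow>
    (\<forall>\<rho>. state_kernel (grid r n) \<rho> \<longrightarrow> cond_value_bound \<epsilon> r \<rho>)"
proof -
  have cond_ii_iff: "cond_ii m0 m n \<Phi> \<Psi> \<epsilon> r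
      \<longleftrightarrow> (\<forall>\<rho>. state (r * n) \<rho> \<longrightarrow> cond_value_bound \<epsilon> r (bip_kernel n \<rho>))"
    unfolding cond_ii_def cond_value_bound_def cond_dnorm_map_transp[OF \<Phi>]
      cond_dnorm_map_transp[OF \<Psi>]
    using cond_dnorm_eq_cond_value[of _ r n] by (auto simp: state_def psd_def)
  show ?thesis
    unfolding cond_ii_iff
  proof (intro iffI allI impI)
    fix \<rho> assume bound: "\<forall>\<rho>. state (r * n) \<rho> \<longrightarrow> cond_value_bound \<epsilon> r (bip_kernel n \<rho>)"
      and \<rho>_state: "state_kernel (grid r n) \<rho>"
    have "state (r * n) (bip_mat r n \<rho>)" by (rule state_bip_mat[OF \<rho>_state])
    with bound show "cond_value_bound \<epsilon> r \<rho>"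
      using cond_value_bound_cong[of r "bip_kernel n (bip_mat r n \<rho>)" \<rho>, OF bip_kernel_bip_mat]
      by blast
  qed (use state_kernel_bip_kernel in blast)
qed

lemma cond_iii_iff:
  "cond_iii m0 m n \<Phi> \<Psi> \<epsilon> r \<longleftrightarrow>
    (\<forall>k lam rho M. ensemble (r * n) k lam rho \<longrightarrow> measurement (n * n) k M \<longrightarrow>
     cond_value r m (kernel_link {..<n} (ensemble_kernel n k lam rho M) (kernel_flip d))
     \<le> cond_value r m0 (kernel_link {..<n} (ensemble_kernel n k lam rho M) (kernel_flip c))
         + \<epsilon> / 2 * psucc_opt (r * n) k lam rho)"
  unfolding cond_iii_def using Sup_psucc_eq_cond_value[OF \<Phi>(2)] Sup_psucc_eq_cond_value[OF \<Psi>(2)]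
  by simp

lemma cond_iii_of_cond_value_bound:
  assumes "0 \<le> \<epsilon>" and bound: "\<And>\<rho>. pos_kernel (grid r n) \<rho> \<Longrightarrow> cond_value_bound \<epsilon> r \<rho>"
  shows "cond_iii m0 m n \<Phi> \<Psi> \<epsilon> r"
  unfolding cond_iii_iff
proof (intro allI impI)
  fix k lam rho M assume game: "ensemble (r * n) k lam rho" "measurement (n * n) k M"
  have "\<epsilon> / 2 * cond_value r n (ensemble_kernel n k lam rho M)
      \<le> \<epsilon> / 2 * psucc_opt (r * n) k lam rho"
    using cond_value_ensemble_kernel_le[OF pos(3) game] \<open>0 \<le> \<epsilon>\<close> by (intro mult_left_mono) auto
  with bound[OF pos_kernel_ensemble_kernel[OF game]]
  show "cond_value r m (kernel_link {..<n} (ensemble_kernel n k lam rho M) (kernel_flip d))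
     \<le> cond_value r m0 (kernel_link {..<n} (ensemble_kernel n k lam rho M) (kernel_flip c))
         + \<epsilon> / 2 * psucc_opt (r * n) k lam rho"
    unfolding cond_value_bound_def by linarith
qed

end

section \<open>Weyl unitaries and the guessing game\<close>

definition unitary_basis :: "nat \<Rightarrow> (nat \<Rightarrow> nat \<Rightarrow> nat \<Rightarrow> complex) \<Rightarrow> bool" where
  "unitary_basis n u \<longleftrightarrow>
     (\<forall>i<n * n. \<forall>a<n. \<forall>b<n. (\<Sum>x<n. u i x a * cnj (u i x b)) = of_bool (a = b)) \<and>
     (\<forall>i<n * n. \<forall>x<n. \<forall>y<n. (\<Sum>a<n. u i x a * cnj (u i y a)) = of_bool (x = y)) \<and>
     (\<forall>a<n. \<forall>b<n. \<forall>x<n. \<forall>y<n. (\<Sum>i<n * n. u i x a * cnj (u i y b))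
         = of_nat n * of_bool (a = b \<and> x = y))"

definition root1 :: "nat \<Rightarrow> nat \<Rightarrow> complex" where
  "root1 n a = cis (2 * pi * real a / real n)"

definition weyl :: "nat \<Rightarrow> nat \<Rightarrow> nat \<Rightarrow> nat \<Rightarrow> complex" where
  "weyl n i x a = of_bool (x = (a + i div n) mod n) * root1 n a ^ (i mod n)"

lemma root1_mult_cnj: "root1 n a * cnj (root1 n a) = 1"
  by (simp add: root1_def cis_cnj cis_mult)

lemma sum_root1_orthogonal:
  assumes "a < n" "b < n"
  shows "(\<Sum>l<n. root1 n a ^ l * cnj (root1 n b ^ l)) = of_nat n * of_bool (a = b)"
proof (cases "a = b")
  case True
  then show ?thesis by (simp add: root1_mult_cnj flip: power_mult_distrib)
next
  case False
  define z where "z = root1 n a * cnj (root1 n b)"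
  have "inj_on (root1 n) {..<n}"
    using bij_betw_roots_unity[of n] assms(1) unfolding root1_def by (auto simp: bij_betw_def)
  then have "root1 n a \<noteq> root1 n b" using False assms by (auto dest: inj_onD)
  then have "z \<noteq> 1"
    unfolding z_def by (metis mult.assoc mult.commute mult_1 root1_mult_cnj)
  moreover have "root1 n c ^ n = 1" for c
    using assms(1) cis_multiple_2pi[of "real c"] by (simp add: root1_def DeMoivre)
  then have "z ^ n = 1" unfolding z_def power_mult_distrib by (simp flip: complex_cnj_power)
  ultimately have "(\<Sum>l<n. z ^ l) = 0" by (simp add: geometric_sum)
  then show ?thesis using False by (simp add: z_def power_mult_distrib)
qed

lemma inj_on_add_mod: "inj_on (\<lambda>a. (a + k) mod n) {..<n :: nat}"
proof (rule inj_onI)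
  fix a b assume ab_eq: "a \<in> {..<n}" "b \<in> {..<n}" "(a + k) mod n = (b + k) mod n"
  then obtain q q' where "a + k + n * q = b + k + n * q'" by (auto simp: nat_mod_eq_iff)
  then have "(a + n * q) mod n = (b + n * q') mod n" by simp
  with ab_eq show "a = b" by simp
qed

lemma sum_add_mod: "(\<Sum>a<n. g ((a + k) mod n)) = (\<Sum>x<n :: nat. g x)"
proof (rule sum.reindex_bij_betw)
  have "(\<lambda>a. (a + k) mod n) ` {..<n} \<subseteq> {..<n}" by (cases "n = 0") auto
  then show "bij_betw (\<lambda>a. (a + k) mod n) {..<n} {..<n}"
    using inj_on_add_mod[of k n] endo_inj_surj[of "{..<n}" "\<lambda>a. (a + k) mod n"]
    by (simp add: bij_betw_def)
qed

lemma weyl_mult_cnj: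
  "weyl n i x a * cnj (weyl n i y a)
      = of_bool (x = (a + i div n) mod n) * of_bool (y = (a + i div n) mod n)"
  by (simp add: weyl_def root1_mult_cnj flip: power_mult_distrib)

lemma sum_weyl:
  assumes "a < n" "b < n" "x < n" "y < n"
  shows "(\<Sum>i<n * n. weyl n i x a * cnj (weyl n i y b)) = of_nat n * of_bool (a = b \<and> x = y)"
proof -
  have "(\<Sum>i<n * n. weyl n i x a * cnj (weyl n i y b)) =
     (\<Sum>k<n. \<Sum>l<n. weyl n (grid_index n (k, l)) x a * cnj (weyl n (grid_index n (k, l)) y b))"
    by (simp add: sum.reindex_bij_betw[OF bij_betw_grid_index, symmetric] sum.cartesian_product')
  also have "\<dots> = (\<Sum>k<n. of_bool (x = (a + k) mod n) * of_bool (y = (b + k) mod n) *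
       (\<Sum>l<n. root1 n a ^ l * cnj (root1 n b ^ l)))"
    unfolding sum_distrib_left by (intro sum.cong refl) (simp add: weyl_def grid_index_def)
  also have "\<dots> = (\<Sum>k<n. of_bool (x = (k + a) mod n) * of_bool (y = (k + a) mod n)
      * (of_nat n * of_bool (a = b)))"
    unfolding sum_root1_orthogonal[OF assms(1,2)] by (intro sum.cong refl) (simp add: add.commute)
  also have "\<dots> = (\<Sum>z<n. of_bool (x = z) * of_bool (y = z) * (of_nat n * of_bool (a = b)))"
    by (rule sum_add_mod[of "\<lambda>z. of_bool (x = z) * of_bool (y = z) * (of_nat n * of_bool (a = b))"])
  also have "\<dots> = of_nat n * of_bool (a = b \<and> x = y)"
    using assms(3) by (auto simp: mult.assoc)
  finally show ?thesis .
qed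

lemma unitary_basis_weyl: "unitary_basis n (weyl n)"
  unfolding unitary_basis_def
proof (intro conjI allI impI sum_weyl)
  fix i a b assume ab_less: "a < n" "b < n"
  show "(\<Sum>x<n. weyl n i x a * cnj (weyl n i x b)) = of_bool (a = b)"
  proof (cases "a = b")
    case True
    then show ?thesis using ab_less by (simp add: weyl_mult_cnj)
  next
    case False
    then have "(a + i div n) mod n \<noteq> (b + i div n) mod n"
      using ab_less inj_on_add_mod[of "i div n" n] by (auto dest: inj_onD)
    then show ?thesis using False by (simp add: weyl_def sum.neutral)
  qed
next
  fix i x y assume "x < n" "y < n"
  have "(\<Sum>a<n. weyl n i x a * cnj (weyl n i y a)) = (\<Sum>z<n. of_bool (x = z) * of_bool (y = z))"
    unfolding weyl_mult_cnj by (rule sum_add_mod[of "\<lambda>z. of_bool (x = z) * of_bool (y = z)"])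
  then show "(\<Sum>a<n. weyl n i x a * cnj (weyl n i y a)) = of_bool (x = y)" using \<open>x < n\<close> by simp
qed

definition unitary_kernel :: "(nat \<Rightarrow> nat \<Rightarrow> complex) \<Rightarrow> (nat \<times> nat) kernel" where
  "unitary_kernel v = kernel_rank1 (\<lambda>p. v (snd p) (fst p))"

lemma pos_unitary_kernel: "pos_kernel I (unitary_kernel v)"
  unfolding unitary_kernel_def by (rule pos_kernel_rank1)

context
  fixes n :: nat and u :: "nat \<Rightarrow> nat \<Rightarrow> nat \<Rightarrow> complex"
  assumes n: "0 < n" and u: "unitary_basis n u"
begin

definition unitary_measurement :: "nat \<Rightarrow> complex mat" where
  "unitary_measurement i = bip_mat n n (\<lambda>p q. of_real (1 / n) * unitary_kernel (u i) p q)"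

definition unitary_ensemble :: "nat \<Rightarrow> (nat \<times> nat) kernel \<Rightarrow> nat \<Rightarrow> complex mat" where
  "unitary_ensemble r C i = bip_mat r n (kernel_link {..<n} C (unitary_kernel (u i)))"

lemma measurement_unitary_basis: "measurement (n * n) (n * n) unitary_measurement"
  unfolding measurement_iff_bip_kernel
proof (intro conjI allI impI ballI)
  show "psd (n * n) (unitary_measurement i)" for i
    unfolding unitary_measurement_def
    by (intro psd_bip_mat pos_kernel_scale pos_unitary_kernel) simp
  fix p q assume in_grid: "p \<in> grid n n" "q \<in> grid n n"
  have "(\<Sum>i<n * n. bip_kernel n (unitary_measurement i) p q)
      = of_real (1 / n) * (\<Sum>i<n * n. u i (snd p) (fst p) * cnj (u i (snd q) (fst q)))"
    by (simp add: unitary_measurement_def bip_kernel_bip_mat in_grid unitary_kernel_def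
      kernel_rank1_def flip: sum_divide_distrib)
  also have "\<dots> = of_bool (p = q)"
    using u in_grid n by (auto simp: unitary_basis_def prod_eq_iff)
  finally show "(\<Sum>i<n * n. bip_kernel n (unitary_measurement i) p q) = of_bool (p = q)" .
qed

lemma ensemble_unitary_basis:
  assumes C_state: "state_kernel (grid r n) C"
  shows "ensemble (r * n) (n * n) (\<lambda>i. 1 / (n * n)) (unitary_ensemble r C)"
proof -
  have "state (r * n) (unitary_ensemble r C i)" if "i < n * n" for i
  proof -
    have "pos_kernel (grid r n) (kernel_link {..<n} C (unitary_kernel (u i)))"
      using C_state by (intro pos_kernel_link pos_unitary_kernel) (auto simp: state_kernel_def)
    moreover have "partial_trace {..<n} (kernel_link {..<n} C (unitary_kernel (u i))) s t
        = 1 * partial_trace {..<n} C s t" for s t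
      using u that
      by (intro partial_trace_link)
        (auto simp: partial_trace_def unitary_kernel_def kernel_rank1_def unitary_basis_def)
    then have "kernel_trace (grid r n) (kernel_link {..<n} C (unitary_kernel (u i)))
        = kernel_trace (grid r n) C"
      by (simp add: kernel_trace_prod) (simp add: kernel_trace_def)
    ultimately show ?thesis
      using C_state unfolding unitary_ensemble_def by (intro state_bip_mat)
        (simp add: state_kernel_def)
  qed
  then show ?thesis using n by (simp add: ensemble_def)
qed

lemma ensemble_kernel_unitary_basis:
  assumes "p \<in> grid r n" "q \<in> grid r n"
  shows "ensemble_kernel n (n * n) (\<lambda>i. 1 / (n * n)) (unitary_ensemble r C) unitary_measurement p q
      = of_real (1 / n) * C p q"
proof -
  have "kernel_link {..<n} (bip_kernel n (unitary_ensemble r C i))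
      (kernel_flip (effect_kernel n (unitary_measurement i))) p q = of_real (1 / n) * C p q"
    if i_less: "i < n * n" for i
  proof -
    let ?U = "unitary_kernel (u i)"
    have link_id: "kernel_link {..<n} ?U (kernel_flip (kernel_transpose ?U)) a b = id_kernel a b"
      if "a \<in> grid n n" "b \<in> grid n n" for a b
    proof -
      have "kernel_flip (kernel_transpose ?U) = kernel_rank1 (\<lambda>p. cnj (u i (fst p) (snd p)))"
        by (simp add: unitary_kernel_def kernel_flip_def kernel_transpose_def kernel_rank1_def
          fun_eq_iff mult.commute)
      then show ?thesis
        using u i_less that
        by (simp add: unitary_kernel_def kernel_link_rank1 id_kernel_def kernel_rank1_def
            unitary_basis_def mem_Times_iff)
    qed
    have "kernel_link {..<n} (bip_kernel n (unitary_ensemble r C i))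
        (kernel_flip (effect_kernel n (unitary_measurement i))) p q
        = kernel_link {..<n} (kernel_link {..<n} C ?U)
            (\<lambda>p q. of_real (1 / n) * kernel_flip (kernel_transpose ?U) p q) p q"
      using assms
      by (intro kernel_link_cong)
        (auto simp: unitary_ensemble_def unitary_measurement_def bip_kernel_bip_mat
          kernel_flip_def kernel_transpose_def)
    also have "\<dots> = of_real (1 / n)
        * kernel_link {..<n} C (kernel_link {..<n} ?U (kernel_flip (kernel_transpose ?U))) p q"
      by (simp add: kernel_link_assoc[symmetric]) (simp add: kernel_link_def sum_divide_distrib)
    also have "kernel_link {..<n} C (kernel_link {..<n} ?U (kernel_flip (kernel_transpose ?U))) p q
        = kernel_link {..<n} C id_kernel p q"
      using assms by (intro kernel_link_cong[OF refl link_id]) auto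
    also have "\<dots> = C p q" by (rule kernel_link_id_right[OF finite_lessThan assms])
    finally show ?thesis .
  qed
  then show ?thesis using n by (simp add: ensemble_kernel_def)
qed

lemma channel_kernel_unitary_basis:
  assumes measurement: "measurement (r * n) (n * n) N"
  shows "channel_kernel r n (\<lambda>p q. \<Sum>i<n * n. of_real (1 / n) *
    kernel_link {..<n} (effect_kernel n (N i)) (kernel_flip (unitary_kernel (u i))) p q)"
    (is "channel_kernel r n (\<lambda>p q. \<Sum>i<n * n. of_real (1 / n) * ?L i p q)")
  unfolding channel_kernel_def
proof (intro conjI allI impI)
  have "pos_kernel (grid r n) (?L i)" if "i < n * n" for i
    using measurement that
    by (intro pos_kernel_link pos_kernel_transpose pos_kernel_flip pos_unitary_kernel)
      (auto simp: measurement_def psd_iff_pos_bip_kernel)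
  then show "pos_kernel (grid r n) (\<lambda>p q. \<Sum>i<n * n. of_real (1 / n) * ?L i p q)"
    by (intro pos_kernel_sum pos_kernel_scale) auto
  fix s t assume st_less: "s < r" "t < r"
  have trace_L: "partial_trace {..<n} (?L i) s t = (\<Sum>x<n. bip_kernel n (N i) (t, x) (s, x))"
    if "i < n * n" for i
  proof -
    have "partial_trace {..<n} (?L i) s t = 1 * partial_trace {..<n} (effect_kernel n (N i)) s t"
      using u that
      by (intro partial_trace_link)
        (auto simp: partial_trace_def kernel_flip_def unitary_kernel_def kernel_rank1_def
          unitary_basis_def)
    then show ?thesis by (simp add: partial_trace_def kernel_transpose_def)
  qed
  have "partial_trace {..<n} (\<lambda>p q. \<Sum>i<n * n. of_real (1 / n) * ?L i p q) s t
      = of_real (1 / n) * (\<Sum>i<n * n. partial_trace {..<n} (?L i) s t)"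
    unfolding partial_trace_def sum_distrib_left by (rule sum.swap)
  also have "(\<Sum>i<n * n. partial_trace {..<n} (?L i) s t)
      = (\<Sum>x<n. \<Sum>i<n * n. bip_kernel n (N i) (t, x) (s, x))"
    by (subst sum.swap) (simp add: trace_L)
  also have "\<dots> = (\<Sum>x<n. of_bool (s = t))"
    using measurement st_less unfolding measurement_iff_bip_kernel by (intro sum.cong) auto
  finally show "partial_trace {..<n} (\<lambda>p q. \<Sum>i<n * n. of_real (1 / n) * ?L i p q) s t
      = of_bool (s = t)"
    using n by simp
qed

lemma psucc_opt_unitary_basis_le:
  "psucc_opt (r * n) (n * n) (\<lambda>i. 1 / (n * n)) (unitary_ensemble r C) \<le> cond_value r n C / n"
  unfolding psucc_opt_def
proof (rule cSup_least)
  show "{psucc (n * n) (\<lambda>i. 1 / (n * n)) (unitary_ensemble r C) N | N.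
      measurement (r * n) (n * n) N} \<noteq> {}"
    using measurement_pullback[OF channel_kernel_depolarising[OF n] measurement_unitary_basis]
    by blast
  fix z assume "z \<in> {psucc (n * n) (\<lambda>i. 1 / (n * n)) (unitary_ensemble r C) N | N.
      measurement (r * n) (n * n) N}"
  then obtain N where z_eq: "z = psucc (n * n) (\<lambda>i. 1 / (n * n)) (unitary_ensemble r C) N"
    and measurement: "measurement (r * n) (n * n) N" by blast
  let ?T = "\<lambda>i. effect_kernel n (N i)"
  let ?L = "\<lambda>i. kernel_link {..<n} (?T i) (kernel_flip (unitary_kernel (u i)))"
  have "mtrace (unitary_ensemble r C i * N i) = kernel_pair (grid r n) C (?L i)"
    if i_less: "i < n * n" for i
  proof -
    have "mtrace (unitary_ensemble r C i * N i)
        = kernel_pair (grid r n) (kernel_link {..<n} C (unitary_kernel (u i))) (?T i)"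
      unfolding unitary_ensemble_def mtrace_mult_bip_kernel[OF bip_mat_carrier
        measurement_carrier[OF measurement i_less]]
      by (rule kernel_pair_cong) (simp_all add: bip_kernel_bip_mat)
    then show ?thesis by (simp add: kernel_pair_link_left)
  qed
  then have "z = (\<Sum>i<n * n. Re (kernel_pair (grid r n) C (?L i))) / (n * n)"
    by (simp add: z_eq psucc_def sum_divide_distrib)
  also have "\<dots> = Re (kernel_pair (grid r n) C (\<lambda>p q. \<Sum>i<n * n. of_real (1 / n) * ?L i p q)) / n"
    unfolding kernel_pair_sum kernel_pair_linear by (simp flip: sum_divide_distrib)
  also have "\<dots> \<le> cond_value r n C / n"
    by (intro divide_right_mono cond_value_upper channel_kernel_unitary_basis measurement) simp
  finally show "z \<le> cond_value r n C / n" .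
qed

end

lemma (in channel_pair) cond_value_bound_of_cond_iii:
  assumes "0 \<le> \<epsilon>" and iii: "cond_iii m0 m n \<Phi> \<Psi> \<epsilon> r" and C_state: "state_kernel (grid r n) C"
  shows "cond_value_bound \<epsilon> r C"
proof -
  note basis = pos(3) unitary_basis_weyl[of n]
  let ?lam = "\<lambda>i. 1 / (n * n)" and ?\<rho> = "unitary_ensemble n (weyl n) r C"
    and ?M = "unitary_measurement n (weyl n)"
  let ?E = "ensemble_kernel n (n * n) ?lam ?\<rho> ?M"
  have scaled: "cond_value r k (kernel_link {..<n} ?E (kernel_flip b))
      = cond_value r k (kernel_link {..<n} C (kernel_flip b)) / n"
    if "0 < k" for k b
  proof -
    have "cond_value r k (kernel_link {..<n} ?E (kernel_flip b))
        = cond_value r k (kernel_link {..<n} (\<lambda>p q. of_real (1 / n) * C p q) (kernel_flip b))"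
      by (intro cond_value_cong kernel_link_cong[OF ensemble_kernel_unitary_basis[OF basis] refl])
    also have "\<dots> = cond_value r k
        (\<lambda>p q. of_real (1 / n) * kernel_link {..<n} C (kernel_flip b) p q)"
      by (simp add: kernel_link_def[abs_def] sum_divide_distrib)
    finally show ?thesis using cond_value_scale[OF that, of "1 / n" r] pos(3) by simp
  qed
  have "cond_value r m (kernel_link {..<n} C (kernel_flip d)) / n
      \<le> cond_value r m0 (kernel_link {..<n} C (kernel_flip c)) / n
          + \<epsilon> / 2 * psucc_opt (r * n) (n * n) ?lam ?\<rho>"
    using iii[unfolded cond_iii_iff, rule_format, OF ensemble_unitary_basis[OF basis C_state]
      measurement_unitary_basis[OF basis]]
    by (simp only: scaled[OF pos(1)] scaled[OF pos(2)])
  also have "\<dots> \<le> cond_value r m0 (kernel_link {..<n} C (kernel_flip c)) / n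
      + \<epsilon> / 2 * (cond_value r n C / n)"
    using psucc_opt_unitary_basis_le[OF basis, of r C] \<open>0 \<le> \<epsilon>\<close>
    by (intro add_left_mono mult_left_mono) auto
  finally show ?thesis
    using pos(3) by (simp add: cond_value_bound_def divide_right_mono field_simps)
qed

theorem theorem6:
  fixes dA0 dA0' dA1 :: nat and \<Phi>1 \<Phi>2 :: cmap and \<epsilon> :: real
  assumes "0 < dA0" and "0 < dA0'" and "0 < dA1"
    and "channel dA0 dA1 \<Phi>1" and "channel dA0' dA1 \<Phi>2"
    and "0 \<le> \<epsilon>"
  shows "(delta_pre dA0 dA0' dA1 \<Phi>1 \<Phi>2 \<le> \<epsilon> \<longleftrightarrow>
            (\<forall>dR>0. cond_ii dA0 dA0' dA1 \<Phi>1 \<Phi>2 \<epsilon> dR))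
       \<and> (delta_pre dA0 dA0' dA1 \<Phi>1 \<Phi>2 \<le> \<epsilon> \<longleftrightarrow>
            (\<forall>dR>0. cond_iii dA0 dA0' dA1 \<Phi>1 \<Phi>2 \<epsilon> dR))
       \<and> (delta_pre dA0 dA0' dA1 \<Phi>1 \<Phi>2 \<le> \<epsilon> \<longleftrightarrow>
            cond_ii dA0 dA0' dA1 \<Phi>1 \<Phi>2 \<epsilon> dA0')
       \<and> (delta_pre dA0 dA0' dA1 \<Phi>1 \<Phi>2 \<le> \<epsilon> \<longleftrightarrow>
            cond_iii dA0 dA0' dA1 \<Phi>1 \<Phi>2 \<epsilon> dA0')"
proof -
  obtain c d where choi_\<Phi>1: "channel_kernel dA0 dA1 c" "has_choi_kernel dA0 dA1 \<Phi>1 c"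
    and choi_\<Phi>2: "channel_kernel dA0' dA1 d" "has_choi_kernel dA0' dA1 \<Phi>2 d"
    using assms(4,5) by (blast elim: channelE)
  interpret channel_pair dA0 dA0' dA1 \<Phi>1 \<Phi>2 c d
    by unfold_locales (use assms(1-3) choi_\<Phi>1 choi_\<Phi>2 in auto)
  have "cond_ii dA0 dA0' dA1 \<Phi>1 \<Phi>2 \<epsilon> r" "cond_iii dA0 dA0' dA1 \<Phi>1 \<Phi>2 \<epsilon> r"
    if "delta_pre dA0 dA0' dA1 \<Phi>1 \<Phi>2 \<le> \<epsilon>" for r
    using cond_value_bound_of_delta_pre[OF _ that] cond_iii_of_cond_value_bound[OF assms(6)]
    unfolding cond_ii_iff_cond_value_bound state_kernel_def by blast+
  moreover have "delta_pre dA0 dA0' dA1 \<Phi>1 \<Phi>2 \<le> \<epsilon>" if "cond_ii dA0 dA0' dA1 \<Phi>1 \<Phi>2 \<epsilon> dA0'"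
    using that delta_pre_le_of_cond_value_bound[OF assms(6)] unfolding cond_ii_iff_cond_value_bound
    by blast
  moreover have "delta_pre dA0 dA0' dA1 \<Phi>1 \<Phi>2 \<le> \<epsilon>" if "cond_iii dA0 dA0' dA1 \<Phi>1 \<Phi>2 \<epsilon> dA0'"
    using cond_value_bound_of_cond_iii[OF assms(6) that]
    by (rule delta_pre_le_of_cond_value_bound[OF assms(6)])
  ultimately show ?thesis using assms(2) by blast
qed

end
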